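(* Let $\alpha\in(0,1]$, let $N\ge1$ be an integer, let $\mathbf{X}$ be an $\alpha$-Hölder weakly geometric (resp. branched) rough path over $\mathbb{R}^{1+d}$ on $[0,T]$, and let $f=(f_0,\dots,f_d)$ be a collection of vector fields on $\mathbb{R}^e$ which are as regular as required for all the operations and RDEs below to make sense. (i) Let $v=(v_0,v_1,\dots,v_d)$ be a collection of elements of $\mathcal{L}^N(\mathbb{R}^{1+d})$ (resp. of $\mathcal{B}^N$). Then $Y$ is an RDE solution flow to $$dY=f(Y)\,d(T_v\mathbf{X})\qquad(\text{resp. } dY=f(Y)\,d(M_v\mathbf{X}))$$ if and only if $Y$ is an RDE solution flow to $$dY=f^v(Y)\,d\mathbf{X}.$$ (ii) Let $v=(v_0,0,\dots,0)$ with $v_0\in\mathcal{L}^N(\mathbb{R}^{1+d})$ (resp. $v_0\in\mathcal{B}^N$), and suppose that $$\max_{|w|\le\lfloor 1/\alpha\rfloor}\ \sup_{u\ne r\in[0,T]}\frac{|\langle \mathbf{X}_{u,r},w\rangle|}{|r-u|^{(1-\alpha)|w|_0+\alpha|w|}}<\infty ,$$ where the max runs over all words $w\in T(\mathbb{R}^{1+d})$ (resp. forests $w\in\mathcal{H}$) with length (resp. number of nodes) $|w|\le\lfloor1/\alpha\rfloor$ and $|w|_0$ is the number of occurrences of the letter $e_0$ (resp. label $0$) in $w$. Then $Y$ is an RDE solution flow to $$dY=f(Y)\,d(T_v\mathbf{X})\qquad(\text{resp. } dY=f(Y)\,d(M_v\mathbf{X}))$$ if and only if $Y$ is an RDE solution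 flow to $$dY=f^v(Y)\,d\mathbf{X}\equiv f(Y)\,d\mathbf{X}+f_{v_0}(Y)\,dX^0 ,$$ where $X^0$ denotes the zeroth component of the path underlying $\mathbf{X}$.
   Context: **Geometric setting.** $\{e_0,\dots,e_d\}$ is the standard basis of $\mathbb{R}^{1+d}$. $T((\mathbb{R}^{1+d}))=\prod_{k\ge0}(\mathbb{R}^{1+d})^{\otimes k}$ (tensor series, product topology) with tensor product $*$; $T(\mathbb{R}^{1+d})=\bigoplus_{k\ge0}(\mathbb{R}^{1+d})^{\otimes k}$ has words $e_{i_1\dots i_k}$ as basis, in duality with $T((\mathbb{R}^{1+d}))$ with words orthonormal; $\sqcup\!\sqcup$ is the shuffle product. $\mathcal{L}((\mathbb{R}^{1+d}))$ is the space of Lie series, $\mathcal{L}^N(\mathbb{R}^{1+d})$ the step-$N$ free nilpotent Lie algebra, identified with Lie polynomials of degree at most $N$. For $v=(v_0,\dots,v_d)\subset\mathcal{L}((\mathbb{R}^{1+d}))$, $T_v$ is the unique continuous algebra morphism of $(T((\mathbb{R}^{1+d})),* )$ with $T_v(e_i)=e_i+v_i$. An $\alpha$-Hölder weakly geometric rough path is a map $\mathbf{X}:[0,T]^2\to T((\mathbb{R}^{1+d}))$ with $\langle\mathbf{X}_{s,t},x\sqcup\!\sqcup y\rangle=\langle\mathbf{X}_{s,t},x\rangle\langle\mathbf{X}_{s,t},y\rangle$, $\mathbf{X}_{s,t}=\mathbf{X}_{s,u}*\mathbf{X}_{u,t}$, and $\sup_{s\ne t}|\langle\mathbf{X}_{s,t},w\rangle|/|t-s|^{\alpha|w|}<\infty$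 for every word $w$. **Branched setting.** $\mathcal{B}$ is the real vector space spanned by unordered rooted trees with nodes labelled by $\{0,\dots,d\}$; $\mathcal{H}$ is spanned by forests (including the empty forest $1$), i.e. the free commutative algebra over $\mathcal{B}$ with product $\odot$, graded by the number of nodes. $\bullet_i$ is the one-node tree with label $i$; $[\tau_1\cdots\tau_n]_{\bullet_i}$ is obtained by grafting $\tau_1,\dots,\tau_n$ onto a root labelled $i$. The Connes–Kreimer coproduct $\Delta_\star$ on $\mathcal{H}$ is the algebra morphism with $\Delta_\star[\tau_1\cdots\tau_n]_{\bullet_i}=[\tau_1\cdots\tau_n]_{\bullet_i}\otimes1+(\mathrm{id}\otimes[\cdot]_{\bullet_i})\Delta_\star(\tau_1\cdots\tau_n)$. $\mathcal{H}^*,\mathcal{B}^*$ are the algebraic duals, identified with formal series of forests, resp. trees (forests orthonormal), with product topology; $\star$ is the product on $\mathcal{H}^*$ dual to $\Delta_\star$. $\mathcal{B}^N$ is the truncation at level $N$, identified with the span of trees with at most $N$ nodes. The pre-Lie product on $\mathcal{B}$ (extended to $\mathcal{B}^*$) is $\tau_1\curvearrowright\tau_2=\sum_\tau n(\tau_1,\tau_2,\tau)\tau$, where $n(\tau_1,\tau_2,\tau)$ is the number of edges of $\tau$ whose removal leaves the branch $\tau_1$ and the trunk $\tau_2$ (the part containing the root). For $v=(v_0,\dots,v_d)\subset\mathcal{B}^*$, $M_v:\mathcal{H}^*\to\mathcal{H}^*$ is the unique continuous algebra morphism (for $\star$) whose restriction to $\mathcal{B}^*$ is a pre-Lie morphism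 $\mathcal{B}^*\to\mathcal{B}^*$ and with $M_v\bullet_i=\bullet_i+v_i$. An $\alpha$-Hölder branched rough path is a map $\mathbf{X}:[0,T]^2\to\mathcal{H}^*$ with $\langle\mathbf{X}_{s,t},\tau_1\odot\tau_2\rangle=\langle\mathbf{X}_{s,t},\tau_1\rangle\langle\mathbf{X}_{s,t},\tau_2\rangle$, $\mathbf{X}_{s,t}=\mathbf{X}_{s,u}\star\mathbf{X}_{u,t}$, and $\sup_{s\ne t}|\langle\mathbf{X}_{s,t},\tau\rangle|/|t-s|^{\alpha|\tau|}<\infty$ for every forest $\tau$ with $|\tau|$ nodes. Rough paths are regarded as fully lifted and translations act pointwise: $(T_v\mathbf{X})_{s,t}:=T_v(\mathbf{X}_{s,t})$, $(M_v\mathbf{X})_{s,t}:=M_v(\mathbf{X}_{s,t})$. (In (i) the translated path is an $\alpha/N$-Hölder, in (ii) an $\alpha\wedge(1/N)$-Hölder, weakly geometric resp. branched rough path.) RDE solutions are understood in the standard rough path sense (weakly geometric, resp. branched, rough differential equations). **Vector fields.** In the geometric case, $f$ induces a canonical map $\mathcal{L}^N(\mathbb{R}^{1+d})\to\mathrm{Vect}(\mathbb{R}^e)$, $u\mapsto f_u$, linear, extending $e_i\mapsto f_i$ and given by replacing Lie brackets by Lie brackets of vector fields (e.g. $f_{[e_1,e_2]}=[f_1,f_2]$); set $f^v=(f_{e_0+v_0},\dots,f_{e_d+v_d})$. In the branched case, $f$ induces a canonical linear map $\mathcal{B}^N\to\mathrm{Vect}(\mathbb{R}^e)$, $u\mapsto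 f_u$, extending $\bullet_i\mapsto f_i$ and given by replacing $\curvearrowright$ by the pre-Lie product $(g^i\partial_i)\triangleright(h^j\partial_j)=(g^i\partial_ih^j)\partial_j$ of vector fields (e.g. $f_{[\bullet_1]_{\bullet_2}}=f_{\bullet_1\curvearrowright\bullet_2}=f_1\triangleright f_2$); for smooth $f$ it is the restriction to trees with at most $N$ nodes of the unique pre-Lie morphism $(\mathcal{B},\curvearrowright)\to(\mathrm{Vect}^\infty(\mathbb{R}^e),\triangleright)$ with $\bullet_i\mapsto f_i$ ($(\mathcal{B},\curvearrowright)$ being the free pre-Lie algebra over $\mathbb{R}^{1+d}$), and for less regular $f$ it is given by the same expressions in $f$ and its derivatives. Set $f^v=(f_{\bullet_0+v_0},\dots,f_{\bullet_d+v_d})$. *)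

theory Defs
  imports "HOL-Analysis.Analysis" "HOL-Library.Multiset" "HOL-Library.Poly_Mapping"
    "HOL-Library.Function_Algebras"
begin

text \<open>
  The labels \<open>0, \<dots>, d\<close> are the elements of an arbitrary finite type \<open>'l\<close>, so that
  \<open>1 + d = CARD('l)\<close>; where the zeroth label plays a role it is the constant \<open>0 :: 'l\<close>.

  Formal series over a basis \<open>'b\<close> (words, trees or forests) are functions \<open>'b \<Rightarrow> real\<close>. They carry the
  product topology, which is the library's topology on function types, and \<open>x b\<close> is the pairing
  \<open>\<langle>x, b\<rangle>\<close>. Their sum, difference and zero are pointwise. The pointwise \<open>*\<close> and \<open>1\<close> on functions are
  not the algebra structures meant here and are never used on series.
\<close>

definition unit_series :: "'b \<Rightarrow> 'b \<Rightarrow> real" where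
  "unit_series b = (\<lambda>c. if c = b then 1 else 0)"

definition scale_series :: "real \<Rightarrow> ('b \<Rightarrow> real) \<Rightarrow> 'b \<Rightarrow> real" where
  "scale_series c x = (\<lambda>b. c * x b)"

definition linear_series :: "(('b \<Rightarrow> real) \<Rightarrow> ('c \<Rightarrow> real)) \<Rightarrow> bool" where
  "linear_series L \<longleftrightarrow>
     (\<forall>x y. L (x + y) = L x + L y) \<and> (\<forall>c x. L (scale_series c x) = scale_series c (L x))"


section \<open>Vector fields\<close>

text \<open>\<open>vf_prelie g h\<close> is the vector field \<open>(g\<^sup>i \<partial>\<^sub>i h\<^sup>j) \<partial>\<^sub>j\<close>.\<close>

definition vf_prelie :: "('e \<Rightarrow> 'e) \<Rightarrow> ('e \<Rightarrow> 'e) \<Rightarrow> 'e \<Rightarrow> 'e::euclidean_space" where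
  "vf_prelie g h = (\<lambda>y. frechet_derivative h (at y) (g y))"

definition vf_bracket :: "('e \<Rightarrow> 'e) \<Rightarrow> ('e \<Rightarrow> 'e) \<Rightarrow> 'e \<Rightarrow> 'e::euclidean_space" where
  "vf_bracket g h = (\<lambda>y. vf_prelie g h y - vf_prelie h g y)"

text \<open>Class \<open>C\<^sup>n\<close> on the whole space, without any boundedness requirement.\<close>

primrec C_class :: "nat \<Rightarrow> ('e \<Rightarrow> 'e::euclidean_space) \<Rightarrow> bool" where
  "C_class 0 g \<longleftrightarrow> continuous_on UNIV g"
| "C_class (Suc n) g \<longleftrightarrow> (\<forall>y. g differentiable at y) \<and>
     (\<forall>h. C_class n (\<lambda>y. frechet_derivative g (at y) h))"


section \<open>Solution flows\<close>

text \<open>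
  Solutions are understood in the sense of Davie: a flow on \<open>[0, T]\<close> is a solution flow if it agrees
  with its local (Euler) expansion up to an error of order strictly larger than one, locally
  uniformly in the initial condition.
\<close>

definition has_local_expansion ::
  "real \<Rightarrow> (real \<Rightarrow> real \<Rightarrow> 'e \<Rightarrow> 'e) \<Rightarrow> (real \<Rightarrow> real \<Rightarrow> 'e \<Rightarrow> 'e::euclidean_space) \<Rightarrow> bool" where
  "has_local_expansion T Y E \<longleftrightarrow>
     (\<exists>\<theta>>1. \<forall>K. compact K \<longrightarrow>
        (\<exists>C. \<forall>s t. 0 \<le> s \<longrightarrow> s \<le> t \<longrightarrow> t \<le> T \<longrightarrow>
           (\<forall>y\<in>K. norm (Y s t y - E s t y) \<le> C * (t - s) powr \<theta>)))"

definition flow_on :: "real \<Rightarrow> (real \<Rightarrow> real \<Rightarrow> 'e \<Rightarrow> 'e) \<Rightarrow> bool" where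
  "flow_on T Y \<longleftrightarrow>
     (\<forall>s y. 0 \<le> s \<longrightarrow> s \<le> T \<longrightarrow> Y s s y = y) \<and>
     (\<forall>s u t y. 0 \<le> s \<longrightarrow> s \<le> u \<longrightarrow> u \<le> t \<longrightarrow> t \<le> T \<longrightarrow> Y u t (Y s u y) = Y s t y)"


section \<open>Tensor series and translation of weakly geometric rough paths\<close>

type_synonym 'l tensor_series = "'l list \<Rightarrow> real"

definition tensor_prod :: "'l tensor_series \<Rightarrow> 'l tensor_series \<Rightarrow> 'l tensor_series" where
  "tensor_prod x y = (\<lambda>w. \<Sum>k\<le>length w. x (take k w) * y (drop k w))"

definition lie_bracket :: "'l tensor_series \<Rightarrow> 'l tensor_series \<Rightarrow> 'l tensor_series" where
  "lie_bracket x y = tensor_prod x y - tensor_prod y x"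

inductive_set lie_polynomials :: "'l tensor_series set" where
  "unit_series [i] \<in> lie_polynomials"
| "x \<in> lie_polynomials \<Longrightarrow> y \<in> lie_polynomials \<Longrightarrow> x + y \<in> lie_polynomials"
| "x \<in> lie_polynomials \<Longrightarrow> scale_series c x \<in> lie_polynomials"
| "x \<in> lie_polynomials \<Longrightarrow> y \<in> lie_polynomials \<Longrightarrow> lie_bracket x y \<in> lie_polynomials"

definition lie_step :: "nat \<Rightarrow> 'l tensor_series set" where
  "lie_step N = {x \<in> lie_polynomials. \<forall>w. length w > N \<longrightarrow> x w = 0}"

text \<open>
  The continuous algebra morphism with \<open>e\<^sub>i \<mapsto> e\<^sub>i + v\<^sub>i\<close> is unique, so it is given by its
  characterising properties; likewise \<open>is_branched_translation\<close> below.
\<close>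

definition is_geometric_translation ::
  "('l \<Rightarrow> 'l tensor_series) \<Rightarrow> ('l tensor_series \<Rightarrow> 'l tensor_series) \<Rightarrow> bool" where
  "is_geometric_translation v \<T> \<longleftrightarrow>
     continuous_on UNIV \<T> \<and> linear_series \<T> \<and>
     \<T> (unit_series []) = unit_series [] \<and>
     (\<forall>x y. \<T> (tensor_prod x y) = tensor_prod (\<T> x) (\<T> y)) \<and>
     (\<forall>i. \<T> (unit_series [i]) = unit_series [i] + v i)"

text \<open>The words occurring in the shuffle product of two words, with multiplicities.\<close>

fun shuffle_words :: "'l list \<Rightarrow> 'l list \<Rightarrow> 'l list multiset" where
  "shuffle_words [] w = {#w#}"
| "shuffle_words u [] = {#u#}"
| "shuffle_words (i # u) (j # w) =
     image_mset ((#) i) (shuffle_words u (j # w)) + image_mset ((#) j) (shuffle_words (i # u) w)"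

definition weakly_geometric_rough_path ::
  "real \<Rightarrow> real \<Rightarrow> (real \<Rightarrow> real \<Rightarrow> 'l tensor_series) \<Rightarrow> bool" where
  "weakly_geometric_rough_path T \<alpha> X \<longleftrightarrow>
     (\<forall>s\<in>{0..T}. \<forall>t\<in>{0..T}. \<forall>u w.
        sum_mset (image_mset (X s t) (shuffle_words u w)) = X s t u * X s t w) \<and>
     (\<forall>s\<in>{0..T}. \<forall>u\<in>{0..T}. \<forall>t\<in>{0..T}. X s t = tensor_prod (X s u) (X u t)) \<and>
     (\<forall>w. \<exists>C. \<forall>s\<in>{0..T}. \<forall>t\<in>{0..T}. s \<noteq> t \<longrightarrow>
        \<bar>X s t w\<bar> / \<bar>t - s\<bar> powr (\<alpha> * real (length w)) \<le> C)"

text \<open>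
  Graph of the map \<open>u \<mapsto> f\<^sub>u\<close> on Lie polynomials of degree at most \<open>N\<close>: linear, and replacing Lie
  brackets by brackets of vector fields. The index \<open>N\<close> bounds the total degree of all brackets
  formed, so that no more than \<open>N - 1\<close> derivatives of \<open>f\<close> are ever taken.
\<close>

inductive lie_field_graph ::
  "('l \<Rightarrow> 'e \<Rightarrow> 'e::euclidean_space) \<Rightarrow> nat \<Rightarrow> 'l tensor_series \<Rightarrow> ('e \<Rightarrow> 'e) \<Rightarrow> bool"
  for f where
  "1 \<le> N \<Longrightarrow> lie_field_graph f N (unit_series [i]) (f i)"
| "lie_field_graph f N u U \<Longrightarrow> lie_field_graph f N w W \<Longrightarrow>
     lie_field_graph f N (u + w) (\<lambda>y. U y + W y)"
| "lie_field_graph f N u U \<Longrightarrow> lie_field_graph f N (scale_series c u) (\<lambda>y. c *\<^sub>R U y)"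
| "lie_field_graph f m u U \<Longrightarrow> lie_field_graph f n w W \<Longrightarrow> m + n \<le> N \<Longrightarrow>
     lie_field_graph f N (lie_bracket u w) (vf_bracket U W)"

definition lie_field ::
  "('l \<Rightarrow> 'e \<Rightarrow> 'e::euclidean_space) \<Rightarrow> nat \<Rightarrow> 'l tensor_series \<Rightarrow> 'e \<Rightarrow> 'e" where
  "lie_field f N u = (THE U. lie_field_graph f N u U)"

text \<open>
  \<open>word_field f [i\<^sub>1, \<dots>, i\<^sub>k]\<close> is \<open>f\<^bsub>i\<^sub>1\<^esub> \<cdots> f\<^bsub>i\<^sub>k\<^esub>\<close>, read as a composition of first order differential
  operators, applied to the identity function.
\<close>

primrec word_field :: "('l \<Rightarrow> 'e \<Rightarrow> 'e) \<Rightarrow> 'l list \<Rightarrow> 'e \<Rightarrow> 'e::euclidean_space" where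
  "word_field f [] = (\<lambda>y. y)"
| "word_field f (i # w) = vf_prelie (f i) (word_field f w)"

definition geometric_expansion ::
  "real \<Rightarrow> ('l \<Rightarrow> 'e \<Rightarrow> 'e) \<Rightarrow> 'l tensor_series \<Rightarrow> 'e \<Rightarrow> 'e::euclidean_space" where
  "geometric_expansion \<alpha> f x y =
     (\<Sum>w | length w \<le> nat \<lfloor>1 / \<alpha>\<rfloor>. x w *\<^sub>R word_field f w y)"

definition geometric_solution_flow ::
  "real \<Rightarrow> real \<Rightarrow> ('l \<Rightarrow> 'e \<Rightarrow> 'e) \<Rightarrow> (real \<Rightarrow> real \<Rightarrow> 'l tensor_series) \<Rightarrow>
   (real \<Rightarrow> real \<Rightarrow> 'e \<Rightarrow> 'e::euclidean_space) \<Rightarrow> bool" where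
  "geometric_solution_flow T \<alpha> f X Y \<longleftrightarrow>
     flow_on T Y \<and> has_local_expansion T Y (\<lambda>s t. geometric_expansion \<alpha> f (X s t))"

text \<open>
  Solution flows of \<open>dY = f(Y) dX + g(Y) dx\<close> for a rough path \<open>X\<close> and a Lipschitz continuous real path \<open>x\<close>.
  The integral against \<open>x\<close> is an ordinary one and interacts with \<open>X\<close> only at order larger than one.
\<close>

definition geometric_drift_solution_flow ::
  "real \<Rightarrow> real \<Rightarrow> ('l \<Rightarrow> 'e \<Rightarrow> 'e) \<Rightarrow> (real \<Rightarrow> real \<Rightarrow> 'l tensor_series) \<Rightarrow>
   ('e \<Rightarrow> 'e) \<Rightarrow> (real \<Rightarrow> real) \<Rightarrow> (real \<Rightarrow> real \<Rightarrow> 'e \<Rightarrow> 'e::euclidean_space) \<Rightarrow> bool" where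
  "geometric_drift_solution_flow T \<alpha> f X g x Y \<longleftrightarrow>
     flow_on T Y \<and>
     has_local_expansion T Y
       (\<lambda>s t y. geometric_expansion \<alpha> f (X s t) y + (x t - x s) *\<^sub>R g y)"


section \<open>Trees, forests and translation of branched rough paths\<close>

datatype 'l rtree = Node 'l "'l rtree multiset"

type_synonym 'l forest = "'l rtree multiset"

primrec tree_nodes :: "'l rtree \<Rightarrow> nat" where
  "tree_nodes (Node i F) = Suc (sum_mset (image_mset tree_nodes F))"

definition forest_nodes :: "'l forest \<Rightarrow> nat" where
  "forest_nodes F = sum_mset (image_mset tree_nodes F)"

primrec tree_label_count :: "'l \<Rightarrow> 'l rtree \<Rightarrow> nat" where
  "tree_label_count j (Node i F) =
     (if i = j then 1 else 0) + sum_mset (image_mset (tree_label_count j) F)"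

definition forest_label_count :: "'l \<Rightarrow> 'l forest \<Rightarrow> nat" where
  "forest_label_count j F = sum_mset (image_mset (tree_label_count j) F)"

abbreviation bullet :: "'l \<Rightarrow> 'l rtree" where
  "bullet i \<equiv> Node i {#}"

text \<open>
  The algebra \<open>\<H>\<close> of forests is the monoid algebra of \<open>('l forest, +)\<close>, and \<open>\<H> \<otimes> \<H>\<close> is the
  monoid algebra of the product monoid, that is \<open>('l forest \<times> 'l forest) \<Rightarrow>\<^sub>0 real\<close> with its convolution
  product. \<open>graft_right i\<close> is the linear map \<open>id \<otimes> [\<cdot>]\<^sub>i\<close>.
\<close>

definition graft_right ::
  "'l \<Rightarrow> (('l forest \<times> 'l forest) \<Rightarrow>\<^sub>0 real) \<Rightarrow> ('l forest \<times> 'l forest) \<Rightarrow>\<^sub>0 real" where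
  "graft_right i x =
     (\<Sum>p\<in>Poly_Mapping.keys x.
        Poly_Mapping.single (fst p, {#Node i (snd p)#}) (Poly_Mapping.lookup x p))"

primrec tree_coproduct :: "'l rtree \<Rightarrow> ('l forest \<times> 'l forest) \<Rightarrow>\<^sub>0 real" where
  "tree_coproduct (Node i F) =
     Poly_Mapping.single ({#Node i F#}, {#}) 1 +
     graft_right i (prod_mset (image_mset tree_coproduct F))"

definition forest_coproduct :: "'l forest \<Rightarrow> ('l forest \<times> 'l forest) \<Rightarrow>\<^sub>0 real" where
  "forest_coproduct F = prod_mset (image_mset tree_coproduct F)"

type_synonym 'l forest_series = "'l forest \<Rightarrow> real"
type_synonym 'l tree_series = "'l rtree \<Rightarrow> real"

definition star_prod :: "'l forest_series \<Rightarrow> 'l forest_series \<Rightarrow> 'l forest_series" where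
  "star_prod x y = (\<lambda>F. \<Sum>p\<in>Poly_Mapping.keys (forest_coproduct F).
     Poly_Mapping.lookup (forest_coproduct F) p * (x (fst p) * y (snd p)))"

text \<open>The inclusion of series of trees into series of forests.\<close>

definition forest_of_tree_series :: "'l tree_series \<Rightarrow> 'l forest_series" where
  "forest_of_tree_series x = (\<lambda>F. if \<exists>\<tau>. F = {#\<tau>#} then x (THE \<tau>. F = {#\<tau>#}) else 0)"

text \<open>
  The pairs (branch, trunk) obtained by removing one edge of a tree, listed with multiplicity:
  either an edge at the root is removed, or an edge inside one of the subtrees at the root.
\<close>

primrec edge_cuts :: "'l rtree \<Rightarrow> ('l rtree \<times> 'l rtree) multiset" where
  "edge_cuts (Node i F) =
     sum_mset (image_mset
       (\<lambda>(\<tau>, cuts). add_mset (\<tau>, Node i (F - {#\<tau>#}))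
          (image_mset (\<lambda>(b, r). (b, Node i (add_mset r (F - {#\<tau>#})))) cuts))
       (image_mset (\<lambda>\<tau>. (\<tau>, edge_cuts \<tau>)) F))"

definition cut_number :: "'l rtree \<Rightarrow> 'l rtree \<Rightarrow> 'l rtree \<Rightarrow> nat" where
  "cut_number \<tau>1 \<tau>2 \<tau> = count (edge_cuts \<tau>) (\<tau>1, \<tau>2)"

definition tree_prelie :: "'l tree_series \<Rightarrow> 'l tree_series \<Rightarrow> 'l tree_series" where
  "tree_prelie x y = (\<lambda>\<tau>. \<Sum>(\<tau>1, \<tau>2)\<in>set_mset (edge_cuts \<tau>).
     real (cut_number \<tau>1 \<tau>2 \<tau>) * (x \<tau>1 * y \<tau>2))"

definition branched_step :: "nat \<Rightarrow> 'l tree_series set" where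
  "branched_step N = {x. \<forall>\<tau>. tree_nodes \<tau> > N \<longrightarrow> x \<tau> = 0}"

definition is_branched_translation ::
  "('l \<Rightarrow> 'l tree_series) \<Rightarrow> ('l forest_series \<Rightarrow> 'l forest_series) \<Rightarrow> bool" where
  "is_branched_translation v M \<longleftrightarrow>
     continuous_on UNIV M \<and> linear_series M \<and>
     M (unit_series {#}) = unit_series {#} \<and>
     (\<forall>x y. M (star_prod x y) = star_prod (M x) (M y)) \<and>
     (\<exists>m. (\<forall>x. M (forest_of_tree_series x) = forest_of_tree_series (m x)) \<and>
          (\<forall>x y. m (tree_prelie x y) = tree_prelie (m x) (m y)) \<and>
          (\<forall>i. m (unit_series (bullet i)) = unit_series (bullet i) + v i))"

definition branched_rough_path ::
  "real \<Rightarrow> real \<Rightarrow> (real \<Rightarrow> real \<Rightarrow> 'l forest_series) \<Rightarrow> bool" where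
  "branched_rough_path T \<alpha> X \<longleftrightarrow>
     (\<forall>s\<in>{0..T}. \<forall>t\<in>{0..T}. \<forall>F G. X s t (F + G) = X s t F * X s t G) \<and>
     (\<forall>s\<in>{0..T}. \<forall>u\<in>{0..T}. \<forall>t\<in>{0..T}. X s t = star_prod (X s u) (X u t)) \<and>
     (\<forall>F. \<exists>C. \<forall>s\<in>{0..T}. \<forall>t\<in>{0..T}. s \<noteq> t \<longrightarrow>
        \<bar>X s t F\<bar> / \<bar>t - s\<bar> powr (\<alpha> * real (forest_nodes F)) \<le> C)"

text \<open>
  Graph of the map \<open>u \<mapsto> f\<^sub>u\<close> on the span of trees with at most \<open>N\<close> nodes: linear, and turning the
  pre-Lie product of trees into that of vector fields. As above, \<open>N\<close> bounds the total degree
  of all products formed.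
\<close>

inductive branched_field_graph ::
  "('l \<Rightarrow> 'e \<Rightarrow> 'e::euclidean_space) \<Rightarrow> nat \<Rightarrow> 'l tree_series \<Rightarrow> ('e \<Rightarrow> 'e) \<Rightarrow> bool"
  for f where
  "1 \<le> N \<Longrightarrow> branched_field_graph f N (unit_series (bullet i)) (f i)"
| "branched_field_graph f N u U \<Longrightarrow> branched_field_graph f N w W \<Longrightarrow>
     branched_field_graph f N (u + w) (\<lambda>y. U y + W y)"
| "branched_field_graph f N u U \<Longrightarrow>
     branched_field_graph f N (scale_series c u) (\<lambda>y. c *\<^sub>R U y)"
| "branched_field_graph f m u U \<Longrightarrow> branched_field_graph f n w W \<Longrightarrow> m + n \<le> N \<Longrightarrow>
     branched_field_graph f N (tree_prelie u w) (vf_prelie U W)"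

definition branched_field ::
  "('l \<Rightarrow> 'e \<Rightarrow> 'e::euclidean_space) \<Rightarrow> nat \<Rightarrow> 'l tree_series \<Rightarrow> 'e \<Rightarrow> 'e" where
  "branched_field f N u = (THE U. branched_field_graph f N u U)"

text \<open>
  No symmetry factors appear in the expansion: with the cut-counting normalisation of the pre-Lie
  product they are contained in \<open>f\<^sub>\<tau>\<close>. For example \<open>\<bullet>\<^sub>1 \<curvearrowright> [\<bullet>\<^sub>1]\<^sub>2 = 2 [\<bullet>\<^sub>1 \<bullet>\<^sub>1]\<^sub>2 + [[\<bullet>\<^sub>1]\<^sub>1]\<^sub>2\<close>,
  so \<open>f\<^sub>\<tau>\<close> is half the elementary differential for \<open>\<tau> = [\<bullet>\<^sub>1 \<bullet>\<^sub>1]\<^sub>2\<close>.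
\<close>

definition branched_expansion ::
  "real \<Rightarrow> ('l \<Rightarrow> 'e \<Rightarrow> 'e) \<Rightarrow> 'l forest_series \<Rightarrow> 'e \<Rightarrow> 'e::euclidean_space" where
  "branched_expansion \<alpha> f x y =
     y + (\<Sum>\<tau> | tree_nodes \<tau> \<le> nat \<lfloor>1 / \<alpha>\<rfloor>.
            x {#\<tau>#} *\<^sub>R branched_field f (nat \<lfloor>1 / \<alpha>\<rfloor>) (unit_series \<tau>) y)"

definition branched_solution_flow ::
  "real \<Rightarrow> real \<Rightarrow> ('l \<Rightarrow> 'e \<Rightarrow> 'e) \<Rightarrow> (real \<Rightarrow> real \<Rightarrow> 'l forest_series) \<Rightarrow>
   (real \<Rightarrow> real \<Rightarrow> 'e \<Rightarrow> 'e::euclidean_space) \<Rightarrow> bool" where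
  "branched_solution_flow T \<alpha> f X Y \<longleftrightarrow>
     flow_on T Y \<and> has_local_expansion T Y (\<lambda>s t. branched_expansion \<alpha> f (X s t))"

definition branched_drift_solution_flow ::
  "real \<Rightarrow> real \<Rightarrow> ('l \<Rightarrow> 'e \<Rightarrow> 'e) \<Rightarrow> (real \<Rightarrow> real \<Rightarrow> 'l forest_series) \<Rightarrow>
   ('e \<Rightarrow> 'e) \<Rightarrow> (real \<Rightarrow> real) \<Rightarrow> (real \<Rightarrow> real \<Rightarrow> 'e \<Rightarrow> 'e::euclidean_space) \<Rightarrow> bool" where
  "branched_drift_solution_flow T \<alpha> f X g x Y \<longleftrightarrow>
     flow_on T Y \<and>
     has_local_expansion T Y
       (\<lambda>s t y. branched_expansion \<alpha> f (X s t) y + (x t - x s) *\<^sub>R g y)"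


section \<open>Improved regularity of the zeroth component\<close>

text \<open>
  \<open>len\<close> is the length (number of nodes) and \<open>len0\<close> the number of letters (labels) \<open>0\<close> of a basis
  element. A common bound for all basis elements up to degree \<open>\<lfloor>1/\<alpha>\<rfloor>\<close> expresses finiteness of the
  maximum of the suprema.
\<close>

definition zeroth_regular ::
  "('b \<Rightarrow> nat) \<Rightarrow> ('b \<Rightarrow> nat) \<Rightarrow> real \<Rightarrow> real \<Rightarrow> (real \<Rightarrow> real \<Rightarrow> 'b \<Rightarrow> real) \<Rightarrow> bool" where
  "zeroth_regular len len0 T \<alpha> X \<longleftrightarrow>
     (\<exists>C. \<forall>w. len w \<le> nat \<lfloor>1 / \<alpha>\<rfloor> \<longrightarrow>
        (\<forall>u\<in>{0..T}. \<forall>r\<in>{0..T}. u \<noteq> r \<longrightarrow>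
           \<bar>X u r w\<bar> / \<bar>r - u\<bar> powr ((1 - \<alpha>) * real (len0 w) + \<alpha> * real (len w)) \<le> C))"

end

(*
A flow solves an RDE iff it agrees with the Euler expansion up to an error of order larger than
one, so it suffices to compare the two Euler expansions.

Geometric case: a Lie polynomial u acts as the first order operator of its vector field f_u, because
second derivatives are symmetric and cancel in brackets. Hence composing the fields f^v along a word
w applies T_v(w), and by continuity the expansion for T_v X is the sum of <X, w> times the field of
T_v(w).

Branched case: elementary differentials divided by symmetry factors form a pre-Lie morphism, and
trees are generated by single nodes under grafting, so the elementary differential of f^v along a tree
is that of f along its image under M_v. Forests with at least two trees contribute nothing, since their
images have no component along single trees.

In both cases the expansions differ only in terms of degree above 1/alpha. In (ii) the terms of degree
at least two that contain the zeroth letter are also of order larger than one.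
*)

theory Submission
  imports Defs
begin

section \<open>Directional derivatives and vector fields of class \<open>C\<^sup>n\<close>\<close>

text \<open>Regularity shapes the proof: \<open>f\<close> has only finitely many derivatives, so
  identities between operators hold only on functions of a matching class, and degrees are weighed
  against \<open>r\<close> throughout. \<open>lie_field\<close> and \<open>branched_field\<close>
  are chosen by \<open>THE\<close>. Uniqueness comes from an explicit formula for every pair in the
  graph. Existence requires products that never exceed degree \<open>N\<close>: homogeneous
  components provide this for Lie polynomials, an induction on the number of root branches for
  trees. In (i) the translated path is only \<alpha>/N-Hoelder and its expansion runs up to
  floor(N/\<alpha>), enough to hold the images of all words or trees of degree up to
  floor(1/\<alpha>). In (ii) it stops at max(floor(1/\<alpha>), N) and may truncate images, but up
  to degree floor(1/\<alpha>) only for elements of degree at least two that contain 0; their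
  coefficients have order at least (1 - \<alpha>) + 2\<alpha> = 1 + \<alpha>. That images of larger
  forests have no single-tree component is not assumed of \<open>M\<close>; it is derived from
  compatibility with both \<open>star_prod\<close> and the pre-Lie product, by induction on the
  number of trees.\<close>

definition dir_deriv :: "'e \<Rightarrow> ('e \<Rightarrow> 'e) \<Rightarrow> 'e \<Rightarrow> 'e::euclidean_space" where
  "dir_deriv u g = (\<lambda>y. frechet_derivative g (at y) u)"

lemma C_class_Suc: "C_class (Suc n) g \<longleftrightarrow> (\<forall>y. g differentiable at y) \<and> (\<forall>h. C_class n (dir_deriv h g))"
  by (simp add: dir_deriv_def)

declare C_class.simps(2) [simp del]

lemma C_class_Suc_imp: "C_class (Suc n) g \<Longrightarrow> C_class n g"
proof (induction n arbitrary: g)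
  case 0
  then show ?case
    by (auto simp: C_class_Suc intro!: continuous_at_imp_continuous_on differentiable_imp_continuous_within)
next
  case (Suc n)
  then show ?case by (auto simp: C_class_Suc)
qed

lemma C_class_mono: "C_class n g \<Longrightarrow> m \<le> n \<Longrightarrow> C_class m g"
  by (induction n) (auto simp: le_Suc_eq dest: C_class_Suc_imp)

lemma C_class_continuous: "C_class n g \<Longrightarrow> continuous_on UNIV g"
  using C_class_mono[of n g 0] by simp

lemma C_class_differentiable: "C_class n g \<Longrightarrow> 1 \<le> n \<Longrightarrow> g differentiable at y"
  by (cases n) (auto simp: C_class_Suc)

lemma dir_deriv_works: "g differentiable at y \<Longrightarrow> (g has_derivative (\<lambda>h. dir_deriv h g y)) (at y)"
  unfolding dir_deriv_def frechet_derivative_works .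

lemma C_class_has_derivative:
  "C_class n g \<Longrightarrow> 1 \<le> n \<Longrightarrow> (g has_derivative (\<lambda>h. dir_deriv h g y)) (at y)"
  by (intro dir_deriv_works C_class_differentiable)

lemma C_class_dir_deriv: "C_class n g \<Longrightarrow> Suc m \<le> n \<Longrightarrow> C_class m (dir_deriv h g)"
  using C_class_mono[of n g "Suc m"] by (auto simp: C_class_Suc)

lemma dir_derivI: "(g has_derivative g') (at y) \<Longrightarrow> dir_deriv h g y = g' h"
  unfolding dir_deriv_def by (metis frechet_derivative_at)

lemma vf_prelie_eq: "vf_prelie g h y = dir_deriv (g y) h y"
  by (simp add: vf_prelie_def dir_deriv_def)

lemma C_class_const: "C_class n (\<lambda>_. c)"
proof (induction n arbitrary: c)
  case (Suc n)
  have "dir_deriv h (\<lambda>_. c) = (\<lambda>_. 0)" for h :: 'a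
    by (auto intro!: ext dir_derivI[where g'="\<lambda>_. 0"])
  with Suc show ?case by (auto simp: C_class_Suc)
qed simp

lemma dir_deriv_id: "dir_deriv h (\<lambda>y. y) = (\<lambda>_. h)"
  by (auto intro!: ext dir_derivI[where g'="\<lambda>h. h"])

lemma C_class_id: "C_class n (\<lambda>y. y)"
  by (cases n) (auto simp: C_class_Suc dir_deriv_id C_class_const)

lemma dir_deriv_add:
  assumes "g differentiable at y" "h differentiable at y"
  shows "dir_deriv u (\<lambda>y. g y + h y) y = dir_deriv u g y + dir_deriv u h y"
  using has_derivative_add[OF assms[THEN dir_deriv_works]] by (rule dir_derivI)

lemma dir_deriv_scaleR:
  assumes "g differentiable at y"
  shows "dir_deriv u (\<lambda>y. c *\<^sub>R g y) y = c *\<^sub>R dir_deriv u g y"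
  using has_derivative_scaleR_right[OF dir_deriv_works[OF assms]] by (rule dir_derivI)

lemma dir_deriv_sum:
  assumes "\<And>i. i \<in> I \<Longrightarrow> g i differentiable at y"
  shows "dir_deriv u (\<lambda>y. \<Sum>i\<in>I. g i y) y = (\<Sum>i\<in>I. dir_deriv u (g i) y)"
proof (rule dir_derivI)
  show "((\<lambda>y. \<Sum>i\<in>I. g i y) has_derivative (\<lambda>u. \<Sum>i\<in>I. dir_deriv u (g i) y)) (at y)"
    by (rule has_derivative_sum) (use assms in \<open>auto intro: dir_deriv_works\<close>)
qed

lemma C_class_add: "C_class n g \<Longrightarrow> C_class n h \<Longrightarrow> C_class n (\<lambda>y. g y + h y)"
proof (induction n arbitrary: g h)
  case 0
  then show ?case by (auto intro: continuous_intros)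
next
  case (Suc n)
  then have "dir_deriv u (\<lambda>y. g y + h y) = (\<lambda>y. dir_deriv u g y + dir_deriv u h y)" for u
    by (auto simp: C_class_Suc dir_deriv_add)
  with Suc show ?case by (auto simp: C_class_Suc)
qed

lemma C_class_scaleR: "C_class n g \<Longrightarrow> C_class n (\<lambda>y. c *\<^sub>R g y)"
proof (induction n arbitrary: g)
  case 0
  then show ?case by (auto intro: continuous_intros)
next
  case (Suc n)
  then have "dir_deriv u (\<lambda>y. c *\<^sub>R g y) = (\<lambda>y. c *\<^sub>R dir_deriv u g y)" for u
    by (auto simp: C_class_Suc dir_deriv_scaleR)
  with Suc show ?case by (auto simp: C_class_Suc)
qed

lemma C_class_sum: "(\<And>i. i \<in> I \<Longrightarrow> C_class n (g i)) \<Longrightarrow> C_class n (\<lambda>y. \<Sum>i\<in>I. g i y)"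
  by (induction I rule: infinite_finite_induct) (auto simp: C_class_const intro: C_class_add)

text \<open>\<open>C_class\<close> speaks only of self-maps of \<open>'e\<close>, so a scalar
  coefficient has to appear as a component \<open>g y \<bullet> b\<close>. This is the form in which
  coefficients arise when a point-dependent direction is expanded in \<open>Basis\<close>.\<close>

lemma C_class_inner_scaleR:
  "C_class n g \<Longrightarrow> C_class n h \<Longrightarrow> C_class n (\<lambda>y. (g y \<bullet> b) *\<^sub>R h y)"
proof (induction n arbitrary: g h)
  case 0
  then show ?case by (auto intro!: continuous_intros)
next
  case (Suc n)
  have d: "((\<lambda>y. (g y \<bullet> b) *\<^sub>R h y) has_derivative
      (\<lambda>u. (g y \<bullet> b) *\<^sub>R dir_deriv u h y + (dir_deriv u g y \<bullet> b) *\<^sub>R h y)) (at y)" for y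
    by (rule has_derivative_scaleR has_derivative_inner_left C_class_has_derivative Suc.prems le_numeral_extra | simp)+
  have "dir_deriv u (\<lambda>y. (g y \<bullet> b) *\<^sub>R h y) =
      (\<lambda>y. (g y \<bullet> b) *\<^sub>R dir_deriv u h y + (dir_deriv u g y \<bullet> b) *\<^sub>R h y)" for u
    using dir_derivI[OF d] by auto
  moreover have "C_class n g" "C_class n h" using Suc.prems by (auto intro: C_class_Suc_imp)
  moreover have "(\<lambda>y. (g y \<bullet> b) *\<^sub>R h y) differentiable at y" for y
    using d by (rule differentiableI)
  ultimately show ?case using Suc.prems Suc.IH
    by (auto simp: C_class_Suc intro!: C_class_add)
qed

text \<open>Replaces a direction that varies with the point by the fixed directions of
  \<open>Basis\<close>, whose derivatives \<open>C_class\<close> controls.\<close>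

lemma dir_deriv_expand:
  assumes "g differentiable at y"
  shows "dir_deriv v g y = (\<Sum>b\<in>Basis. (v \<bullet> b) *\<^sub>R dir_deriv b g y)"
proof -
  have lin: "linear (\<lambda>v. dir_deriv v g y)"
    unfolding dir_deriv_def using assms by (rule linear_frechet_derivative)
  have "dir_deriv v g y = dir_deriv (\<Sum>b\<in>Basis. (v \<bullet> b) *\<^sub>R b) g y"
    by (simp add: euclidean_representation)
  also have "\<dots> = (\<Sum>b\<in>Basis. (v \<bullet> b) *\<^sub>R dir_deriv b g y)"
    using linear_sum[OF lin, of "\<lambda>b. (v \<bullet> b) *\<^sub>R b" Basis] linear_scale[OF lin] by simp
  finally show ?thesis .
qed

lemma dir_deriv_add_left:
  "g differentiable at y \<Longrightarrow> dir_deriv (u + v) g y = dir_deriv u g y + dir_deriv v g y"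
  unfolding dir_deriv_def by (rule linear_add[OF linear_frechet_derivative])

lemma dir_deriv_scaleR_left:
  "g differentiable at y \<Longrightarrow> dir_deriv (c *\<^sub>R u) g y = c *\<^sub>R dir_deriv u g y"
  unfolding dir_deriv_def by (rule linear_scale[OF linear_frechet_derivative])

lemma dir_deriv_sum_left:
  "g differentiable at y \<Longrightarrow> dir_deriv (\<Sum>i\<in>I. u i) g y = (\<Sum>i\<in>I. dir_deriv (u i) g y)"
  unfolding dir_deriv_def by (rule linear_sum[OF linear_frechet_derivative])

lemma C_class_vf_prelie:
  assumes "C_class n g" "C_class (Suc n) h"
  shows "C_class n (vf_prelie g h)"
proof -
  have "vf_prelie g h = (\<lambda>y. \<Sum>b\<in>Basis. (g y \<bullet> b) *\<^sub>R dir_deriv b h y)"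
    using assms(2) by (auto simp: vf_prelie_eq C_class_Suc intro!: ext dir_deriv_expand)
  then show ?thesis
    using assms by (auto simp: C_class_Suc intro!: C_class_sum C_class_inner_scaleR)
qed

section \<open>Symmetry of second derivatives\<close>

text \<open>The second difference over a parallelogram, paired with \<open>k\<close> so that the
  real mean value theorem applies: once along \<open>u\<close> to the difference of two translates
  of \<open>g\<close>, once along \<open>v\<close> to the derivative obtained. The left side is
  symmetric in \<open>u\<close> and \<open>v\<close>, while the right side fixes an order of
  differentiation.\<close>

lemma dir_deriv_mixed_mvt:
  assumes g: "C_class 2 g" and "0 < r"
  shows "\<exists>\<xi> \<eta>. 0 < \<xi> \<and> \<xi> < r \<and> 0 < \<eta> \<and> \<eta> < r \<and>
    (g (y + r *\<^sub>R u + r *\<^sub>R v) - g (y + r *\<^sub>R u) - (g (y + r *\<^sub>R v) - g y)) \<bullet> k =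
    r * (r * (dir_deriv v (dir_deriv u g) (y + \<xi> *\<^sub>R u + \<eta> *\<^sub>R v) \<bullet> k))"
proof -
  let ?F = "\<lambda>s. (g (y + s *\<^sub>R u + r *\<^sub>R v) - g (y + s *\<^sub>R u)) \<bullet> k"
  let ?F' = "\<lambda>s. (dir_deriv u g (y + s *\<^sub>R u + r *\<^sub>R v) - dir_deriv u g (y + s *\<^sub>R u)) \<bullet> k"
  have path: "((\<lambda>s. h (z + s *\<^sub>R w)) has_vector_derivative dir_deriv w h (z + s *\<^sub>R w)) (at s)"
    if "C_class 1 h" for h :: "'a \<Rightarrow> 'a" and z w s
  proof -
    have h: "(h has_derivative (\<lambda>w. dir_deriv w h (z + s *\<^sub>R w'))) (at (z + s *\<^sub>R w'))" for w'
      using C_class_has_derivative[OF that] by simp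
    have "((\<lambda>s. z + s *\<^sub>R w) has_derivative (\<lambda>t. t *\<^sub>R w)) (at s)"
      by (auto intro!: derivative_eq_intros)
    then have "((\<lambda>s. h (z + s *\<^sub>R w)) has_derivative (\<lambda>t. dir_deriv (t *\<^sub>R w) h (z + s *\<^sub>R w))) (at s)"
      using h[of w] by (rule has_derivative_compose[where g=h])
    then show ?thesis
      unfolding has_vector_derivative_def
      using that by (simp add: dir_deriv_scaleR_left C_class_differentiable)
  qed
  have g1: "C_class 1 g" "C_class 1 (dir_deriv u g)"
    using g by (auto intro: C_class_mono C_class_dir_deriv)
  have 1: "(?F has_real_derivative ?F' s) (at s)" for s
  proof -
    have "((\<lambda>s. g (y + s *\<^sub>R u + r *\<^sub>R v) - g (y + s *\<^sub>R u)) has_vector_derivative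
      (dir_deriv u g (y + s *\<^sub>R u + r *\<^sub>R v) - dir_deriv u g (y + s *\<^sub>R u))) (at s)"
      using path[OF g1(1), of "y + r *\<^sub>R v" u s] path[OF g1(1), of y u s]
      by (auto intro!: has_vector_derivative_diff simp: add_ac)
    then show ?thesis
      using bounded_linear.has_vector_derivative[OF bounded_linear_inner_left]
      by (fastforce simp: has_real_derivative_iff_has_vector_derivative)
  qed
  obtain \<xi> where \<xi>: "0 < \<xi>" "\<xi> < r" "?F r - ?F 0 = (r - 0) * ?F' \<xi>"
    using MVT2[of 0 r ?F ?F'] 1 \<open>0 < r\<close> by blast
  let ?G = "\<lambda>t. dir_deriv u g (y + \<xi> *\<^sub>R u + t *\<^sub>R v) \<bullet> k"
  let ?G' = "\<lambda>t. dir_deriv v (dir_deriv u g) (y + \<xi> *\<^sub>R u + t *\<^sub>R v) \<bullet> k"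
  have 2: "(?G has_real_derivative ?G' t) (at t)" for t
    using bounded_linear.has_vector_derivative[OF bounded_linear_inner_left
       path[OF g1(2), of "y + \<xi> *\<^sub>R u" v t]]
    by (simp add: has_real_derivative_iff_has_vector_derivative)
  obtain \<eta> where \<eta>: "0 < \<eta>" "\<eta> < r" "?G r - ?G 0 = (r - 0) * ?G' \<eta>"
    using MVT2[of 0 r ?G ?G'] 2 \<open>0 < r\<close> by blast
  show ?thesis
    using \<xi> \<eta> by (intro exI[of _ \<xi>] exI[of _ \<eta>]) (simp add: inner_diff_left)
qed

lemma dir_deriv_commute:
  assumes g: "C_class 2 g"
  shows "dir_deriv v (dir_deriv u g) = dir_deriv u (dir_deriv v g)"
proof (rule ext, rule euclidean_eqI)
  fix y k :: 'a
  let ?A = "\<lambda>z. dir_deriv v (dir_deriv u g) z \<bullet> k" and ?B = "\<lambda>z. dir_deriv u (dir_deriv v g) z \<bullet> k"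
  have cont: "continuous_on UNIV ?A" "continuous_on UNIV ?B"
    using g by (auto simp: numeral_2_eq_2 C_class_Suc intro!: continuous_intros)
  have "\<exists>\<xi> \<eta> \<xi>' \<eta>'. 0 < \<xi> \<and> \<xi> < inverse (Suc n) \<and> 0 < \<eta> \<and> \<eta> < inverse (Suc n) \<and>
      0 < \<xi>' \<and> \<xi>' < inverse (Suc n) \<and> 0 < \<eta>' \<and> \<eta>' < inverse (Suc n) \<and>
      ?A (y + \<xi> *\<^sub>R u + \<eta> *\<^sub>R v) = ?B (y + \<xi>' *\<^sub>R v + \<eta>' *\<^sub>R u)" for n
  proof -
    define r where "r = inverse (real (Suc n))"
    have r: "0 < r" by (simp add: r_def)
    obtain \<xi> \<eta> where 1: "0 < \<xi>" "\<xi> < r" "0 < \<eta>" "\<eta> < r"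
      "(g (y + r *\<^sub>R u + r *\<^sub>R v) - g (y + r *\<^sub>R u) - (g (y + r *\<^sub>R v) - g y)) \<bullet> k =
      r * (r * ?A (y + \<xi> *\<^sub>R u + \<eta> *\<^sub>R v))"
      using dir_deriv_mixed_mvt[OF g r] by blast
    obtain \<xi>' \<eta>' where 2: "0 < \<xi>'" "\<xi>' < r" "0 < \<eta>'" "\<eta>' < r"
      "(g (y + r *\<^sub>R v + r *\<^sub>R u) - g (y + r *\<^sub>R v) - (g (y + r *\<^sub>R u) - g y)) \<bullet> k =
      r * (r * ?B (y + \<xi>' *\<^sub>R v + \<eta>' *\<^sub>R u))"
      using dir_deriv_mixed_mvt[OF g r] by blast
    \<comment> \<open>The second difference does not change when \<open>u\<close> and
      \<open>v\<close> are exchanged, so the two mean values agree.\<close>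
    have "r * (r * ?A (y + \<xi> *\<^sub>R u + \<eta> *\<^sub>R v)) = r * (r * ?B (y + \<xi>' *\<^sub>R v + \<eta>' *\<^sub>R u))"
      unfolding 1(5)[symmetric] 2(5)[symmetric] by (simp add: algebra_simps)
    then show ?thesis using 1 2 r unfolding r_def[symmetric] by auto
  qed
  then obtain \<xi> \<eta> \<xi>' \<eta>' where *: "\<And>n. 0 < \<xi> n" "\<And>n. \<xi> n < inverse (real (Suc n))"
     "\<And>n. 0 < \<eta> n" "\<And>n. \<eta> n < inverse (real (Suc n))"
     "\<And>n. 0 < \<xi>' n" "\<And>n. \<xi>' n < inverse (real (Suc n))"
     "\<And>n. 0 < \<eta>' n" "\<And>n. \<eta>' n < inverse (real (Suc n))"
     "\<And>n. ?A (y + \<xi> n *\<^sub>R u + \<eta> n *\<^sub>R v) = ?B (y + \<xi>' n *\<^sub>R v + \<eta>' n *\<^sub>R u)"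
    by metis
  have squeeze: "z \<longlonglongrightarrow> 0" if "\<And>n. 0 < z n" "\<And>n. z n < inverse (real (Suc n))" for z
    by (rule tendsto_sandwich[OF _ _ tendsto_const LIMSEQ_inverse_real_of_nat])
      (use that in \<open>auto intro!: always_eventually less_imp_le\<close>)
  have lim: "(\<lambda>n. h (y + a n *\<^sub>R p + b n *\<^sub>R q)) \<longlonglongrightarrow> h y"
    if "continuous_on UNIV h" "a \<longlonglongrightarrow> 0" "b \<longlonglongrightarrow> 0" for h :: "'a \<Rightarrow> real" and a b p q
  proof -
    have "(\<lambda>n. y + a n *\<^sub>R p + b n *\<^sub>R q) \<longlonglongrightarrow> y + 0 *\<^sub>R p + 0 *\<^sub>R q"
      using that by (intro tendsto_intros)
    then show ?thesis using that(1)
      by (auto simp: continuous_on_eq_continuous_at intro: isCont_tendsto_compose)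
  qed
  have "(\<lambda>n. ?A (y + \<xi> n *\<^sub>R u + \<eta> n *\<^sub>R v)) \<longlonglongrightarrow> ?A y"
    using * by (intro lim[OF cont(1)] squeeze)
  moreover have "(\<lambda>n. ?B (y + \<xi>' n *\<^sub>R v + \<eta>' n *\<^sub>R u)) \<longlonglongrightarrow> ?B y"
    using * by (intro lim[OF cont(2)] squeeze)
  ultimately show "?A y = ?B y" unfolding *(9) by (rule LIMSEQ_unique)
qed

section \<open>Iterated products and brackets of vector fields\<close>

text \<open>Product rule: the outer derivative falls either on \<open>g\<close>, giving a second
  derivative bilinear in \<open>u\<close> and \<open>w\<close>, or on \<open>w\<close>. The first
  term is the one that cancels in brackets.\<close>

lemma vf_prelie_second:
  assumes "C_class 1 w" "C_class 2 g"
  shows "vf_prelie u (vf_prelie w g) y =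
    (\<Sum>b\<in>Basis. (w y \<bullet> b) *\<^sub>R dir_deriv (u y) (dir_deriv b g) y) + dir_deriv (dir_deriv (u y) w y) g y"
proof -
  have g1: "g differentiable at y" "\<And>b. C_class 1 (dir_deriv b g)" for y
    using assms(2) by (auto intro: C_class_differentiable C_class_dir_deriv)
  have eq: "vf_prelie w g = (\<lambda>y. \<Sum>b\<in>Basis. (w y \<bullet> b) *\<^sub>R dir_deriv b g y)"
    by (auto simp: vf_prelie_eq intro!: ext dir_deriv_expand g1)
  have "(vf_prelie w g has_derivative (\<lambda>h. \<Sum>b\<in>Basis. (w y \<bullet> b) *\<^sub>R dir_deriv h (dir_deriv b g) y +
      (dir_deriv h w y \<bullet> b) *\<^sub>R dir_deriv b g y)) (at y)"
    unfolding eq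
    by (rule has_derivative_sum has_derivative_scaleR has_derivative_inner_left
        C_class_has_derivative assms g1 order_refl)+
  from dir_derivI[OF this, of "u y"] show ?thesis
    unfolding vf_prelie_eq[of u] dir_deriv_expand[OF g1(1), of "dir_deriv (u y) w y"]
    by (simp add: sum.distrib)
qed

lemma vf_prelie_bracket:
  assumes "C_class 1 u" "C_class 1 w" "C_class 2 g"
  shows "vf_prelie (vf_bracket u w) g y =
    vf_prelie u (vf_prelie w g) y - vf_prelie w (vf_prelie u g) y"
proof -
  have g1: "C_class 1 (dir_deriv b g)" "g differentiable at y" for b
    using assms(3) by (auto intro: C_class_dir_deriv C_class_differentiable)
  have exp: "dir_deriv p (dir_deriv b g) y = (\<Sum>c\<in>Basis. (p \<bullet> c) *\<^sub>R dir_deriv c (dir_deriv b g) y)" for p b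
    by (rule dir_deriv_expand[OF C_class_differentiable[OF g1(1) order_refl]])
  \<comment> \<open>The second-order term is a bilinear form in the values of \<open>w\<close> and
    \<open>u\<close>; commuting derivatives make it symmetric.\<close>
  have "(\<Sum>b\<in>Basis. (w y \<bullet> b) *\<^sub>R dir_deriv (u y) (dir_deriv b g) y) =
      (\<Sum>b\<in>Basis. \<Sum>c\<in>Basis. (w y \<bullet> b) *\<^sub>R (u y \<bullet> c) *\<^sub>R dir_deriv b (dir_deriv c g) y)"
    unfolding exp[of "u y"] scaleR_sum_right
    by (intro sum.cong refl) (metis dir_deriv_commute[OF assms(3)])
  also have "\<dots> = (\<Sum>c\<in>Basis. \<Sum>b\<in>Basis. (w y \<bullet> b) *\<^sub>R (u y \<bullet> c) *\<^sub>R dir_deriv b (dir_deriv c g) y)"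
    by (rule sum.swap)
  also have "\<dots> = (\<Sum>b\<in>Basis. (u y \<bullet> b) *\<^sub>R dir_deriv (w y) (dir_deriv b g) y)"
    by (simp add: exp[of "w y"] scaleR_sum_right mult.commute)
  finally show ?thesis
    unfolding vf_prelie_second[OF assms(2,3)] vf_prelie_second[OF assms(1,3)]
    using dir_deriv_add_left[OF g1(2), of "dir_deriv (u y) w y" "(-1) *\<^sub>R dir_deriv (w y) u y"]
       dir_deriv_scaleR_left[OF g1(2), of "-1" "dir_deriv (w y) u y"]
    by (simp add: vf_prelie_eq vf_bracket_def)
qed

section \<open>Local expansions\<close>

abbreviation level :: "real \<Rightarrow> nat" where
  "level \<alpha> \<equiv> nat \<lfloor>1 / \<alpha>\<rfloor>"

text \<open>Coefficients that are negligible in an Euler expansion, whatever continuous field they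
  multiply.\<close>

definition higher_order :: "real \<Rightarrow> (real \<Rightarrow> real \<Rightarrow> real) \<Rightarrow> bool" where
  "higher_order T x \<longleftrightarrow> (\<exists>\<beta>>1. \<exists>C. \<forall>s t. 0 \<le> s \<longrightarrow> s \<le> t \<longrightarrow> t \<le> T \<longrightarrow> \<bar>x s t\<bar> \<le> C * (t - s) powr \<beta>)"

text \<open>The length of a time interval may exceed one, so lowering an exponent costs a constant
  that depends on the bound \<open>S\<close>.\<close>

lemma powr_exponent_mono:
  assumes "0 \<le> x" "x \<le> S" "a \<le> b" "0 < a"
  shows "x powr b \<le> (1 + S) powr (b - a) * x powr (a :: real)"
proof (cases "x = 0")
  case False
  then have "x powr b = x powr (b - a) * x powr a"
    by (simp flip: powr_add)
  also have "\<dots> \<le> (1 + S) powr (b - a) * x powr a"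
    by (rule mult_right_mono[OF powr_mono2]) (use assms in auto)
  finally show ?thesis .
qed (use assms in auto)

lemma has_local_expansion_zero: "has_local_expansion T A A"
  unfolding has_local_expansion_def by (intro exI[of _ 2]) (auto intro!: exI[of _ 0])

lemma has_local_expansion_add:
  assumes "has_local_expansion T A B" "has_local_expansion T A' B'"
  shows "has_local_expansion T (\<lambda>s t y. A s t y + A' s t y) (\<lambda>s t y. B s t y + B' s t y)"
proof -
  obtain a where a: "a > 1" "\<And>K. compact K \<Longrightarrow> \<exists>C. \<forall>s t. 0 \<le> s \<longrightarrow> s \<le> t \<longrightarrow> t \<le> T \<longrightarrow>
           (\<forall>y\<in>K. norm (A s t y - B s t y) \<le> C * (t - s) powr a)"
    using assms(1) unfolding has_local_expansion_def by auto
  obtain b where b: "b > 1" "\<And>K. compact K \<Longrightarrow> \<exists>C. \<forall>s t. 0 \<le> s \<longrightarrow> s \<le> t \<longrightarrow> t \<le> T \<longrightarrow>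
           (\<forall>y\<in>K. norm (A' s t y - B' s t y) \<le> C * (t - s) powr b)"
    using assms(2) unfolding has_local_expansion_def by auto
  \<comment> \<open>The two errors come with different exponents; the smaller one is still above one
    and serves both.\<close>
  define \<theta> where "\<theta> = min a b"
  have \<theta>: "\<theta> > 1" "\<theta> \<le> a" "\<theta> \<le> b" using a b by (auto simp: \<theta>_def)
  have "\<exists>C. \<forall>s t. 0 \<le> s \<longrightarrow> s \<le> t \<longrightarrow> t \<le> T \<longrightarrow>
           (\<forall>y\<in>K. norm (A s t y + A' s t y - (B s t y + B' s t y)) \<le> C * (t - s) powr \<theta>)"
    if K: "compact K" for K
  proof -
    obtain C where C: "\<And>s t y. 0 \<le> s \<Longrightarrow> s \<le> t \<Longrightarrow> t \<le> T \<Longrightarrow> y \<in> K \<Longrightarrow>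
           norm (A s t y - B s t y) \<le> C * (t - s) powr a"
      using a(2)[OF K] by auto
    obtain D where D: "\<And>s t y. 0 \<le> s \<Longrightarrow> s \<le> t \<Longrightarrow> t \<le> T \<Longrightarrow> y \<in> K \<Longrightarrow>
           norm (A' s t y - B' s t y) \<le> D * (t - s) powr b"
      using b(2)[OF K] by auto
    let ?E = "\<bar>C\<bar> * (1 + T) powr (a - \<theta>) + \<bar>D\<bar> * (1 + T) powr (b - \<theta>)"
    have "norm (A s t y + A' s t y - (B s t y + B' s t y)) \<le> ?E * (t - s) powr \<theta>"
      if st: "0 \<le> s" "s \<le> t" "t \<le> T" "y \<in> K" for s t y
    proof -
      have "C * (t - s) powr a \<le> \<bar>C\<bar> * ((1 + T) powr (a - \<theta>) * (t - s) powr \<theta>)"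
        by (intro mult_mono powr_exponent_mono) (use st \<theta> in auto)
      moreover have "D * (t - s) powr b \<le> \<bar>D\<bar> * ((1 + T) powr (b - \<theta>) * (t - s) powr \<theta>)"
        by (intro mult_mono powr_exponent_mono) (use st \<theta> in auto)
      moreover have "norm (A s t y + A' s t y - (B s t y + B' s t y)) \<le>
          norm (A s t y - B s t y) + norm (A' s t y - B' s t y)"
        using norm_triangle_ineq[of "A s t y - B s t y" "A' s t y - B' s t y"]
        by (simp add: algebra_simps)
      ultimately show ?thesis using C[OF st] D[OF st] by (simp add: algebra_simps)
    qed
    then show ?thesis by blast
  qed
  then show ?thesis unfolding has_local_expansion_def using \<theta>(1) by blast
qed

lemma has_local_expansion_sum:
  assumes "\<And>i. i \<in> I \<Longrightarrow> has_local_expansion T (A i) (B i)"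
  shows "has_local_expansion T (\<lambda>s t y. \<Sum>i\<in>I. A i s t y) (\<lambda>s t y. \<Sum>i\<in>I. B i s t y)"
  using assms
  by (induction I rule: infinite_finite_induct)
    (auto simp: has_local_expansion_zero intro!: has_local_expansion_add)

lemma has_local_expansion_sym: "has_local_expansion T A B \<Longrightarrow> has_local_expansion T B A"
  unfolding has_local_expansion_def by (simp add: norm_minus_commute)

lemma has_local_expansion_trans:
  assumes "has_local_expansion T A B" "has_local_expansion T B E"
  shows "has_local_expansion T A E"
proof -
  \<comment> \<open>The common term \<open>B\<close> cancels in the difference of the two
    sides.\<close>
  have "has_local_expansion T (\<lambda>s t y. A s t y + B s t y) (\<lambda>s t y. B s t y + E s t y)"
    by (rule has_local_expansion_add[OF assms])
  then show ?thesis unfolding has_local_expansion_def by (simp add: algebra_simps)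
qed

lemma has_local_expansion_cong_right:
  "has_local_expansion T B E \<Longrightarrow> has_local_expansion T A B \<longleftrightarrow> has_local_expansion T A E"
  using has_local_expansion_trans has_local_expansion_sym by metis

lemma has_local_expansion_higher_order:
  assumes "higher_order T x" "continuous_on UNIV g" "continuous_on UNIV h"
  shows "has_local_expansion T (\<lambda>s t y. x s t *\<^sub>R g y) (\<lambda>s t y. x s t *\<^sub>R h y)"
proof -
  obtain \<beta> C where \<beta>: "\<beta> > 1"
    and C: "\<And>s t. 0 \<le> s \<Longrightarrow> s \<le> t \<Longrightarrow> t \<le> T \<Longrightarrow> \<bar>x s t\<bar> \<le> C * (t - s) powr \<beta>"
    using assms(1) unfolding higher_order_def by auto
  have "\<exists>C. \<forall>s t. 0 \<le> s \<longrightarrow> s \<le> t \<longrightarrow> t \<le> T \<longrightarrow>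
           (\<forall>y\<in>K. norm (x s t *\<^sub>R g y - x s t *\<^sub>R h y) \<le> C * (t - s) powr \<beta>)"
    if K: "compact K" for K
  proof -
    have "compact ((\<lambda>y. g y - h y) ` K)"
      using assms K by (intro compact_continuous_image continuous_intros)
        (auto intro: continuous_on_subset)
    then have "bounded ((\<lambda>y. g y - h y) ` K)" by (rule compact_imp_bounded)
    then obtain B where "B > 0" "\<forall>z\<in>(\<lambda>y. g y - h y) ` K. norm z \<le> B" unfolding bounded_pos by auto
    then have B: "\<And>y. y \<in> K \<Longrightarrow> norm (g y - h y) \<le> B" "B > 0" by simp_all
    have "norm (x s t *\<^sub>R g y - x s t *\<^sub>R h y) \<le> (C * B) * (t - s) powr \<beta>"
      if "0 \<le> s" "s \<le> t" "t \<le> T" "y \<in> K" for s t y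
    proof -
      have "norm (x s t *\<^sub>R g y - x s t *\<^sub>R h y) = \<bar>x s t\<bar> * norm (g y - h y)"
        by (simp flip: scaleR_diff_right)
      also have "\<dots> \<le> (C * (t - s) powr \<beta>) * B"
        using C[OF that(1-3)] B that by (intro mult_mono) auto
      finally show ?thesis by (simp add: mult_ac)
    qed
    then show ?thesis by blast
  qed
  then show ?thesis unfolding has_local_expansion_def using \<beta> by blast
qed

text \<open>All Euler expansions are compared through this alternative: for each basis element
  either the two fields coincide, or its coefficient is negligible and continuity of the fields is
  enough.\<close>

lemma has_local_expansion_sum_agree:
  assumes "\<And>b. b \<in> B \<Longrightarrow> (\<forall>y. g b y = h b y) \<or>
      higher_order T (\<lambda>s t. X s t b) \<and> continuous_on UNIV (g b) \<and> continuous_on UNIV (h b)"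
  shows "has_local_expansion T (\<lambda>s t y. \<Sum>b\<in>B. X s t b *\<^sub>R g b y) (\<lambda>s t y. \<Sum>b\<in>B. X s t b *\<^sub>R h b y)"
proof (rule has_local_expansion_sum)
  fix b assume "b \<in> B"
  from assms[OF this] show "has_local_expansion T (\<lambda>s t y. X s t b *\<^sub>R g b y) (\<lambda>s t y. X s t b *\<^sub>R h b y)"
    by (auto simp: has_local_expansion_zero intro: has_local_expansion_higher_order)
qed

text \<open>The case \<open>s = t\<close> has to be supplied separately, since \<open>\<bar>x s t\<bar> / \<bar>t - s\<bar> powr \<beta> = 0\<close> there.\<close>

lemma higher_orderI:
  assumes "\<beta> > 1" "\<And>s. 0 \<le> s \<Longrightarrow> s \<le> T \<Longrightarrow> x s s = 0"
    "\<exists>C. \<forall>s\<in>{0..T}. \<forall>t\<in>{0..T}. s \<noteq> t \<longrightarrow> \<bar>x s t\<bar> / \<bar>t - s\<bar> powr \<beta> \<le> C"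
  shows "higher_order T x"
proof -
  obtain C where C: "\<And>s t. s \<in> {0..T} \<Longrightarrow> t \<in> {0..T} \<Longrightarrow> s \<noteq> t \<Longrightarrow> \<bar>x s t\<bar> / \<bar>t - s\<bar> powr \<beta> \<le> C"
    using assms(3) by blast
  have "\<bar>x s t\<bar> \<le> C * (t - s) powr \<beta>" if "0 \<le> s" "s \<le> t" "t \<le> T" for s t
  proof (cases "s = t")
    case True
    then show ?thesis using assms(2)[of s] that by simp
  next
    case False
    then have "\<bar>x s t\<bar> / (t - s) powr \<beta> \<le> C" "0 < (t - s) powr \<beta>"
      using C[of s t] that by auto
    then show ?thesis by (simp add: divide_le_eq)
  qed
  then show ?thesis unfolding higher_order_def using assms(1) by blast
qed

lemma higher_order_long:
  assumes "0 < \<alpha>" "level \<alpha> < n" "\<And>s. 0 \<le> s \<Longrightarrow> s \<le> T \<Longrightarrow> x s s = 0"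
    "\<exists>C. \<forall>s\<in>{0..T}. \<forall>t\<in>{0..T}. s \<noteq> t \<longrightarrow> \<bar>x s t\<bar> / \<bar>t - s\<bar> powr (\<alpha> * real n) \<le> C"
  shows "higher_order T x"
proof (rule higher_orderI[OF _ assms(3,4)])
  have "1 / \<alpha> < real n" using assms(1,2) by linarith
  then show "1 < \<alpha> * real n" using assms(1) by (simp add: field_simps)
qed auto

lemma higher_order_zeroth:
  assumes "0 < \<alpha>" "\<alpha> \<le> 1" "zeroth_regular len len0 T \<alpha> X" "len b \<le> level \<alpha>"
    "2 \<le> len b" "1 \<le> len0 b" "\<And>s. 0 \<le> s \<Longrightarrow> s \<le> T \<Longrightarrow> X s s b = 0"
  shows "higher_order T (\<lambda>s t. X s t b)"
proof (rule higher_orderI[where \<beta> = "(1 - \<alpha>) * real (len0 b) + \<alpha> * real (len b)"])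
  \<comment> \<open>Length at least two and at least one letter 0 give an exponent of at least
    \<open>(1 - \<alpha>) + 2 * \<alpha> = 1 + \<alpha>\<close>.\<close>
  have "1 < (1 - \<alpha>) * 1 + \<alpha> * 2" using assms(1) by simp
  also have "\<dots> \<le> (1 - \<alpha>) * real (len0 b) + \<alpha> * real (len b)"
    by (intro add_mono mult_left_mono) (use assms in auto)
  finally show "1 < (1 - \<alpha>) * real (len0 b) + \<alpha> * real (len b)" .
  show "\<exists>C. \<forall>s\<in>{0..T}. \<forall>t\<in>{0..T}. s \<noteq> t \<longrightarrow>
      \<bar>X s t b\<bar> / \<bar>t - s\<bar> powr ((1 - \<alpha>) * real (len0 b) + \<alpha> * real (len b)) \<le> C"
    using assms(3,4) unfolding zeroth_regular_def by blast
qed (use assms(7) in auto)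

lemma has_local_expansion_cong:
  assumes "\<And>s t y. 0 \<le> s \<Longrightarrow> s \<le> t \<Longrightarrow> t \<le> T \<Longrightarrow> E s t y = E' s t y"
  shows "has_local_expansion T Y E \<longleftrightarrow> has_local_expansion T Y E'"
  unfolding has_local_expansion_def using assms by (simp cong: ball_cong)

section \<open>Degrees at which the expansions stop, and increments of the underlying path\<close>

text \<open>\<open>min \<alpha> (1 / real N)\<close> is the regularity of the translated path in
  (ii), so this is the degree of its Euler expansion.\<close>

lemma nat_floor_inverse_min:
  assumes "0 < \<alpha>" "1 \<le> N"
  shows "nat \<lfloor>1 / min \<alpha> (1 / real N)\<rfloor> = max (level \<alpha>) N"
proof (cases "\<alpha> \<le> 1 / real N")
  case True
  then have "real N \<le> 1 / \<alpha>" using assms by (simp add: field_simps)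
  then have "N \<le> level \<alpha>" by linarith
  then show ?thesis using True by (simp add: min_def max_def)
next
  case False
  then have "1 / \<alpha> \<le> real N" using assms by (simp add: field_simps)
  then have "level \<alpha> \<le> N" by linarith
  then show ?thesis using False by (simp add: min_def max_def)
qed

lemma nat_floor_inverse_pos: "0 < \<alpha> \<Longrightarrow> \<alpha> \<le> 1 \<Longrightarrow> 1 \<le> level \<alpha>"
  by (simp add: le_nat_iff)

text \<open>Images of words or trees of degree up to \<open>level \<alpha>\<close> have degree up to
  \<open>N * level \<alpha>\<close>, so the expansion of a path of regularity
  \<open>\<alpha> / N\<close> contains them whole.\<close>

lemma mult_nat_floor_le:
  assumes "0 < \<alpha>"
  shows "N * level \<alpha> \<le> nat \<lfloor>real N / \<alpha>\<rfloor>"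
proof -
  have "real (N * level \<alpha>) \<le> real N * (1 / \<alpha>)"
    unfolding of_nat_mult by (intro mult_left_mono) (use assms in auto)
  then show ?thesis unfolding of_nat_mult by (simp add: le_nat_floor flip: of_nat_mult)
qed

text \<open>\<open>n\<close> stands for the pairing with the empty word or forest, \<open>z\<close>
  for that with a single letter. The definition of a rough path does not fix \<open>n = 1\<close>:
  multiplicativity leaves 0 or 1, Chen's relation makes the value the same for all pairs of times,
  and if it is 0 then \<open>z\<close> vanishes too.\<close>

lemma chen_increment:
  fixes n z :: "real \<Rightarrow> real \<Rightarrow> real"
  assumes n: "\<And>a b c. a \<in> S \<Longrightarrow> b \<in> S \<Longrightarrow> c \<in> S \<Longrightarrow> n a b = n a c * n c b"
    and z: "\<And>a b c. a \<in> S \<Longrightarrow> b \<in> S \<Longrightarrow> c \<in> S \<Longrightarrow> z a b = n a c * z c b + z a c * n c b"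
    and char: "\<And>a b. a \<in> S \<Longrightarrow> b \<in> S \<Longrightarrow> n a b = n a b * n a b \<and> z a b = n a b * z a b"
    and S: "r \<in> S" "s \<in> S" "t \<in> S"
  shows "z r t - z r s = z s t"
proof (cases "n r r = 0")
  case True
  then have "n a b = 0" if "a \<in> S" "b \<in> S" for a b
    using n[OF that S(1)] n[OF S(1) that(2) S(1)] by simp
  then have "z a b = 0" if "a \<in> S" "b \<in> S" for a b using char[OF that] that by simp
  then show ?thesis using S by simp
next
  case False
  then have "n a b \<noteq> 0" if "a \<in> S" "b \<in> S" for a b
    using n[OF S(1) S(1) that(1)] n[OF that(1) S(1) that(2)] that n[OF S(1) S(1) that(2)] by auto
  then have "n a b = 1" if "a \<in> S" "b \<in> S" for a b using char[OF that] that by simp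
  then show ?thesis using z[OF S(1,3,2)] S by simp
qed

section \<open>Linear maps of formal series\<close>

lemma sum_fun_apply: "(\<Sum>i\<in>I. u i) b = (\<Sum>i\<in>I. u i b)"
  by (induction I rule: infinite_finite_induct) auto

lemma scale_series_apply [simp]: "scale_series c x b = c * x b"
  by (simp add: scale_series_def)

lemma unit_series_apply: "unit_series b c = (if c = b then 1 else 0)"
  by (simp add: unit_series_def)

lemma series_eq_sum:
  assumes "finite B" "\<And>b. b \<notin> B \<Longrightarrow> x b = 0"
  shows "x = (\<Sum>b\<in>B. scale_series (x b) (unit_series b))"
  using assms by (auto simp: sum_fun_apply unit_series_apply if_distrib cong: if_cong)

lemma linear_series_add: "linear_series L \<Longrightarrow> L (x + y) = L x + L y"
  and linear_series_scale: "linear_series L \<Longrightarrow> L (scale_series c x) = scale_series c (L x)"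
  by (auto simp: linear_series_def)

lemma linear_series_zero:
  assumes "linear_series L"
  shows "L 0 = 0"
proof -
  have "L (scale_series 0 0) = scale_series 0 (L 0)" using assms by (rule linear_series_scale)
  then show ?thesis by (simp add: scale_series_def zero_fun_def)
qed

lemma linear_series_sum: "linear_series L \<Longrightarrow> L (\<Sum>i\<in>I. x i) = (\<Sum>i\<in>I. L (x i))"
  by (induction I rule: infinite_finite_induct) (auto simp: linear_series_zero linear_series_add)

lemma linear_series_finite:
  assumes "linear_series L" "finite B" "\<And>b. b \<notin> B \<Longrightarrow> x b = 0"
  shows "L x c = (\<Sum>b\<in>B. x b * L (unit_series b) c)"
  by (subst series_eq_sum[OF assms(2,3)])
    (simp_all add: linear_series_sum[OF assms(1)] linear_series_scale[OF assms(1)] sum_fun_apply)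

text \<open>Only elements of bounded \<open>len\<close> reach the coordinate \<open>c\<close>, so
  all late truncations of \<open>x\<close> have the same image there. They converge to
  \<open>x\<close> in the product topology, and continuity carries the finite formula over to
  \<open>x\<close>.\<close>

lemma continuous_linear_series_eq:
  fixes len :: "'b \<Rightarrow> nat"
  assumes "continuous_on UNIV L" "linear_series L" "\<And>n. finite {b. len b \<le> n}"
    and "\<And>b. n < len b \<Longrightarrow> L (unit_series b) c = 0"
  shows "L x c = (\<Sum>b | len b \<le> n. x b * L (unit_series b) c)"
proof -
  define x' where "x' k = (\<lambda>b. if len b \<le> k then x b else 0)" for k
  have eq: "L (x' k) c = (\<Sum>b | len b \<le> n. x b * L (unit_series b) c)" if "n \<le> k" for k
  proof -
    have "L (x' k) c = (\<Sum>b | len b \<le> k. x' k b * L (unit_series b) c)"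
      by (rule linear_series_finite) (use assms in \<open>auto simp: x'_def\<close>)
    also have "\<dots> = (\<Sum>b | len b \<le> n. x b * L (unit_series b) c)"
      by (rule sum.mono_neutral_cong_right) (use assms that in \<open>auto simp: x'_def\<close>)
    finally show ?thesis .
  qed
  have "(\<lambda>k. x' k b) \<longlonglongrightarrow> x b" for b
    by (rule tendsto_eventually) (auto simp: x'_def eventually_sequentially intro!: exI[of _ "len b"])
  then have "limitin (product_topology (\<lambda>i. euclidean) UNIV) x' x sequentially"
    by (simp add: limitin_componentwise)
  then have "x' \<longlonglongrightarrow> x" by (simp add: euclidean_product_topology)
  then have "(\<lambda>k. L (x' k)) \<longlonglongrightarrow> L x"
    by (rule continuous_on_tendsto_compose[OF assms(1)]) auto
  then have "limitin (product_topology (\<lambda>i. euclidean) UNIV) (\<lambda>k. L (x' k)) (L x) sequentially"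
    by (simp add: euclidean_product_topology)
  then have "(\<lambda>k. L (x' k) c) \<longlonglongrightarrow> L x c" by (simp add: limitin_componentwise)
  moreover have "(\<lambda>k. L (x' k) c) \<longlonglongrightarrow> (\<Sum>b | len b \<le> n. x b * L (unit_series b) c)"
    by (rule tendsto_eventually) (auto simp: eq eventually_sequentially intro!: exI[of _ n])
  ultimately show ?thesis by (rule LIMSEQ_unique)
qed

section \<open>Words as differential operators\<close>

text \<open>\<open>word_field\<close> with an arbitrary function in place of the identity, so that
  concatenation of words becomes composition of operators.\<close>

primrec word_op :: "('l \<Rightarrow> 'e \<Rightarrow> 'e) \<Rightarrow> 'l list \<Rightarrow> ('e \<Rightarrow> 'e) \<Rightarrow> 'e \<Rightarrow> 'e::euclidean_space" where
  "word_op f [] g = g"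
| "word_op f (i # w) g = vf_prelie (f i) (word_op f w g)"

lemma word_op_append: "word_op f (a @ b) g = word_op f a (word_op f b g)"
  by (induction a) auto

lemma word_field_eq: "word_field f w = word_op f w (\<lambda>y. y)"
  by (induction w) auto

text \<open>Each letter differentiates all that stands to its right: \<open>g\<close> is
  differentiated \<open>length w\<close> times, but the last field only \<open>length w - 1\<close>
  times. Hence the bound by \<open>Suc r\<close>.\<close>

lemma C_class_word_op:
  assumes "\<And>i. C_class r (f i)" "C_class (k + length w) g" "k + length w \<le> Suc r"
  shows "C_class k (word_op f w g)"
  using assms(2,3)
proof (induction w arbitrary: k)
  case (Cons i w)
  from Cons.IH[of "Suc k"] Cons.prems show ?case
    using C_class_mono[OF assms(1)[of i], of k] by (auto intro!: C_class_vf_prelie)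
qed simp

lemma C_class_word_field:
  assumes "\<And>i. C_class r (f i)" "k + length w \<le> Suc r"
  shows "C_class k (word_field f w)"
  unfolding word_field_eq using assms by (intro C_class_word_op C_class_id)

lemma word_op_sum:
  assumes "\<And>i. C_class r (f i)" "length w \<le> Suc r" "\<And>j. j \<in> J \<Longrightarrow> C_class (length w) (g j)"
  shows "word_op f w (\<lambda>y. \<Sum>j\<in>J. c j *\<^sub>R g j y) = (\<lambda>y. \<Sum>j\<in>J. c j *\<^sub>R word_op f w (g j) y)"
  using assms(2,3)
proof (induction w)
  case (Cons i w)
  then have IH: "word_op f w (\<lambda>y. \<Sum>j\<in>J. c j *\<^sub>R g j y) = (\<lambda>y. \<Sum>j\<in>J. c j *\<^sub>R word_op f w (g j) y)"
    by (auto dest: C_class_Suc_imp)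
  have "word_op f w (g j) differentiable at y" if "j \<in> J" for j y
    using Cons.prems that by (intro C_class_differentiable[of 1] C_class_word_op[OF assms(1)]) auto
  then show ?case
    by (simp add: IH vf_prelie_eq fun_eq_iff dir_deriv_sum dir_deriv_scaleR)
qed simp

abbreviation words_upto :: "nat \<Rightarrow> 'l list set" where
  "words_upto n \<equiv> {w. length w \<le> n}"

lemma finite_words_upto: "finite (words_upto n :: 'l::finite list set)"
  using finite_lists_length_le[of "UNIV :: 'l set" n] by simp

lemma sum_tensor_prod:
  fixes u v :: "'l::finite tensor_series" and \<phi> :: "'l list \<Rightarrow> 'a::real_vector"
  assumes u: "\<And>w. length w > m \<Longrightarrow> u w = 0" and v: "\<And>w. length w > n \<Longrightarrow> v w = 0" and "m + n \<le> N"
  shows "(\<Sum>w\<in>words_upto N. tensor_prod u v w *\<^sub>R \<phi> w) =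
    (\<Sum>a\<in>words_upto m. \<Sum>b\<in>words_upto n. (u a * v b) *\<^sub>R \<phi> (a @ b))"
proof -
  let ?S = "Sigma (words_upto N :: 'l list set) (\<lambda>w. {..length w})"
  let ?S' = "{p \<in> ?S. length (take (snd p) (fst p)) > m \<or> length (drop (snd p) (fst p)) > n}"
  have fin: "finite ?S" by (intro finite_SigmaI) (auto simp: finite_words_upto)
  have "(\<Sum>w\<in>words_upto N. tensor_prod u v w *\<^sub>R \<phi> w) =
      (\<Sum>w\<in>words_upto N. \<Sum>k\<le>length w. (u (take k w) * v (drop k w)) *\<^sub>R \<phi> w)"
    by (simp add: tensor_prod_def scaleR_sum_left)
  also have "\<dots> = (\<Sum>(w, k)\<in>?S. (u (take k w) * v (drop k w)) *\<^sub>R \<phi> w)"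
    by (rule sum.Sigma) (auto simp: finite_words_upto)
  \<comment> \<open>A word with a splitting position is a pair of words. Positions whose prefix or
    suffix exceeds the degree of its factor have coefficient zero and make up
    \<open>?S'\<close>.\<close>
  also have "\<dots> = (\<Sum>(a, b)\<in>words_upto m \<times> words_upto n. (u a * v b) *\<^sub>R \<phi> (a @ b))"
    by (rule sum.reindex_bij_witness_not_neutral[where S' = ?S' and T' = "{}" and
        i = "\<lambda>(a, b). (a @ b, length a)" and j = "\<lambda>(w, k). (take k w, drop k w)"])
      (use fin u v \<open>m + n \<le> N\<close> in \<open>auto simp: not_less\<close>)
  also have "\<dots> = (\<Sum>a\<in>words_upto m. \<Sum>b\<in>words_upto n. (u a * v b) *\<^sub>R \<phi> (a @ b))"
    by (rule sum.Sigma[symmetric]) (auto simp: finite_words_upto)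
  finally show ?thesis .
qed

lemma sum_words_upto_extend:
  fixes u :: "'l::finite tensor_series" and \<phi> :: "'l list \<Rightarrow> 'a::real_vector"
  assumes "\<And>w. length w > m \<Longrightarrow> u w = 0" "m \<le> n"
  shows "(\<Sum>w\<in>words_upto m. u w *\<^sub>R \<phi> w) = (\<Sum>w\<in>words_upto n. u w *\<^sub>R \<phi> w)"
  by (rule sum.mono_neutral_left) (use assms in \<open>auto simp: finite_words_upto not_le\<close>)

lemma tensor_prod_high:
  assumes "\<And>w. length w > m \<Longrightarrow> u w = 0" "\<And>w. length w > n \<Longrightarrow> v w = 0" "length w > m + n"
  shows "tensor_prod u v w = 0"
  unfolding tensor_prod_def
proof (rule sum.neutral, rule ballI)
  fix k assume "k \<in> {..length w}"
  then have "length (take k w) > m \<or> length (drop k w) > n" using assms(3) by auto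
  then show "u (take k w) * v (drop k w) = 0" using assms(1,2) by fastforce
qed

lemma tensor_prod_low:
  assumes "\<And>w. length w < m \<Longrightarrow> u w = 0" "\<And>w. length w < n \<Longrightarrow> v w = 0" "length w < m + n"
  shows "tensor_prod u v w = 0"
  unfolding tensor_prod_def
proof (rule sum.neutral, rule ballI)
  fix k assume "k \<in> {..length w}"
  then have "length (take k w) < m \<or> length (drop k w) < n" using assms(3) by auto
  then show "u (take k w) * v (drop k w) = 0" using assms(1,2) by fastforce
qed

text \<open>
  A Lie polynomial acts as a first order operator, i.e. as a vector field; this is what makes
  \<open>lie_field_graph\<close> single-valued.
\<close>

lemma lie_field_graph_word_op:
  fixes f :: "'l::finite \<Rightarrow> 'e \<Rightarrow> 'e::euclidean_space"
  assumes "lie_field_graph f n u U" "\<And>i. C_class r (f i)" "n \<le> Suc r"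
  shows "1 \<le> n \<and> (\<forall>w. length w > n \<longrightarrow> u w = 0) \<and> C_class (Suc r - n) U \<and>
    (\<forall>g y. C_class n g \<longrightarrow> vf_prelie U g y = (\<Sum>w\<in>words_upto n. u w *\<^sub>R word_op f w g y))"
  using assms(1,3)
proof (induction rule: lie_field_graph.induct)
  case (1 N i)
  have "(\<Sum>w\<in>words_upto N. unit_series [i] w *\<^sub>R word_op f w g y) = vf_prelie (f i) g y" for g y
    using \<open>1 \<le> N\<close> sum.delta[of "words_upto N" "[i]" "\<lambda>w. word_op f w g y"]
    by (simp add: unit_series_apply if_distrib[where f="\<lambda>c. c *\<^sub>R _"] finite_words_upto cong: if_cong)
  moreover have "C_class (Suc r - N) (f i)"
    using assms(2) by (rule C_class_mono) (use 1 in auto)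
  ultimately show ?case using 1 by (auto simp: unit_series_apply)
next
  case (2 N u U w W)
  have "vf_prelie (\<lambda>y. U y + W y) g y = vf_prelie U g y + vf_prelie W g y" if "C_class N g" for g y
    using 2 C_class_differentiable[OF that] by (simp add: vf_prelie_eq dir_deriv_add_left)
  with 2 show ?case by (auto simp: scaleR_add_left sum.distrib intro: C_class_add)
next
  case (3 N u U c)
  have "vf_prelie (\<lambda>y. c *\<^sub>R U y) g y = c *\<^sub>R vf_prelie U g y" if "C_class N g" for g y
    using 3 C_class_differentiable[OF that] by (simp add: vf_prelie_eq dir_deriv_scaleR_left)
  with 3 show ?case by (auto simp: scaleR_sum_right intro: C_class_scaleR)
next
  case (4 m u U n w W N)
  then have m: "1 \<le> m" "\<And>w. length w > m \<Longrightarrow> u w = 0" "C_class (Suc r - m) U"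
      "\<And>g y. C_class m g \<Longrightarrow> vf_prelie U g y = (\<Sum>w\<in>words_upto m. u w *\<^sub>R word_op f w g y)"
    and n: "1 \<le> n" "\<And>v. length v > n \<Longrightarrow> w v = 0" "C_class (Suc r - n) W"
      "\<And>g y. C_class n g \<Longrightarrow> vf_prelie W g y = (\<Sum>v\<in>words_upto n. w v *\<^sub>R word_op f v g y)"
    and N: "m + n \<le> N" "N \<le> Suc r"
    by auto
  \<comment> \<open>Composition of two operators, stated for general \<open>P\<close> and
    \<open>Q\<close> because the bracket needs it in both orders. The inner result is of class
    \<open>k\<close> since \<open>k + l \<le> N\<close> and \<open>N \<le> Suc r\<close>, which is
    what the outer operator of degree \<open>k\<close> requires.\<close>
  have prod: "vf_prelie P (vf_prelie Q g) y = (\<Sum>v\<in>words_upto N. tensor_prod p q v *\<^sub>R word_op f v g y)"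
    if p: "1 \<le> k" "\<And>w. length w > k \<Longrightarrow> p w = 0"
      "\<And>g y. C_class k g \<Longrightarrow> vf_prelie P g y = (\<Sum>w\<in>words_upto k. p w *\<^sub>R word_op f w g y)"
    and q: "1 \<le> l" "\<And>w. length w > l \<Longrightarrow> q w = 0" "C_class (Suc r - l) Q"
      "\<And>g y. C_class l g \<Longrightarrow> vf_prelie Q g y = (\<Sum>w\<in>words_upto l. q w *\<^sub>R word_op f w g y)"
    and kl: "k + l \<le> N" and g: "C_class N g"
    for k l p q P Q g y
  proof -
    have Qg: "vf_prelie Q g = (\<lambda>y. \<Sum>b\<in>words_upto l. q b *\<^sub>R word_op f b g y)"
      using q(4) C_class_mono[OF g] kl by fastforce
    have "C_class k (vf_prelie Q g)"
      using q(3) g kl N(2) p(1) q(1) by (intro C_class_vf_prelie) (auto elim: C_class_mono)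
    then have "vf_prelie P (vf_prelie Q g) y =
        (\<Sum>a\<in>words_upto k. p a *\<^sub>R word_op f a (vf_prelie Q g) y)"
      by (rule p(3))
    also have "\<dots> = (\<Sum>a\<in>words_upto k. \<Sum>b\<in>words_upto l. (p a * q b) *\<^sub>R word_op f (a @ b) g y)"
    proof (rule sum.cong[OF refl])
      fix a :: "'l list" assume a: "a \<in> words_upto k"
      have "C_class (length a) (word_op f b g)" if "b \<in> words_upto l" for b
        by (rule C_class_word_op[OF assms(2) C_class_mono[OF g]]) (use a that kl N in auto)
      then have "word_op f a (vf_prelie Q g) = (\<lambda>y. \<Sum>b\<in>words_upto l. q b *\<^sub>R word_op f a (word_op f b g) y)"
        unfolding Qg using a kl N by (intro word_op_sum[OF assms(2)]) auto
      then show "p a *\<^sub>R word_op f a (vf_prelie Q g) y =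
          (\<Sum>b\<in>words_upto l. (p a * q b) *\<^sub>R word_op f (a @ b) g y)"
        by (simp add: word_op_append scaleR_sum_right)
    qed
    also have "\<dots> = (\<Sum>v\<in>words_upto N. tensor_prod p q v *\<^sub>R word_op f v g y)"
      by (rule sum_tensor_prod[symmetric]) (use p q kl in auto)
    finally show ?thesis .
  qed
  have "vf_prelie (vf_bracket U W) g y = (\<Sum>v\<in>words_upto N. lie_bracket u w v *\<^sub>R word_op f v g y)"
    if g: "C_class N g" for g y
  proof -
    \<comment> \<open>Only in the commutator do the two compositions combine to the action of a
      vector field again.\<close>
    have "vf_prelie (vf_bracket U W) g y = vf_prelie U (vf_prelie W g) y - vf_prelie W (vf_prelie U g) y"
      by (intro vf_prelie_bracket C_class_mono[OF m(3)] C_class_mono[OF n(3)] C_class_mono[OF g])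
        (use m(1) n(1) N in auto)
    also have "vf_prelie U (vf_prelie W g) y = (\<Sum>v\<in>words_upto N. tensor_prod u w v *\<^sub>R word_op f v g y)"
      by (rule prod[OF m(1,2,4) n]) (use N g in auto)
    also have "vf_prelie W (vf_prelie U g) y = (\<Sum>v\<in>words_upto N. tensor_prod w u v *\<^sub>R word_op f v g y)"
      by (rule prod[OF n(1,2,4) m]) (use N g in auto)
    finally show ?thesis
      by (simp add: lie_bracket_def scaleR_diff_left sum_subtractf)
  qed
  moreover have "C_class (Suc r - N) (vf_bracket U W)"
  proof -
    have "C_class (Suc r - N) (vf_prelie P Q)"
      if "1 \<le> k" "1 \<le> l" "k + l \<le> N" "C_class (Suc r - k) P" "C_class (Suc r - l) Q" for k l P Q
      using that by (intro C_class_vf_prelie C_class_mono[OF that(4)] C_class_mono[OF that(5)]) (use N in auto)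
    from C_class_add[OF this C_class_scaleR[OF this], of m n U W n m W U "-1"] show ?thesis
      using m n N by (simp add: vf_bracket_def add.commute)
  qed
  moreover have "lie_bracket u w v = 0" if "length v > N" for v
    using tensor_prod_high[of m u n w v] tensor_prod_high[of n w m u v] m n N that
    by (simp add: lie_bracket_def)
  ultimately show ?case using m n N by auto
qed

section \<open>Existence and uniqueness of the field of a Lie polynomial\<close>

definition word_series_field ::
  "('l::finite \<Rightarrow> 'e \<Rightarrow> 'e::euclidean_space) \<Rightarrow> nat \<Rightarrow> 'l tensor_series \<Rightarrow> 'e \<Rightarrow> 'e" where
  "word_series_field f n u = (\<lambda>y. \<Sum>w\<in>words_upto n. u w *\<^sub>R word_field f w y)"

lemma word_series_field_extend:
  assumes "\<And>w. length w > m \<Longrightarrow> u w = 0" "m \<le> n"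
  shows "word_series_field f m u = word_series_field f n u"
  unfolding word_series_field_def using sum_words_upto_extend[OF assms] by fastforce

lemma lie_field_graph_unique:
  assumes "lie_field_graph f n u U" "\<And>i. C_class r (f i)" "n \<le> Suc r"
  shows "U = word_series_field f n u"
proof
  fix y
  \<comment> \<open>A vector field is recovered from its operator by applying it to the
    identity.\<close>
  have "U y = vf_prelie U (\<lambda>y. y) y" by (simp add: vf_prelie_eq dir_deriv_id)
  with lie_field_graph_word_op[OF assms] show "U y = word_series_field f n u y"
    by (simp add: C_class_id word_field_eq word_series_field_def)
qed

text \<open>No rule produces zero directly; it enters as the zero multiple of a letter, which
  explains the shape of the field.\<close>

lemma lie_field_graph_zero:
  assumes "1 \<le> n"
  shows "lie_field_graph f n 0 (\<lambda>y. 0 *\<^sub>R f undefined y)"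
proof -
  have "lie_field_graph f n (scale_series 0 (unit_series [undefined])) (\<lambda>y. 0 *\<^sub>R f undefined y)"
    by (rule lie_field_graph.intros(3)[OF lie_field_graph.intros(1)[OF assms]])
  then show ?thesis by (simp add: scale_series_def zero_fun_def)
qed

lemma lie_field_graph_sum:
  assumes "1 \<le> n" "\<And>i. i \<in> I \<Longrightarrow> \<exists>U. lie_field_graph f n (u i) U"
  shows "\<exists>U. lie_field_graph f n (\<Sum>i\<in>I. u i) U"
  using assms(2)
proof (induction I rule: infinite_finite_induct)
  case (insert i I)
  then obtain U W where "lie_field_graph f n (u i) U" "lie_field_graph f n (\<Sum>i\<in>I. u i) W" by blast
  then show ?case unfolding sum.insert[OF insert(1,2)] by (blast intro: lie_field_graph.intros(2))
qed (use lie_field_graph_zero[OF assms(1)] in \<open>auto simp del: zero_fun_apply\<close>)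

lemma lie_field_graph_mono: "lie_field_graph f m u U \<Longrightarrow> m \<le> n \<Longrightarrow> lie_field_graph f n u U"
proof (induction arbitrary: n rule: lie_field_graph.induct)
  case (4 m u U k w W N)
  then show ?case by (intro lie_field_graph.intros(4)[of f m u U k w W]) auto
qed (auto intro: lie_field_graph.intros)

lemma lie_polynomials_Nil: "u \<in> lie_polynomials \<Longrightarrow> u [] = 0"
  by (induction rule: lie_polynomials.induct)
    (auto simp: unit_series_apply lie_bracket_def tensor_prod_def)

definition degree_part :: "nat \<Rightarrow> 'l tensor_series \<Rightarrow> 'l tensor_series" where
  "degree_part k u = (\<lambda>w. if length w = k then u w else 0)"

text \<open>Without constant terms the two end positions drop out, so both factors have degree at
  least one and below \<open>k\<close>.\<close>

lemma degree_part_tensor_prod: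
  assumes "x [] = 0" "y [] = 0"
  shows "degree_part k (tensor_prod x y) =
    (\<Sum>i\<in>{1..<k}. tensor_prod (degree_part i x) (degree_part (k - i) y))"
proof
  fix w
  show "degree_part k (tensor_prod x y) w =
    (\<Sum>i\<in>{1..<k}. tensor_prod (degree_part i x) (degree_part (k - i) y)) w"
  proof (cases "length w = k")
    case True
    have "tensor_prod (degree_part i x) (degree_part (k - i) y) w = x (take i w) * y (drop i w)"
      if "i \<in> {1..<k}" for i
    proof -
      have "tensor_prod (degree_part i x) (degree_part (k - i) y) w =
          (\<Sum>j\<le>k. if j = i then x (take i w) * y (drop i w) else 0)"
        unfolding tensor_prod_def True
        by (rule sum.cong) (use True in \<open>auto simp: degree_part_def\<close>)
      then show ?thesis using that by simp
    qed
    then have "(\<Sum>i\<in>{1..<k}. tensor_prod (degree_part i x) (degree_part (k - i) y)) w =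
        (\<Sum>i\<in>{1..<k}. x (take i w) * y (drop i w))"
      by (simp add: sum_fun_apply)
    also have "\<dots> = (\<Sum>i\<le>k. x (take i w) * y (drop i w))"
      by (rule sum.mono_neutral_left) (use True assms in \<open>auto simp: not_less_eq_eq Suc_le_eq\<close>)
    finally show ?thesis using True by (simp add: degree_part_def tensor_prod_def)
  next
    case False
    have "tensor_prod (degree_part i x) (degree_part (k - i) y) w = 0" if "i \<in> {1..<k}" for i
      unfolding tensor_prod_def
      by (rule sum.neutral) (use that False in \<open>auto simp: degree_part_def\<close>)
    then show ?thesis using False by (simp add: degree_part_def sum_fun_apply)
  qed
qed

text \<open>A Lie polynomial of low degree may be written with brackets of higher degree that
  cancel, and the graph does not admit those. Passing to homogeneous components removes them: the
  part of degree \<open>k\<close> of a bracket is a sum of brackets of parts whose degrees add up to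
  \<open>k\<close>.\<close>

lemma lie_field_graph_degree_part:
  assumes "u \<in> lie_polynomials" "1 \<le> k"
  shows "\<exists>U. lie_field_graph f k (degree_part k u) U"
  using assms
proof (induction arbitrary: k rule: lie_polynomials.induct)
  case (1 i)
  show ?case
  proof (cases "k = 1")
    case True
    then have "degree_part k (unit_series [i]) = unit_series [i]"
      by (auto simp: degree_part_def unit_series_apply)
    then show ?thesis using 1 lie_field_graph.intros(1) by metis
  next
    case False
    then have "degree_part k (unit_series [i]) = 0"
      by (auto simp: degree_part_def unit_series_apply)
    then show ?thesis using 1 lie_field_graph_zero by metis
  qed
next
  case (2 x y)
  have "degree_part k (x + y) = degree_part k x + degree_part k y"
    by (auto simp: degree_part_def)
  moreover obtain U W where "lie_field_graph f k (degree_part k x) U" "lie_field_graph f k (degree_part k y) W"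
    using 2(3,4)[OF 2(5)] by blast
  then have "lie_field_graph f k (degree_part k x + degree_part k y) (\<lambda>y. U y + W y)"
    by (rule lie_field_graph.intros(2))
  ultimately show ?case by metis
next
  case (3 x c)
  have "degree_part k (scale_series c x) = scale_series c (degree_part k x)"
    by (auto simp: degree_part_def)
  moreover obtain U where "lie_field_graph f k (degree_part k x) U"
    using 3(2)[OF 3(3)] by blast
  then have "lie_field_graph f k (scale_series c (degree_part k x)) (\<lambda>y. c *\<^sub>R U y)"
    by (rule lie_field_graph.intros(3))
  ultimately show ?case by metis
next
  case (4 x y)
  have nil: "x [] = 0" "y [] = 0" using 4 lie_polynomials_Nil by auto
  \<comment> \<open>Reversing one sum pairs the terms of the two tensor products into
    brackets.\<close>
  have rev: "(\<Sum>i\<in>{1..<k}. tensor_prod (degree_part i y) (degree_part (k - i) x)) =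
      (\<Sum>i\<in>{1..<k}. tensor_prod (degree_part (k - i) y) (degree_part i x))"
    by (rule sum.reindex_bij_witness[where i="\<lambda>i. k - i" and j="\<lambda>i. k - i"]) auto
  have "degree_part k (lie_bracket x y) = degree_part k (tensor_prod x y) - degree_part k (tensor_prod y x)"
    by (auto simp: degree_part_def lie_bracket_def)
  also have "\<dots> = (\<Sum>i\<in>{1..<k}. lie_bracket (degree_part i x) (degree_part (k - i) y))"
    unfolding degree_part_tensor_prod[of x y, OF nil] degree_part_tensor_prod[of y x, OF nil(2,1)] rev
    by (simp add: lie_bracket_def sum_subtractf)
  finally have eq: "degree_part k (lie_bracket x y) =
    (\<Sum>i\<in>{1..<k}. lie_bracket (degree_part i x) (degree_part (k - i) y))" .
  show ?case unfolding eq
  proof (rule lie_field_graph_sum[OF 4(5)])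
    fix i assume "i \<in> {1..<k}"
    then have i: "1 \<le> i" "1 \<le> k - i" "i + (k - i) \<le> k" by auto
    then show "\<exists>U. lie_field_graph f k (lie_bracket (degree_part i x) (degree_part (k - i) y)) U"
      using 4(3)[OF i(1)] 4(4)[OF i(2)] lie_field_graph.intros(4)[OF _ _ i(3)] by blast
  qed
qed

lemma lie_field_graph_exists:
  assumes "u \<in> lie_step N" "1 \<le> N"
  shows "\<exists>U. lie_field_graph f N u U"
proof -
  have u: "u \<in> lie_polynomials" "\<And>w. length w > N \<Longrightarrow> u w = 0" using assms by (auto simp: lie_step_def)
  have "u = (\<Sum>k\<in>{1..N}. degree_part k u)"
  proof
    fix w
    have "(\<Sum>k\<in>{1..N}. degree_part k u) w = (\<Sum>k\<in>{1..N}. if k = length w then u w else 0)"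
      unfolding sum_fun_apply by (rule sum.cong) (auto simp: degree_part_def)
    then show "u w = (\<Sum>k\<in>{1..N}. degree_part k u) w"
      using u(2)[of w] lie_polynomials_Nil[OF u(1)] by (cases "w = []") (auto simp: not_le Suc_le_eq)
  qed
  moreover have "\<exists>U. lie_field_graph f N (\<Sum>k\<in>{1..N}. degree_part k u) U"
  proof (rule lie_field_graph_sum[OF assms(2)])
    fix k assume "k \<in> {1..N}"
    then show "\<exists>U. lie_field_graph f N (degree_part k u) U"
      using lie_field_graph_degree_part[OF u(1), of k f] lie_field_graph_mono[of f k _ _ N] by auto
  qed
  ultimately show ?thesis by simp
qed

lemma lie_step_unit_add: "v \<in> lie_step N \<Longrightarrow> 1 \<le> N \<Longrightarrow> unit_series [i] + v \<in> lie_step N"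
  by (auto simp: lie_step_def unit_series_apply intro: lie_polynomials.intros)

text \<open>\<open>THE\<close> denotes a value of the graph because every value is given by the same
  formula \<open>word_series_field\<close>.\<close>

lemma lie_field_graph_lie_field:
  fixes f :: "'l::finite \<Rightarrow> 'e \<Rightarrow> 'e::euclidean_space"
  assumes "u \<in> lie_step N" "1 \<le> N" "\<And>i. C_class r (f i)" "N \<le> Suc r"
  shows "lie_field_graph f N u (lie_field f N u)"
proof -
  obtain U where U: "lie_field_graph f N u U" using lie_field_graph_exists assms by blast
  have "(THE U. lie_field_graph f N u U) = U"
  proof (rule the_equality[where P = "lie_field_graph f N u"])
    show "W = U" if "lie_field_graph f N u W" for W
      using lie_field_graph_unique[OF that assms(3,4)] lie_field_graph_unique[OF U assms(3,4)] by simp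
  qed (rule U)
  with U show ?thesis by (simp add: lie_field_def)
qed

section \<open>Translation of tensor series\<close>

lemma tensor_prod_unit_Cons: "tensor_prod (unit_series [i]) (unit_series w) = unit_series (i # w)"
proof
  fix w'
  show "tensor_prod (unit_series [i]) (unit_series w) w' = unit_series (i # w) w'"
  proof (cases w')
    case (Cons j w'')
    have "tensor_prod (unit_series [i]) (unit_series w) w' =
        (\<Sum>k\<in>{..length w'}. if k = 1 then unit_series (i # w) w' else 0)"
      unfolding tensor_prod_def
    proof (rule sum.cong[OF refl])
      fix k assume "k \<in> {..length w'}"
      moreover have "take k w' \<noteq> [i]" if "k \<noteq> 1" "k \<le> length w'"
        using that by (metis length_take min.absorb2 One_nat_def length_Cons list.size(3))
      ultimately show "unit_series [i] (take k w') * unit_series w (drop k w') =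
          (if k = 1 then unit_series (i # w) w' else 0)"
        using Cons by (auto simp: unit_series_apply)
    qed
    also have "\<dots> = unit_series (i # w) w'" using Cons by (auto simp: Suc_le_eq)
    finally show ?thesis .
  qed (simp add: tensor_prod_def unit_series_apply)
qed

context
  fixes v :: "'l::{finite, zero} \<Rightarrow> 'l tensor_series" and \<T> N
  assumes tr: "is_geometric_translation v \<T>" and v: "\<And>i. v i \<in> lie_step N" and N: "1 \<le> N"
begin

lemma translation_unit_Cons:
  "\<T> (unit_series (i # w)) = tensor_prod (unit_series [i] + v i) (\<T> (unit_series w))"
  using tr unfolding is_geometric_translation_def
  by (metis tensor_prod_unit_Cons)

text \<open>A letter becomes a series without constant term, since Lie polynomials have none, so
  translation never lowers the degree. This makes every coordinate of \<open>\<T> x\<close> a finite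
  sum.\<close>

lemma translation_unit_low: "length w' < length w \<Longrightarrow> \<T> (unit_series w) w' = 0"
proof (induction w arbitrary: w')
  case (Cons i w)
  have "(unit_series [i] + v i) [] = 0"
    using v lie_polynomials_Nil by (auto simp: lie_step_def unit_series_apply)
  then show ?case unfolding translation_unit_Cons
    using Cons by (intro tensor_prod_low[of 1 _ "length w"]) auto
qed simp

lemma translation_unit_high: "N * length w < length w' \<Longrightarrow> \<T> (unit_series w) w' = 0"
proof (induction w arbitrary: w')
  case Nil
  have "\<T> (unit_series []) = unit_series []" using tr by (simp add: is_geometric_translation_def)
  moreover have "unit_series [] w' = 0" using Nil by (auto simp: unit_series_apply)
  ultimately show ?case by metis
next
  case (Cons i w)
  have "unit_series [i] + v i \<in> lie_step N" by (rule lie_step_unit_add[OF v N])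
  then show ?case unfolding translation_unit_Cons
    using Cons by (intro tensor_prod_high[of N _ "N * length w"]) (auto simp: lie_step_def)
qed

lemma translation_apply:
  assumes "length w \<le> n"
  shows "\<T> x w = (\<Sum>w'\<in>words_upto n. x w' * \<T> (unit_series w') w)"
proof (rule continuous_linear_series_eq)
  show "\<T> (unit_series b) w = 0" if "n < length b" for b
    using translation_unit_low assms that by auto
qed (use tr in \<open>auto simp: is_geometric_translation_def finite_words_upto\<close>)

text \<open>Exchanging the two finite sums moves the translation from the path to the
  fields.\<close>

lemma geometric_expansion_translation:
  "geometric_expansion \<alpha> f (\<T> x) y =
    (\<Sum>w\<in>words_upto (level \<alpha>). x w *\<^sub>R word_series_field f (level \<alpha>) (\<T> (unit_series w)) y)"
proof -
  let ?W = "words_upto (level \<alpha>)"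
  have "geometric_expansion \<alpha> f (\<T> x) y =
      (\<Sum>w\<in>?W. \<Sum>w'\<in>?W. (x w' * \<T> (unit_series w') w) *\<^sub>R word_field f w y)"
    unfolding geometric_expansion_def
    by (rule sum.cong[OF refl]) (auto simp: translation_apply[of _ "level \<alpha>"] scaleR_sum_left)
  also have "\<dots> = (\<Sum>w'\<in>?W. \<Sum>w\<in>?W. (x w' * \<T> (unit_series w') w) *\<^sub>R word_field f w y)"
    by (rule sum.swap)
  finally show ?thesis by (simp add: word_series_field_def scaleR_sum_right)
qed

lemma word_field_translation:
  fixes f :: "'l \<Rightarrow> 'e \<Rightarrow> 'e::euclidean_space"
  assumes f: "\<And>i. C_class r (f i)" and "N * length w \<le> Suc r"
  shows "word_field (\<lambda>i. lie_field f N (unit_series [i] + v i)) w =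
    word_series_field f (N * length w) (\<T> (unit_series w))"
  using assms(2)
proof (induction w)
  case Nil
  have "\<T> (unit_series []) = unit_series []" using tr by (simp add: is_geometric_translation_def)
  moreover have "unit_series [] [] = (1 :: real)" by (simp add: unit_series_apply)
  ultimately have "\<T> (unit_series []) [] = 1" by metis
  then show ?case by (simp add: word_series_field_def)
next
  case (Cons i w)
  let ?fv = "\<lambda>i. lie_field f N (unit_series [i] + v i)"
  let ?n = "N * length w"
  have N': "N \<le> Suc r" "?n + N \<le> Suc r" using Cons.prems by auto
  have step: "unit_series [i] + v i \<in> lie_step N" by (rule lie_step_unit_add[OF v N])
  note graph = lie_field_graph_word_op[OF lie_field_graph_lie_field[OF step N f N'(1)] f N'(1)]
  have G: "word_field ?fv w = (\<lambda>y. \<Sum>b\<in>words_upto ?n. \<T> (unit_series w) b *\<^sub>R word_field f b y)"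
    using Cons.IH N'(2) unfolding word_series_field_def by linarith
  \<comment> \<open>Words of length up to \<open>?n\<close> leave \<open>N\<close> derivatives, just
    what the field of a Lie polynomial of degree \<open>N\<close> needs in order to act through
    words.\<close>
  have wf: "C_class N (word_field f b)" if "b \<in> words_upto ?n" for b
    by (rule C_class_word_field[OF f]) (use that N' in auto)
  then have "C_class N (word_field ?fv w)"
    unfolding G by (intro C_class_sum C_class_scaleR) auto
  then have "word_field ?fv (i # w) y =
      (\<Sum>a\<in>words_upto N. (unit_series [i] + v i) a *\<^sub>R word_op f a (word_field ?fv w) y)" for y
    using graph by simp
  moreover have "word_op f a (word_field ?fv w) =
      (\<lambda>y. \<Sum>b\<in>words_upto ?n. \<T> (unit_series w) b *\<^sub>R word_field f (a @ b) y)" if "a \<in> words_upto N" for a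
  proof -
    have "word_op f a (word_field ?fv w) =
        (\<lambda>y. \<Sum>b\<in>words_upto ?n. \<T> (unit_series w) b *\<^sub>R word_op f a (word_field f b) y)"
      unfolding G using that N' by (intro word_op_sum[OF f] C_class_mono[OF wf]) auto
    then show ?thesis by (simp add: word_field_eq word_op_append)
  qed
  ultimately have "word_field ?fv (i # w) y = (\<Sum>a\<in>words_upto N. \<Sum>b\<in>words_upto ?n.
      ((unit_series [i] + v i) a * \<T> (unit_series w) b) *\<^sub>R word_field f (a @ b) y)" for y
    by (simp add: scaleR_sum_right)
  also have "\<dots> y = (\<Sum>u\<in>words_upto (N * length (i # w)). 
      tensor_prod (unit_series [i] + v i) (\<T> (unit_series w)) u *\<^sub>R word_field f u y)" for y
    by (rule sum_tensor_prod[symmetric]) (use step translation_unit_high in \<open>auto simp: lie_step_def\<close>)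
  finally show ?case unfolding translation_unit_Cons word_series_field_def by blast
qed

end


section \<open>Solution flows driven by translated weakly geometric rough paths\<close>

lemma tensor_prod_Nil: "tensor_prod x y [] = x [] * y []"
  and tensor_prod_singleton: "tensor_prod x y [i] = x [] * y [i] + x [i] * y []"
  by (simp_all add: tensor_prod_def)

context
  fixes T \<alpha> :: real and X :: "real \<Rightarrow> real \<Rightarrow> 'l tensor_series"
  assumes X: "weakly_geometric_rough_path T \<alpha> X"
begin

lemma rough_path_Nil_mult:
  assumes "s \<in> {0..T}" "t \<in> {0..T}"
  shows "X s t w = X s t [] * X s t w"
proof -
  have "sum_mset (image_mset (X s t) (shuffle_words [] w)) = X s t [] * X s t w"
    using X assms unfolding weakly_geometric_rough_path_def by blast
  then show ?thesis by simp
qed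

lemma rough_path_chen:
  assumes "s \<in> {0..T}" "u \<in> {0..T}" "t \<in> {0..T}"
  shows "X s t = tensor_prod (X s u) (X u t)"
  using X assms unfolding weakly_geometric_rough_path_def by blast

text \<open>The Hoelder bounds say nothing about equal times, but Chen's relation does: by induction
  all proper splittings of \<open>w\<close> contribute zero, and the two trivial ones give
  \<open>X s s w = X s s w + X s s w\<close>.\<close>

lemma rough_path_diagonal:
  assumes s: "s \<in> {0..T}" and "w \<noteq> []"
  shows "X s s w = 0"
  using assms(2)
proof (induction "length w" arbitrary: w rule: less_induct)
  case less
  have "X s s w = (\<Sum>k\<le>length w. X s s (take k w) * X s s (drop k w))"
    using fun_cong[OF rough_path_chen[OF s s s], of w] by (simp add: tensor_prod_def)
  also have "\<dots> = (\<Sum>k\<in>{0, length w}. X s s (take k w) * X s s (drop k w))"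
  proof (rule sum.mono_neutral_right, simp, simp, rule ballI)
    fix k assume "k \<in> {..length w} - {0, length w}"
    then have "X s s (take k w) = 0" by (intro less) auto
    then show "X s s (take k w) * X s s (drop k w) = 0" by simp
  qed
  also have "\<dots> = X s s w + X s s w"
    using less rough_path_Nil_mult[OF s s, of w] by (simp add: mult.commute)
  finally show ?case by simp
qed

lemma rough_path_increment:
  assumes "s \<in> {0..T}" "t \<in> {0..T}"
  shows "X 0 t [i] - X 0 s [i] = X s t [i]"
proof -
  have 0: "0 \<in> {0..T}" using assms by auto
  note chen = fun_cong[OF rough_path_chen]
  show ?thesis
  proof (rule chen_increment[where S = "{0..T}" and n = "\<lambda>a b. X a b []", OF _ _ _ 0 assms])
    fix a b c assume S: "a \<in> {0..T}" "b \<in> {0..T}" "c \<in> {0..T}"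
    show "X a b [] = X a c [] * X c b []" "X a b [i] = X a c [] * X c b [i] + X a c [i] * X c b []"
      using chen[OF S(1,3,2)] by (simp_all add: tensor_prod_Nil tensor_prod_singleton)
  qed (use rough_path_Nil_mult in blast)
qed

lemma rough_path_long_words:
  assumes "0 < \<alpha>" "level \<alpha> < length w"
  shows "higher_order T (\<lambda>s t. X s t w)"
proof (rule higher_order_long[OF assms])
  show "\<exists>C. \<forall>s\<in>{0..T}. \<forall>t\<in>{0..T}. s \<noteq> t \<longrightarrow> \<bar>X s t w\<bar> / \<bar>t - s\<bar> powr (\<alpha> * real (length w)) \<le> C"
    using X unfolding weakly_geometric_rough_path_def by blast
  show "X s s w = 0" if "0 \<le> s" "s \<le> T" for s
    using rough_path_diagonal[of s w] that assms(2) by (cases "w = []") auto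
qed

end

context
  fixes T \<alpha> :: real and N and X :: "real \<Rightarrow> real \<Rightarrow> 'l::{finite, zero} tensor_series"
    and v :: "'l \<Rightarrow> 'l tensor_series" and \<T> and f fv :: "'l \<Rightarrow> 'e \<Rightarrow> 'e::euclidean_space"
    and Y :: "real \<Rightarrow> real \<Rightarrow> 'e \<Rightarrow> 'e"
  assumes \<alpha>: "0 < \<alpha>" "\<alpha> \<le> 1" and N: "1 \<le> N"
    and X: "weakly_geometric_rough_path T \<alpha> X"
    and v: "\<And>i. v i \<in> lie_step N" and tr: "is_geometric_translation v \<T>"
    and fv: "\<And>i. fv i = lie_field f N (unit_series [i] + v i)"
begin

lemma translated_field_eq: "fv = (\<lambda>i. lie_field f N (unit_series [i] + v i))"
  using fv by (rule ext)

lemma continuous_word_series_field: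
  assumes "\<And>i. C_class r (f i)" "n \<le> Suc r"
  shows "continuous_on UNIV (word_series_field f n u)"
  unfolding word_series_field_def
  using C_class_word_field[of r f 0, OF assms(1)] assms(2)
  by (intro continuous_intros) auto

text \<open>\<open>h w\<close> is the field expected for \<open>w\<close>. Words longer than
  \<open>level \<alpha>\<close> are compared with the zero field, so their coefficients have to be
  negligible.\<close>

lemma geometric_translation_expansion:
  assumes "level \<alpha> \<le> level \<beta>"
    and "\<And>w. length w \<le> level \<beta> \<Longrightarrow>
      length w \<le> level \<alpha> \<and> word_series_field f (level \<beta>) (\<T> (unit_series w)) = h w \<or>
      higher_order T (\<lambda>s t. X s t w) \<and>
        continuous_on UNIV (word_series_field f (level \<beta>) (\<T> (unit_series w))) \<and>
        (length w \<le> level \<alpha> \<longrightarrow> continuous_on UNIV (h w))"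
  shows "has_local_expansion T (\<lambda>s t. geometric_expansion \<beta> f (\<T> (X s t)))
    (\<lambda>s t y. \<Sum>w\<in>words_upto (level \<alpha>). X s t w *\<^sub>R h w y)"
proof -
  let ?M = "level \<beta>" and ?L = "level \<alpha>"
  \<comment> \<open>The shorter sum is padded with zero fields so that both sums run over the same
    words.\<close>
  have "(\<Sum>w\<in>words_upto ?L. X s t w *\<^sub>R h w y) =
      (\<Sum>w\<in>words_upto ?M. X s t w *\<^sub>R (if length w \<le> ?L then h w y else 0))" for s t y
    by (rule sum.mono_neutral_cong_left) (use assms(1) in \<open>auto simp: finite_words_upto\<close>)
  moreover have "has_local_expansion T
      (\<lambda>s t y. \<Sum>w\<in>words_upto ?M. X s t w *\<^sub>R word_series_field f ?M (\<T> (unit_series w)) y)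
      (\<lambda>s t y. \<Sum>w\<in>words_upto ?M. X s t w *\<^sub>R (if length w \<le> ?L then h w y else 0))"
    by (rule has_local_expansion_sum_agree) (use assms(2) in force)
  moreover have "(\<lambda>s t. geometric_expansion \<beta> f (\<T> (X s t))) =
      (\<lambda>s t y. \<Sum>w\<in>words_upto ?M. X s t w *\<^sub>R word_series_field f ?M (\<T> (unit_series w)) y)"
    by (rule ext)+ (rule geometric_expansion_translation[OF tr v N])
  ultimately show ?thesis by simp
qed

text \<open>Forming \<open>fv\<close> takes up to \<open>N - 1\<close> derivatives of
  \<open>f\<close>, and the Euler expansion takes up to \<open>level \<alpha> - 1\<close>
  derivatives of \<open>fv\<close>; the assumed class is the sum of the two.\<close>

lemma continuous_word_field_translated:
  assumes "\<And>i. C_class (level \<alpha> - 1 + (N - 1)) (f i)" "length w \<le> level \<alpha>"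
  shows "continuous_on UNIV (word_field fv w)"
proof -
  have "C_class (level \<alpha> - 1) (fv i)" for i
  proof -
    have N': "N \<le> Suc (level \<alpha> - 1 + (N - 1))" using N by simp
    have step: "unit_series [i] + v i \<in> lie_step N" by (rule lie_step_unit_add[OF v N])
    have "C_class (Suc (level \<alpha> - 1 + (N - 1)) - N) (fv i)"
      unfolding fv
      using lie_field_graph_word_op[where f=f, OF lie_field_graph_lie_field[where f=f, OF step N assms(1) N'] assms(1) N'] by blast
    then show ?thesis using N by simp
  qed
  from C_class_word_field[of _ fv 0, OF this] show ?thesis using assms(2) nat_floor_inverse_pos[OF \<alpha>] by auto
qed

lemma geometric_translation_i:
  assumes f: "\<And>i. C_class (nat \<lfloor>real N / \<alpha>\<rfloor> - 1) (f i)"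
  shows "geometric_solution_flow T (\<alpha> / real N) f (\<lambda>s t. \<T> (X s t)) Y \<longleftrightarrow>
    geometric_solution_flow T \<alpha> fv X Y"
proof -
  let ?M = "nat \<lfloor>real N / \<alpha>\<rfloor>" and ?L = "level \<alpha>"
  have M: "nat \<lfloor>1 / (\<alpha> / real N)\<rfloor> = ?M" using N by simp
  have NL: "N * ?L \<le> ?M" using mult_nat_floor_le \<alpha> by blast
  have L: "1 \<le> ?L" "?L \<le> N * ?L" using nat_floor_inverse_pos[OF \<alpha>] N by auto
  have "has_local_expansion T (\<lambda>s t. geometric_expansion (\<alpha> / real N) f (\<T> (X s t)))
    (\<lambda>s t y. \<Sum>w\<in>words_upto ?L. X s t w *\<^sub>R word_field fv w y)"
  proof (rule geometric_translation_expansion, unfold M)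
    show "?L \<le> ?M" using NL L by linarith
    fix w :: "'l list"
    assume "length w \<le> ?M"
    show "length w \<le> ?L \<and> word_series_field f ?M (\<T> (unit_series w)) = word_field fv w \<or>
      higher_order T (\<lambda>s t. X s t w) \<and> continuous_on UNIV (word_series_field f ?M (\<T> (unit_series w))) \<and>
      (length w \<le> ?L \<longrightarrow> continuous_on UNIV (word_field fv w))"
    proof (cases "length w \<le> ?L")
      case True
      then have "N * length w \<le> N * ?L" by (rule mult_le_mono2)
      then have le: "N * length w \<le> ?M" "N * length w \<le> Suc (?M - 1)" using NL by linarith+
      have "word_field fv w = word_series_field f (N * length w) (\<T> (unit_series w))"
        unfolding translated_field_eq by (rule word_field_translation[OF tr v N f le(2)])
      also have "\<dots> = word_series_field f ?M (\<T> (unit_series w))"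
        using translation_unit_high[OF tr v N] le(1) by (rule word_series_field_extend)
      finally show ?thesis using True by simp
    next
      case False
      then show ?thesis
        using rough_path_long_words[OF X \<alpha>(1), of w] continuous_word_series_field[OF f] by auto
    qed
  qed
  then have "has_local_expansion T (\<lambda>s t. geometric_expansion (\<alpha> / real N) f (\<T> (X s t)))
    (\<lambda>s t. geometric_expansion \<alpha> fv (X s t))"
    by (simp add: geometric_expansion_def[abs_def])
  then show ?thesis
    by (simp add: geometric_solution_flow_def has_local_expansion_cong_right)
qed

section \<open>Translation of the zeroth letter only, geometric case\<close>

context
  assumes f: "\<And>i. C_class (level \<alpha> + N - 2) (f i)"
    and v0: "\<And>i. i \<noteq> 0 \<Longrightarrow> v i = 0"
    and reg: "zeroth_regular length (\<lambda>w. count_list w 0) T \<alpha> X"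
begin

lemma C_class_fields: "C_class (level \<alpha> - 1 + (N - 1)) (f i)"
proof -
  have "level \<alpha> - 1 + (N - 1) = level \<alpha> + N - 2" using nat_floor_inverse_pos[OF \<alpha>] N by linarith
  then show ?thesis using f by simp
qed

lemma step_le_regularity: "N \<le> Suc (level \<alpha> - 1 + (N - 1))" using N by simp

lemma lie_field_eq:
  assumes "u \<in> lie_step N"
  shows "lie_field f N u = word_series_field f N u"
  by (rule lie_field_graph_unique[OF lie_field_graph_lie_field[OF assms N C_class_fields step_le_regularity] C_class_fields step_le_regularity])

lemma lie_field_nonzero:
  assumes "i \<noteq> 0"
  shows "fv i = f i"
proof
  fix y
  have "fv i y = word_series_field f N (unit_series [i]) y"
    using lie_field_eq[OF lie_step_unit_add[OF v[of i] N], of i] v0[OF assms] by (simp only: fv add_0_right)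
  also have "\<dots> = (\<Sum>w\<in>words_upto N. if w = [i] then word_field f [i] y else 0)"
    unfolding word_series_field_def by (rule sum.cong) (auto simp: unit_series_apply)
  finally show "fv i y = f i y" using N by (simp add: finite_words_upto vf_prelie_eq dir_deriv_id)
qed

lemma word_field_no_zero: "0 \<notin> set w \<Longrightarrow> word_field fv w = word_field f w"
proof (induction w)
  case (Cons i w)
  then have "fv i = f i" "word_field fv w = word_field f w" by (auto intro!: lie_field_nonzero)
  then show ?case by (simp only: word_field.simps)
qed simp

lemma translation_no_zero: "0 \<notin> set w \<Longrightarrow> \<T> (unit_series w) = unit_series w"
proof (induction w)
  case (Cons i w)
  then have "\<T> (unit_series (i # w)) = tensor_prod (unit_series [i]) (unit_series w)"
    using v0[of i] by (simp only: translation_unit_Cons[OF tr v N]) auto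
  then show ?case by (simp only: tensor_prod_unit_Cons)
qed (use tr in \<open>simp only: is_geometric_translation_def\<close>)

lemma singular_words:
  assumes "length w \<le> level \<alpha>" "0 \<in> set w" "w \<noteq> [0]"
  shows "higher_order T (\<lambda>s t. X s t w)"
proof (rule higher_order_zeroth[OF \<alpha> reg assms(1)])
  show "2 \<le> length w" using assms(2,3) by (cases w; cases "tl w") auto
  show "1 \<le> count_list w 0" using assms(2) count_list_0_iff[of w 0] by linarith
  show "X s s w = 0" if "0 \<le> s" "s \<le> T" for s
    using rough_path_diagonal[OF X, of s w] that assms(2) by (cases "w = []") auto
qed

lemma word_series_field_unit:
  assumes "length w \<le> n"
  shows "word_series_field f n (unit_series w) = word_field f w"
proof
  fix y
  have "word_series_field f n (unit_series w) y = (\<Sum>u\<in>words_upto n. if u = w then word_field f w y else 0)"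
    unfolding word_series_field_def by (rule sum.cong) (auto simp: unit_series_apply)
  then show "word_series_field f n (unit_series w) y = word_field f w y"
    using assms by (simp add: finite_words_upto)
qed

lemma word_series_field_add:
  "word_series_field f n (u + w) = (\<lambda>y. word_series_field f n u y + word_series_field f n w y)"
  by (simp add: word_series_field_def scaleR_add_left sum.distrib)

lemma word_field_single: "word_field g [i] = g i"
  by (simp add: vf_prelie_eq dir_deriv_id fun_eq_iff)

lemma geometric_translation_ii:
  "geometric_solution_flow T (min \<alpha> (1 / real N)) f (\<lambda>s t. \<T> (X s t)) Y \<longleftrightarrow>
    geometric_solution_flow T \<alpha> fv X Y"
proof -
  let ?L = "level \<alpha>"
  define M where "M = max ?L N"
  have M: "nat \<lfloor>1 / min \<alpha> (1 / real N)\<rfloor> = M" unfolding M_def by (rule nat_floor_inverse_min[OF \<alpha>(1) N])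
  have M': "?L \<le> M" "N \<le> M" "M \<le> Suc (?L - 1 + (N - 1))" using nat_floor_inverse_pos[OF \<alpha>] N by (auto simp: M_def)
  have "has_local_expansion T (\<lambda>s t. geometric_expansion (min \<alpha> (1 / real N)) f (\<T> (X s t)))
    (\<lambda>s t y. \<Sum>w\<in>words_upto ?L. X s t w *\<^sub>R word_field fv w y)"
  proof (rule geometric_translation_expansion, unfold M)
    show "?L \<le> M" by fact
    fix w :: "'l list"
    assume "length w \<le> M"
    have cont: "continuous_on UNIV (word_series_field f M (\<T> (unit_series w)))"
      by (rule continuous_word_series_field[OF C_class_fields M'(3)])
    \<comment> \<open>In the last case \<open>\<T>\<close> may send \<open>w\<close> to degrees
      above \<open>M\<close>, so the two fields can differ; there the order of the coefficient
      decides.\<close>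
    consider "length w > ?L" | "length w \<le> ?L" "0 \<notin> set w" | "w = [0]" |
      "length w \<le> ?L" "0 \<in> set w" "w \<noteq> [0]" by linarith
    then show "length w \<le> ?L \<and> word_series_field f M (\<T> (unit_series w)) = word_field fv w \<or>
      higher_order T (\<lambda>s t. X s t w) \<and> continuous_on UNIV (word_series_field f M (\<T> (unit_series w))) \<and>
      (length w \<le> ?L \<longrightarrow> continuous_on UNIV (word_field fv w))"
    proof cases
      case 1
      then show ?thesis using rough_path_long_words[OF X \<alpha>(1)] cont by auto
    next
      case 2
      then show ?thesis
        using word_series_field_unit[of w M] M' translation_no_zero[OF 2(2)] word_field_no_zero[OF 2(2)]
        by (metis le_trans)
    next
      case 3
      have step: "unit_series [0] + v 0 \<in> lie_step N" by (rule lie_step_unit_add[OF v N])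
      have "word_field fv w = word_series_field f N (unit_series [0] + v 0)"
        unfolding 3 word_field_single fv by (rule lie_field_eq[OF step])
      also have "\<dots> = word_series_field f M (unit_series [0] + v 0)"
        using step M'(2) by (intro word_series_field_extend) (auto simp: lie_step_def)
      also have "unit_series [0] + v 0 = \<T> (unit_series w)"
        using tr unfolding 3 is_geometric_translation_def by metis
      finally have "word_field fv w = word_series_field f M (\<T> (unit_series w))" .
      moreover have "length w \<le> ?L" using 3 nat_floor_inverse_pos[OF \<alpha>] by simp
      ultimately show ?thesis by metis
    next
      case 4
      then show ?thesis
        using singular_words[OF 4] cont continuous_word_field_translated[OF C_class_fields 4(1)] by auto
    qed
  qed
  then have "has_local_expansion T (\<lambda>s t. geometric_expansion (min \<alpha> (1 / real N)) f (\<T> (X s t)))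
    (\<lambda>s t. geometric_expansion \<alpha> fv (X s t))"
    by (simp add: geometric_expansion_def[abs_def])
  then show ?thesis
    by (simp add: geometric_solution_flow_def has_local_expansion_cong_right)
qed

lemma geometric_translation_drift:
  "geometric_solution_flow T \<alpha> fv X Y \<longleftrightarrow>
    geometric_drift_solution_flow T \<alpha> f X (lie_field f N (v 0)) (\<lambda>t. X 0 t [0]) Y"
proof -
  let ?L = "level \<alpha>"
  let ?g = "lie_field f N (v 0)"
  \<comment> \<open>The drift is booked on the single word \<open>[0]\<close>, whose coefficient is
    the increment of the zeroth component. There the field of \<open>fv\<close> is exactly
    \<open>f 0\<close> plus the field of \<open>v 0\<close>.\<close>
  let ?h = "\<lambda>w y. word_field f w y + (if w = [0] then ?g y else 0)"
  have g: "?g = word_series_field f N (v 0)" by (rule lie_field_eq[OF v])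
  have r: "N \<le> Suc (?L - 1 + (N - 1))" "?L \<le> Suc (?L - 1 + (N - 1))" using nat_floor_inverse_pos[OF \<alpha>] N by auto
  have "has_local_expansion T (\<lambda>s t y. \<Sum>w\<in>words_upto ?L. X s t w *\<^sub>R word_field fv w y)
    (\<lambda>s t y. \<Sum>w\<in>words_upto ?L. X s t w *\<^sub>R ?h w y)"
  proof (rule has_local_expansion_sum_agree)
    fix w :: "'l list" assume w: "w \<in> words_upto ?L"
    consider "0 \<notin> set w" | "w = [0]" | "0 \<in> set w" "w \<noteq> [0]" by linarith
    then show "(\<forall>y. word_field fv w y = ?h w y) \<or>
      higher_order T (\<lambda>s t. X s t w) \<and> continuous_on UNIV (word_field fv w) \<and> continuous_on UNIV (?h w)"
    proof cases
      case 1
      then show ?thesis using word_field_no_zero[OF 1] by auto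
    next
      case 2
      have "word_field fv w = word_series_field f N (unit_series [0] + v 0)"
        unfolding 2 word_field_single fv by (rule lie_field_eq[OF lie_step_unit_add[OF v N]])
      also have "\<dots> = ?h w"
        using 2 N word_series_field_unit[of "[0]" N]
        by (simp only: word_series_field_add g) (simp add: fun_eq_iff)
      finally show ?thesis by metis
    next
      case 3
      have "continuous_on UNIV (word_field f w)"
        using C_class_word_field[of _ f 0 w, OF C_class_fields] w r by auto
      then have "continuous_on UNIV (?h w)" using 3 by simp
      then show ?thesis
        using singular_words[of w] continuous_word_field_translated[OF C_class_fields, of w] w 3 by auto
    qed
  qed
  moreover have "(\<Sum>w\<in>words_upto ?L. X s t w *\<^sub>R ?h w y) =
      geometric_expansion \<alpha> f (X s t) y + (X 0 t [0] - X 0 s [0]) *\<^sub>R ?g y"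
    if "0 \<le> s" "s \<le> t" "t \<le> T" for s t y
  proof -
    have "(\<Sum>w\<in>words_upto ?L. X s t w *\<^sub>R ?h w y) = geometric_expansion \<alpha> f (X s t) y +
        (\<Sum>w\<in>words_upto ?L. if w = [0 :: 'l] then X s t [0] *\<^sub>R ?g y else 0)"
      unfolding geometric_expansion_def sum.distrib[symmetric]
      by (intro sum.cong refl) (auto simp: scaleR_add_right)
    then show ?thesis
      using nat_floor_inverse_pos[OF \<alpha>] rough_path_increment[OF X, of s t 0] that by (simp add: finite_words_upto)
  qed
  ultimately have "has_local_expansion T (\<lambda>s t. geometric_expansion \<alpha> fv (X s t))
    (\<lambda>s t y. geometric_expansion \<alpha> f (X s t) y + (X 0 t [0] - X 0 s [0]) *\<^sub>R ?g y)"
    unfolding geometric_expansion_def[of \<alpha> fv, abs_def]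
    by (subst (asm) has_local_expansion_cong)
  then show ?thesis
    unfolding geometric_solution_flow_def geometric_drift_solution_flow_def
    by (simp add: has_local_expansion_cong_right)
qed

end

end

section \<open>The Connes--Kreimer coproduct\<close>

text \<open>The linear extension of \<open>\<phi>\<close> to the monoid algebra. Evaluating
  coproducts through it turns their recursion into rules for \<open>star_prod\<close>, without any
  account of cancelling coefficients.\<close>

definition pm_eval :: "('k \<Rightarrow> real) \<Rightarrow> ('k \<Rightarrow>\<^sub>0 real) \<Rightarrow> real" where
  "pm_eval \<phi> p = (\<Sum>k\<in>Poly_Mapping.keys p. Poly_Mapping.lookup p k * \<phi> k)"

lemma pm_eval_superset:
  assumes "finite A" "Poly_Mapping.keys p \<subseteq> A"
  shows "pm_eval \<phi> p = (\<Sum>k\<in>A. Poly_Mapping.lookup p k * \<phi> k)"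
  unfolding pm_eval_def
  by (rule sum.mono_neutral_left) (use assms in \<open>auto simp: in_keys_iff\<close>)

lemma pm_eval_add: "pm_eval \<phi> (p + q) = pm_eval \<phi> p + pm_eval \<phi> q"
proof -
  let ?A = "Poly_Mapping.keys p \<union> Poly_Mapping.keys q"
  have "Poly_Mapping.keys (p + q) \<subseteq> ?A" by (rule Poly_Mapping.keys_add)
  then show ?thesis
    by (simp add: pm_eval_superset[of ?A] lookup_add distrib_right sum.distrib)
qed

lemma pm_eval_zero: "pm_eval \<phi> 0 = 0"
  by (simp add: pm_eval_def)

lemma pm_eval_sum: "pm_eval \<phi> (\<Sum>i\<in>I. p i) = (\<Sum>i\<in>I. pm_eval \<phi> (p i))"
  by (induction I rule: infinite_finite_induct) (auto simp: pm_eval_add pm_eval_zero)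

lemma pm_eval_single: "pm_eval \<phi> (Poly_Mapping.single k c) = c * \<phi> k"
  by (simp add: pm_eval_def)

lemma poly_mapping_sum_singles:
  fixes p :: "'k \<Rightarrow>\<^sub>0 real"
  shows "(\<Sum>k\<in>Poly_Mapping.keys p. Poly_Mapping.single k (Poly_Mapping.lookup p k)) = p"
  by (rule poly_mapping_eqI) (simp add: lookup_sum lookup_single when_def in_keys_iff)

lemma pm_eval_mult: "pm_eval \<phi> (p * q) = pm_eval (\<lambda>k. pm_eval (\<lambda>l. \<phi> (k + l)) q) p"
proof -
  have "p * q = (\<Sum>k\<in>Poly_Mapping.keys p. \<Sum>l\<in>Poly_Mapping.keys q.
      Poly_Mapping.single (k + l) (Poly_Mapping.lookup p k * Poly_Mapping.lookup q l))"
    by (subst poly_mapping_sum_singles[of p, symmetric], subst poly_mapping_sum_singles[of q, symmetric])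
      (simp add: sum_product mult_single)
  then show ?thesis
    by (simp add: pm_eval_sum pm_eval_single pm_eval_def[of _ p] pm_eval_def[of _ q] sum_distrib_left mult.assoc)
qed

lemma pm_eval_fun_add: "pm_eval (\<lambda>k. \<phi> k + \<psi> k) p = pm_eval \<phi> p + pm_eval \<psi> p"
  by (simp add: pm_eval_def distrib_left sum.distrib)

lemma pm_eval_fun_scale: "pm_eval (\<lambda>k. c * \<phi> k) p = c * pm_eval \<phi> p"
  by (simp add: pm_eval_def sum_distrib_left mult.left_commute)

lemma star_prod_eq: "star_prod x y F = pm_eval (\<lambda>(a, b). x a * y b) (forest_coproduct F)"
  by (simp add: star_prod_def pm_eval_def case_prod_unfold)

lemma star_prod_empty: "star_prod x y {#} = x {#} * y {#}"
  by (simp add: star_prod_eq forest_coproduct_def pm_eval_single zero_prod_def flip: single_one)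

lemma pm_eval_graft_right:
  "pm_eval \<phi> (graft_right i p) = pm_eval (\<lambda>(a, b). \<phi> (a, {#Node i b#})) p"
  by (simp add: graft_right_def pm_eval_sum pm_eval_single pm_eval_def[of _ p] case_prod_unfold)

text \<open>The recursion of the coproduct at a root, read dually: either the whole tree goes to the
  left factor or its root stays in the right one.\<close>

lemma star_prod_tree:
  "star_prod x y {#Node i F#} = x {#Node i F#} * y {#} + star_prod x (\<lambda>G. y {#Node i G#}) F"
  by (simp add: star_prod_eq forest_coproduct_def pm_eval_add pm_eval_single pm_eval_graft_right
      case_prod_unfold)

text \<open>Multiplicativity of the coproduct, read dually: \<open>t\<close> is split first, then
  the rest of the forest.\<close>

lemma star_prod_add_mset:
  "star_prod x y (add_mset t F) =
    pm_eval (\<lambda>(a, b). star_prod (\<lambda>A. x (a + A)) (\<lambda>B. y (b + B)) F) (tree_coproduct t)"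
  by (simp add: star_prod_eq forest_coproduct_def pm_eval_mult case_prod_unfold)

lemma star_prod_singleton: "star_prod x y {#t#} = pm_eval (\<lambda>(a, b). x a * y b) (tree_coproduct t)"
  by (simp add: star_prod_eq forest_coproduct_def)

lemma star_prod_scale_left: "star_prod (\<lambda>A. c * x A) y F = c * star_prod x y F"
  by (simp add: star_prod_eq case_prod_unfold mult.assoc pm_eval_fun_scale)

lemma star_prod_add_left: "star_prod (\<lambda>A. x A + x' A) y F = star_prod x y F + star_prod x' y F"
  by (simp add: star_prod_eq case_prod_unfold distrib_right pm_eval_fun_add)

lemma forest_nodes_simps [simp]:
  "forest_nodes {#} = 0" "forest_nodes (add_mset t F) = tree_nodes t + forest_nodes F"
  "forest_nodes (F + G) = forest_nodes F + forest_nodes G"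
  by (auto simp: forest_nodes_def)

lemma tree_nodes_Node [simp]: "tree_nodes (Node i F) = Suc (forest_nodes F)"
  by (simp add: forest_nodes_def)

declare tree_nodes.simps [simp del]

lemma tree_nodes_pos: "0 < tree_nodes t"
  by (cases t) simp

text \<open>The induction splits off a tree and then its root, where the summand
  \<open>x {#t#}\<close> vanishes. Characters rather than the unit alone are treated because the
  values of a path at equal times need the same argument.\<close>

lemma star_prod_character_trivial:
  assumes "x {#} = 1" "\<And>A B. x (A + B) = x A * x B"
    and "\<And>t. tree_nodes t \<le> n \<Longrightarrow> x {#t#} = 0" and "forest_nodes F \<le> n"
  shows "star_prod x z F = z F"
  using assms(4)
proof (induction "forest_nodes F" arbitrary: F z rule: less_induct)
  case less
  show ?case
  proof (cases F)
    case empty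
    then show ?thesis by (simp add: star_prod_empty assms(1))
  next
    case (add t G)
    obtain i H where t: "t = Node i H" by (cases t)
    have G: "star_prod x z' G = z' G" for z'
      by (rule less(1)) (use less(2) add tree_nodes_pos[of t] in auto)
    have H: "star_prod x z' H = z' H" for z'
      by (rule less(1)) (use less(2) add t in auto)
    have "star_prod x z F = pm_eval (\<lambda>(a, b). x a * z (b + G)) (tree_coproduct t)"
      unfolding add star_prod_add_mset assms(2) by (simp add: star_prod_scale_left G)
    also have "\<dots> = star_prod x (\<lambda>b. z (b + G)) {#t#}"
      by (simp add: star_prod_singleton)
    also have "\<dots> = z F"
      using assms(3)[of t] less(2) by (simp add: t star_prod_tree H add)
    finally show ?thesis .
  qed
qed

lemma star_prod_unit_left: "star_prod (unit_series {#}) z F = z F"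
  by (rule star_prod_character_trivial[of _ "forest_nodes F"]) (auto simp: unit_series_apply)

lemma forest_of_tree_series_simps [simp]:
  "forest_of_tree_series p {#} = 0" "forest_of_tree_series p {#t#} = p t"
  by (auto simp: forest_of_tree_series_def)

lemma forest_of_tree_series_other: "size F \<noteq> 1 \<Longrightarrow> forest_of_tree_series p F = 0"
  by (auto simp: forest_of_tree_series_def)

text \<open>Leibniz rule with \<open>unit_series {#}\<close> as counit: tree series are the
  infinitesimal characters of the forest algebra. Hence left multiplication by one of them acts on a
  forest one tree at a time.\<close>

lemma forest_of_tree_series_add:
  "forest_of_tree_series p (A + B) =
    forest_of_tree_series p A * unit_series {#} B + unit_series {#} A * forest_of_tree_series p B"
proof (cases "A = {#} \<or> B = {#}")
  case False
  then have "size (A + B) \<noteq> 1" by (cases A; cases B) auto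
  then show ?thesis using False by (simp add: forest_of_tree_series_other unit_series_apply)
qed (auto simp: unit_series_apply)

lemma star_prod_tree_series_add_mset:
  "star_prod (forest_of_tree_series p) z (add_mset t F) =
    star_prod (forest_of_tree_series p) (\<lambda>B. z (add_mset t B)) F +
    star_prod (forest_of_tree_series p) (\<lambda>B. z (B + F)) {#t#}"
proof -
  let ?x = "forest_of_tree_series p"
  have "star_prod ?x z (add_mset t F) = pm_eval (\<lambda>(a, b). ?x a * z (b + F) +
      unit_series {#} a * star_prod ?x (\<lambda>B. z (b + B)) F) (tree_coproduct t)"
    unfolding star_prod_add_mset forest_of_tree_series_add
    by (simp add: star_prod_add_left star_prod_scale_left star_prod_unit_left)
  also have "\<dots> = star_prod ?x (\<lambda>B. z (B + F)) {#t#} +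
      star_prod (unit_series {#}) (\<lambda>b. star_prod ?x (\<lambda>B. z (b + B)) F) {#t#}"
    by (simp add: star_prod_singleton case_prod_unfold pm_eval_fun_add)
  finally show ?thesis by (simp add: star_prod_unit_left)
qed

lemma sum_mset_Union:
  fixes \<phi> :: "'a \<Rightarrow> 'b::comm_monoid_add"
  shows "sum_mset (image_mset \<phi> (sum_mset A)) = sum_mset (image_mset (\<lambda>M. sum_mset (image_mset \<phi> M)) A)"
  by (induction A) auto

section \<open>Edge cuts, the star product and the pre-Lie product\<close>

lemma edge_cuts_sum:
  fixes \<phi> :: "'l rtree \<times> 'l rtree \<Rightarrow> 'b::comm_monoid_add"
  shows "(\<Sum>c\<in>#edge_cuts (Node i F). \<phi> c) = (\<Sum>t\<in>#F. \<phi> (t, Node i (F - {#t#})) +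
      (\<Sum>c\<in>#edge_cuts t. \<phi> (fst c, Node i (add_mset (snd c) (F - {#t#})))))"
  by (simp add: sum_mset_Union image_mset.compositionality comp_def case_prod_unfold)

lemma edge_cuts_Node_iff:
  "c \<in># edge_cuts (Node i F) \<longleftrightarrow> (\<exists>t\<in>#F. c = (t, Node i (F - {#t#})) \<or>
     (\<exists>d\<in>#edge_cuts t. c = (fst d, Node i (add_mset (snd d) (F - {#t#})))))"
  by (auto simp: case_prod_unfold)

declare edge_cuts.simps [simp del]

lemma edge_cuts_nodes: "c \<in># edge_cuts t \<Longrightarrow> tree_nodes (fst c) + tree_nodes (snd c) = tree_nodes t"
proof (induction t arbitrary: c)
  case (Node i F)
  then obtain t where t: "t \<in># F" "c = (t, Node i (F - {#t#})) \<or>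
     (\<exists>d\<in>#edge_cuts t. c = (fst d, Node i (add_mset (snd d) (F - {#t#}))))"
    by (auto simp: edge_cuts_Node_iff)
  then obtain G where G: "F = add_mset t G" by (metis insert_DiffM)
  from t show ?case
    using Node.IH[OF t(1)] by (auto simp: G)
qed

lemma edge_cuts_labels: "c \<in># edge_cuts t \<Longrightarrow> set_rtree (fst c) \<union> set_rtree (snd c) = set_rtree t"
proof (induction t arbitrary: c)
  case (Node i F)
  then obtain t where t: "t \<in># F" "c = (t, Node i (F - {#t#})) \<or>
     (\<exists>d\<in>#edge_cuts t. c = (fst d, Node i (add_mset (snd d) (F - {#t#}))))"
    by (auto simp: edge_cuts_Node_iff)
  then obtain G where G: "F = add_mset t G" by (metis insert_DiffM)
  from t(2) show ?case
  proof
    assume "\<exists>d\<in>#edge_cuts t. c = (fst d, Node i (add_mset (snd d) (F - {#t#})))"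
    then obtain d where "d \<in># edge_cuts t" "c = (fst d, Node i (add_mset (snd d) G))"
      by (auto simp: G)
    moreover have "set_rtree (fst d) \<union> set_rtree (snd d) = set_rtree t"
      using Node.IH[OF t(1)] calculation(1) by blast
    ultimately show ?thesis by (auto simp: G)
  qed (auto simp: G)
qed

text \<open>The Grossman-Larson product in dual form: \<open>p\<close> takes away either a whole
  tree or a branch cut off at one edge. The Leibniz rule reduces a forest to its trees, and the
  clause for the root reduces a tree to the smaller forest of its branches.\<close>

lemma star_prod_tree_series:
  "star_prod (forest_of_tree_series p) z F = (\<Sum>t\<in>#F. p t * z (F - {#t#}) +
     (\<Sum>c\<in>#edge_cuts t. p (fst c) * z (add_mset (snd c) (F - {#t#}))))"
proof (induction "forest_nodes F" arbitrary: F z rule: less_induct)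
  case less
  have tree: "star_prod (forest_of_tree_series p) z' {#t#} = p t * z' {#} +
      (\<Sum>c\<in>#edge_cuts t. p (fst c) * z' {#snd c#})" if "tree_nodes t \<le> forest_nodes F" for t z'
  proof -
    obtain i H where t: "t = Node i H" by (cases t)
    have "star_prod (forest_of_tree_series p) (\<lambda>G. z' {#Node i G#}) H =
        (\<Sum>c\<in>#edge_cuts (Node i H). p (fst c) * z' {#snd c#})"
      unfolding edge_cuts_sum by (subst less) (use that t in auto)
    then show ?thesis by (simp add: t star_prod_tree)
  qed
  show ?case
  proof (cases F)
    case empty
    then show ?thesis by (simp add: star_prod_empty)
  next
    case (add t G)
    have "star_prod (forest_of_tree_series p) (\<lambda>B. z (add_mset t B)) G =
      (\<Sum>t'\<in>#G. p t' * z (add_mset t (G - {#t'#})) +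
        (\<Sum>c\<in>#edge_cuts t'. p (fst c) * z (add_mset t (add_mset (snd c) (G - {#t'#})))))"
      by (rule less) (use add tree_nodes_pos[of t] in auto)
    also have "\<dots> = (\<Sum>t'\<in>#G. p t' * z (F - {#t'#}) +
        (\<Sum>c\<in>#edge_cuts t'. p (fst c) * z (add_mset (snd c) (F - {#t'#}))))"
      by (intro arg_cong[where f = sum_mset] image_mset_cong)
        (auto simp: add add_mset_commute)
    finally show ?thesis
      by (simp add: add star_prod_tree_series_add_mset[of p z] tree algebra_simps)
  qed
qed

lemma sum_mset_count:
  fixes \<phi> :: "'a \<Rightarrow> 'b::real_vector"
  shows "(\<Sum>x\<in>#A. \<phi> x) = (\<Sum>x\<in>set_mset A. real (count A x) *\<^sub>R \<phi> x)"
proof (induction A)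
  case (add x A)
  have "(\<Sum>y\<in>set_mset (add_mset x A). real (count (add_mset x A) y) *\<^sub>R \<phi> y) =
      (\<Sum>y\<in>set_mset (add_mset x A). real (count A y) *\<^sub>R \<phi> y + (if y = x then \<phi> x else 0))"
    by (rule sum.cong) (auto simp: scaleR_add_left)
  also have "\<dots> = (\<Sum>y\<in>set_mset (add_mset x A). real (count A y) *\<^sub>R \<phi> y) + \<phi> x"
    by (simp add: sum.distrib)
  also have "(\<Sum>y\<in>set_mset (add_mset x A). real (count A y) *\<^sub>R \<phi> y) =
      (\<Sum>y\<in>set_mset A. real (count A y) *\<^sub>R \<phi> y)"
    by (rule sum.mono_neutral_right) (auto simp: count_eq_zero_iff)
  finally show ?case by (simp add: add.IH)
qed simp

lemma sum_mset_count_superset: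
  fixes \<phi> :: "'a \<Rightarrow> 'b::real_vector"
  assumes "finite K" "set_mset A \<subseteq> K"
  shows "(\<Sum>x\<in>#A. \<phi> x) = (\<Sum>x\<in>K. real (count A x) *\<^sub>R \<phi> x)"
  unfolding sum_mset_count
  by (rule sum.mono_neutral_left) (use assms in \<open>auto simp: count_eq_zero_iff\<close>)

lemma tree_prelie_eq: "tree_prelie x y t = (\<Sum>c\<in>#edge_cuts t. x (fst c) * y (snd c))"
  by (simp add: tree_prelie_def cut_number_def sum_mset_count case_prod_unfold)

text \<open>On single trees the star product differs from the pre-Lie product only by the term with
  the empty forest. This links the two morphism properties of a translation.\<close>

lemma star_prod_tree_series_singleton:
  "star_prod (forest_of_tree_series p) z {#t#} = p t * z {#} + tree_prelie p (\<lambda>t. z {#t#}) t"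
  by (simp add: star_prod_tree_series tree_prelie_eq)

section \<open>Generation of trees by grafting\<close>

abbreviation "trees_upto n \<equiv> {t. tree_nodes t \<le> n}"

lemma size_le_forest_nodes: "size F \<le> forest_nodes F"
proof (induction F)
  case (add t F)
  then show ?case using tree_nodes_pos[of t] by simp
qed simp

lemma tree_nodes_le_forest: "t \<in># F \<Longrightarrow> tree_nodes t \<le> forest_nodes F"
  by (metis forest_nodes_simps(2) insert_DiffM le_add1)

text \<open>Trees and forests have to be treated together: a tree with \<open>n + 1\<close> nodes is
  a root over a forest with \<open>n\<close> nodes.\<close>

lemma finite_trees_forests_upto:
  "finite (trees_upto n :: 'l::finite rtree set) \<and> finite {F :: 'l forest. forest_nodes F \<le> n}"
proof (induction n)
  case 0
  have "trees_upto 0 = ({} :: 'l rtree set)" using tree_nodes_pos by (auto simp: not_le)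
  moreover have "{F :: 'l forest. forest_nodes F \<le> 0} = {{#}}"
  proof -
    have "F = {#}" if "forest_nodes F = 0" for F :: "'l forest"
      using size_le_forest_nodes[of F] that by simp
    then show ?thesis by auto
  qed
  ultimately show ?case by (metis finite.emptyI finite.insertI)
next
  case (Suc n)
  have "trees_upto (Suc n) \<subseteq> (\<lambda>(i :: 'l, F). Node i F) ` (UNIV \<times> {F. forest_nodes F \<le> n})"
  proof
    fix t :: "'l rtree" assume "t \<in> trees_upto (Suc n)"
    then show "t \<in> (\<lambda>(i :: 'l, F). Node i F) ` (UNIV \<times> {F. forest_nodes F \<le> n})"
      by (cases t) auto
  qed
  then have fin: "finite (trees_upto (Suc n) :: 'l rtree set)"
    by (rule finite_subset) (use Suc in auto)
  have "{F :: 'l forest. forest_nodes F \<le> Suc n} \<subseteq>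
      mset ` {ts. set ts \<subseteq> trees_upto (Suc n) \<and> length ts \<le> Suc n}"
  proof
    fix F :: "'l forest" assume F: "F \<in> {F. forest_nodes F \<le> Suc n}"
    obtain ts where ts: "mset ts = F" using ex_mset by blast
    then have "set ts \<subseteq> trees_upto (Suc n)" "length ts \<le> Suc n"
      using F tree_nodes_le_forest[of _ F] size_le_forest_nodes[of F] by fastforce+
    then show "F \<in> mset ` {ts. set ts \<subseteq> trees_upto (Suc n) \<and> length ts \<le> Suc n}"
      using ts by auto
  qed
  moreover have "finite (mset ` {ts. set ts \<subseteq> (trees_upto (Suc n) :: 'l rtree set) \<and> length ts \<le> Suc n})"
    by (intro finite_imageI finite_lists_length_le fin)
  ultimately show ?case using fin finite_subset by blast
qed

lemmas finite_trees_upto = finite_trees_forests_upto[THEN conjunct1]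
  and finite_forests_upto = finite_trees_forests_upto[THEN conjunct2]

lemma cut_number_nodes:
  assumes "cut_number a t r \<noteq> 0"
  shows "tree_nodes r = tree_nodes a + tree_nodes t"
  using edge_cuts_nodes[of "(a, t)" r] assms by (auto simp: cut_number_def count_eq_zero_iff)

lemma cut_number_labels:
  assumes "cut_number a t r \<noteq> 0"
  shows "set_rtree r = set_rtree a \<union> set_rtree t"
  using edge_cuts_labels[of "(a, t)" r] assms by (auto simp: cut_number_def count_eq_zero_iff)

lemma edge_cuts_sum_indicator:
  "(\<Sum>c\<in>#edge_cuts r. if fst c = a \<and> Q (snd c) then 1 else 0 :: real) =
    (\<Sum>t\<in>{t. Q t \<and> (a, t) \<in># edge_cuts r}. real (cut_number a t r))"
proof -
  have "(\<Sum>c\<in>#edge_cuts r. if fst c = a \<and> Q (snd c) then 1 else 0 :: real) =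
      (\<Sum>c\<in>set_mset (edge_cuts r). if fst c = a \<and> Q (snd c) then real (count (edge_cuts r) c) else 0)"
    unfolding sum_mset_count by (rule sum.cong) auto
  also have "\<dots> = (\<Sum>c\<in>{c \<in> set_mset (edge_cuts r). fst c = a \<and> Q (snd c)}. real (count (edge_cuts r) c))"
    by (rule sum.inter_filter[symmetric]) simp
  also have "\<dots> = (\<Sum>t\<in>{t. Q t \<and> (a, t) \<in># edge_cuts r}. real (cut_number a t r))"
    by (rule sum.reindex_bij_witness[of _ "\<lambda>t. (a, t)" snd]) (auto simp: cut_number_def)
  finally show ?thesis .
qed

text \<open>
  The counts on the right-hand side arise because \<open>tree_prelie\<close> counts edges of the resulting tree,
  so that each of the equal subtrees at its root contributes.
\<close>

lemma tree_prelie_unit_Node: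
  fixes a :: "'l::finite rtree"
  assumes n: "tree_nodes a + forest_nodes F \<le> n"
  shows "tree_prelie (unit_series a) (unit_series (Node i F)) =
    scale_series (real (Suc (count F a))) (unit_series (Node i (add_mset a F))) +
    (\<Sum>t\<in>set_mset F. \<Sum>r\<in>trees_upto n.
      scale_series (real (cut_number a t r * count (add_mset r (F - {#t#})) r))
        (unit_series (Node i (add_mset r (F - {#t#})))))"
proof
  let ?G = "\<lambda>t r. add_mset r (F - {#t#})"
  let ?k = "\<lambda>t r. real (cut_number a t r * count (?G t r) r)"
  fix s :: "'l rtree"
  obtain j G where s: "s = Node j G" by (cases s)
  \<comment> \<open>\<open>Q r t\<close> says that the root label agrees and that \<open>G\<close>
    arises from \<open>F\<close> by replacing a branch \<open>t\<close> with
    \<open>r\<close>.\<close>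
  define Q where "Q r t \<longleftrightarrow> j = i \<and> r \<in># G \<and> t \<in># F \<and> G - {#r#} = F - {#t#}" for r t
  define K where "K = set_mset F \<union> set_mset G \<union> trees_upto n"
  have fin: "finite K" by (simp add: K_def finite_trees_upto)
  have Qiff1: "j = i \<and> add_mset t (G - {#r#}) = F \<longleftrightarrow> Q r t" if "r \<in># G" for r t
    using that unfolding Q_def by (metis add_mset_remove_trivial insert_DiffM union_single_eq_member)
  have Qiff2: "Node j G = Node i (?G t r) \<longleftrightarrow> Q r t" if "t \<in># F" for r t
    using that unfolding Q_def rtree.inject
    by (metis add_mset_remove_trivial insert_DiffM union_single_eq_member)
  \<comment> \<open>An edge of \<open>s\<close> is either at the root, where \<open>a\<close> is cut
    off as a whole branch, or inside a branch \<open>r\<close>.\<close>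
  have "tree_prelie (unit_series a) (unit_series (Node i F)) s =
      (\<Sum>r\<in>#G. (if r = a \<and> j = i \<and> G - {#r#} = F then 1 else 0)) +
      (\<Sum>r\<in>#G. \<Sum>c\<in>#edge_cuts r. if fst c = a \<and> (j = i \<and> add_mset (snd c) (G - {#r#}) = F) then 1 else 0)"
    unfolding tree_prelie_eq s edge_cuts_sum sum_mset.distrib
    by (intro arg_cong2[where f = "(+)"] arg_cong[where f = sum_mset] image_mset_cong)
      (auto simp: unit_series_apply)
  also have "(\<Sum>r\<in>#G. (if r = a \<and> j = i \<and> G - {#r#} = F then 1 else 0)) =
      real (Suc (count F a)) * unit_series (Node i (add_mset a F)) s"
  proof (cases "j = i \<and> G = add_mset a F")
    case True
    have "(\<Sum>r\<in>#G. (if r = a \<and> j = i \<and> G - {#r#} = F then 1 else 0 :: real)) =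
        (\<Sum>r\<in>set_mset G. if r = a then real (count G a) else 0)"
      unfolding sum_mset_count by (rule sum.cong) (use True in auto)
    then show ?thesis using True by (simp add: unit_series_apply s)
  next
    case False
    have "(\<Sum>r\<in>#G. (if r = a \<and> j = i \<and> G - {#r#} = F then 1 else 0 :: real)) = (\<Sum>r\<in>#G. 0)"
      using False by (intro arg_cong[where f = sum_mset] image_mset_cong) (auto simp: insert_DiffM)
    then show ?thesis using False by (auto simp: unit_series_apply s)
  qed
  also have "(\<Sum>r\<in>#G. \<Sum>c\<in>#edge_cuts r. if fst c = a \<and> (j = i \<and> add_mset (snd c) (G - {#r#}) = F) then 1 else 0) =
      (\<Sum>r\<in>#G. \<Sum>t\<in>{t. Q r t \<and> (a, t) \<in># edge_cuts r}. real (cut_number a t r))"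
    by (intro arg_cong[where f = sum_mset] image_mset_cong)
      (simp add: edge_cuts_sum_indicator[where Q = "Q r" for r] Qiff1)
  also have "\<dots> = (\<Sum>r\<in>K. real (count G r) * (\<Sum>t\<in>{t. Q r t \<and> (a, t) \<in># edge_cuts r}. real (cut_number a t r)))"
    by (subst sum_mset_count_superset[OF fin]) (auto simp: K_def)
  also have "\<dots> = (\<Sum>r\<in>K. \<Sum>t\<in>K. if Q r t then real (cut_number a t r * count G r) else 0)"
  proof (rule sum.cong[OF refl])
    fix r
    have "(\<Sum>t\<in>{t. Q r t \<and> (a, t) \<in># edge_cuts r}. real (cut_number a t r)) =
        (\<Sum>t\<in>K. if Q r t then real (cut_number a t r) else 0)"
      by (rule sum.mono_neutral_cong_left[OF fin])
        (auto simp: K_def Q_def cut_number_def count_eq_zero_iff)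
    then show "real (count G r) * (\<Sum>t\<in>{t. Q r t \<and> (a, t) \<in># edge_cuts r}. real (cut_number a t r)) =
        (\<Sum>t\<in>K. if Q r t then real (cut_number a t r * count G r) else 0)"
      by (simp add: sum_distrib_left if_distrib mult.commute cong: if_cong)
  qed
  also have "\<dots> = (\<Sum>t\<in>K. \<Sum>r\<in>K. if Q r t then real (cut_number a t r * count G r) else 0)"
    by (rule sum.swap)
  also have "\<dots> = (\<Sum>t\<in>set_mset F. \<Sum>r\<in>trees_upto n. if Q r t then real (cut_number a t r * count G r) else 0)"
  proof (rule sum.mono_neutral_cong_right[OF fin])
    fix t assume t: "t \<in> set_mset F"
    show "(\<Sum>r\<in>K. if Q r t then real (cut_number a t r * count G r) else 0) =
        (\<Sum>r\<in>trees_upto n. if Q r t then real (cut_number a t r * count G r) else 0)"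
    proof (rule sum.mono_neutral_right[OF fin], simp add: K_def, rule ballI)
      fix r assume "r \<in> K - trees_upto n"
      then have "cut_number a t r = 0"
        using cut_number_nodes[of a t r] tree_nodes_le_forest[OF t] n by fastforce
      then show "(if Q r t then real (cut_number a t r * count G r) else 0) = 0" by simp
    qed
  qed (auto simp: K_def Q_def)
  also have "\<dots> = (\<Sum>t\<in>set_mset F. \<Sum>r\<in>trees_upto n.
      ?k t r *
        unit_series (Node i (?G t r)) s)"
  proof (intro sum.cong refl)
    fix t r assume "t \<in> set_mset F"
    then show "(if Q r t then real (cut_number a t r * count G r) else 0) =
      ?k t r *
        unit_series (Node i (?G t r)) s"
      using Qiff2[of t r] by (auto simp: unit_series_apply s algebra_simps)
  qed
  finally show "tree_prelie (unit_series a) (unit_series (Node i F)) s =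
    (scale_series (real (Suc (count F a))) (unit_series (Node i (add_mset a F))) +
    (\<Sum>t\<in>set_mset F. \<Sum>r\<in>trees_upto n.
      scale_series (?k t r)
        (unit_series (Node i (?G t r))))) s"
    by (simp add: sum_fun_apply)
qed

text \<open>Grafting \<open>a\<close> onto a tree with branches \<open>G\<close> gives a positive
  multiple of the tree with the additional branch \<open>a\<close>, plus trees of the same size with
  one branch fewer at the root. Solving for the first tree expresses it by smaller trees and by
  trees with fewer root branches. The index of \<open>P\<close> follows the degree of the products
  formed, and \<open>S\<close> restricts the labels.\<close>

lemma tree_generation:
  fixes P :: "nat \<Rightarrow> 'l::finite tree_series \<Rightarrow> bool"
  assumes zero: "\<And>n. 1 \<le> n \<Longrightarrow> P n 0"
    and base: "\<And>i. i \<in> S \<Longrightarrow> P 1 (unit_series (bullet i))"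
    and add: "\<And>n u w. P n u \<Longrightarrow> P n w \<Longrightarrow> P n (u + w)"
    and scale: "\<And>n c u. P n u \<Longrightarrow> P n (scale_series c u)"
    and prelie: "\<And>m n u w. P m u \<Longrightarrow> P n w \<Longrightarrow> P (m + n) (tree_prelie u w)"
    and "set_rtree t \<subseteq> S"
  shows "P (tree_nodes t) (unit_series t)"
  using assms(6)
proof (induction "tree_nodes t" arbitrary: t rule: less_induct)
  case less
  have sum: "P n (\<Sum>x\<in>A. u x)" if "1 \<le> n" "\<And>x. x \<in> A \<Longrightarrow> P n (u x)" for n and A :: "'b set" and u
    using that(2) by (induction A rule: infinite_finite_induct)
      (auto simp: zero[OF that(1)] add simp del: zero_fun_apply plus_fun_apply)
  obtain i F where t: "t = Node i F" by (cases t)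
  \<comment> \<open>All forests of branches with the same number of nodes are treated at once, since
    the remainder leads to other trees of the same size.\<close>
  have "P (Suc (forest_nodes F')) (unit_series (Node i F'))"
    if "forest_nodes F' = forest_nodes F" "set_rtree (Node i F') \<subseteq> S" for F'
    using that
  proof (induction "size F'" arbitrary: F' rule: less_induct)
    case inner: less
    show ?case
    proof (cases F')
      case empty
      then show ?thesis using base[of i] inner.prems by simp
    next
      case (add a G)
      let ?n = "tree_nodes a + forest_nodes G"
      let ?u = "\<lambda>t r. scale_series (real (cut_number a t r * count (add_mset r (G - {#t#})) r))
          (unit_series (Node i (add_mset r (G - {#t#}))))"
      let ?R = "\<Sum>t\<in>set_mset G. \<Sum>r\<in>trees_upto ?n. ?u t r"
      let ?N = "Suc (forest_nodes F')"
      have "P (tree_nodes a) (unit_series a)"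
        by (rule less.hyps) (use inner.prems add in \<open>auto simp: t\<close>)
      moreover have "P (tree_nodes (Node i G)) (unit_series (Node i G))"
        by (rule less.hyps) (use inner.prems add tree_nodes_pos[of a] in \<open>auto simp: t\<close>)
      ultimately have "P (tree_nodes a + tree_nodes (Node i G))
          (tree_prelie (unit_series a) (unit_series (Node i G)))"
        by (rule prelie)
      then have lie: "P ?N (tree_prelie (unit_series a) (unit_series (Node i G)))"
        by (simp add: add)
      have u: "P ?N (?u t r)" if "t \<in># G" for t r
      proof (cases "cut_number a t r = 0")
        case True
        then have "?u t r = 0" by (simp add: fun_eq_iff)
        then show ?thesis using zero by simp
      next
        case False
        obtain H where H: "G = add_mset t H" using \<open>t \<in># G\<close> by (metis insert_DiffM)
        have nodes: "forest_nodes (add_mset r H) = forest_nodes F'"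
          using cut_number_nodes[OF False] by (simp add: add H)
        have "set_rtree (Node i (add_mset r H)) \<subseteq> S"
          using cut_number_labels[OF False] inner.prems(2) by (auto simp: add H)
        then have "P (Suc (forest_nodes (add_mset r H))) (unit_series (Node i (add_mset r H)))"
          using nodes inner.prems(1) by (intro inner.hyps) (auto simp: add H)
        then have "P ?N (unit_series (Node i (add_mset r H)))" by (simp only: nodes)
        then show ?thesis by (auto simp: H intro: scale)
      qed
      have "P ?N ?R" by (intro sum u) auto
      \<comment> \<open>The coefficient \<open>Suc (count G a)\<close> is nonzero, so the grafting
        identity can be solved for the new tree.\<close>
      then have "P ?N (scale_series (1 / real (Suc (count G a)))
          (tree_prelie (unit_series a) (unit_series (Node i G)) + scale_series (-1) ?R))"
        by (intro scale assms(3) lie)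
      also have "scale_series (1 / real (Suc (count G a)))
          (tree_prelie (unit_series a) (unit_series (Node i G)) + scale_series (-1) ?R) =
          unit_series (Node i F')"
        unfolding tree_prelie_unit_Node[OF order_refl] by (auto simp: add fun_eq_iff simp del: of_nat_Suc)
      finally show ?thesis .
    qed
  qed
  from this[of F] less.prems show ?case by (simp add: t)
qed

section \<open>Elementary differentials\<close>

primrec nabla :: "'e list \<Rightarrow> ('e \<Rightarrow> 'e) \<Rightarrow> 'e \<Rightarrow> 'e::euclidean_space" where
  "nabla [] g = g"
| "nabla (u # us) g = nabla us (dir_deriv u g)"

lemma nabla_sum:
  assumes "\<And>j. j \<in> J \<Longrightarrow> C_class (length us) (g j)"
  shows "nabla us (\<lambda>y. \<Sum>j\<in>J. c j *\<^sub>R g j y) = (\<lambda>y. \<Sum>j\<in>J. c j *\<^sub>R nabla us (g j) y)"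
  using assms
proof (induction us arbitrary: g)
  case (Cons u us)
  have "dir_deriv u (\<lambda>y. \<Sum>j\<in>J. c j *\<^sub>R g j y) = (\<lambda>y. \<Sum>j\<in>J. c j *\<^sub>R dir_deriv u (g j) y)"
  proof
    fix y
    have "g j differentiable at y" if "j \<in> J" for j
      using Cons.prems[OF that] by (rule C_class_differentiable) simp
    then show "dir_deriv u (\<lambda>y. \<Sum>j\<in>J. c j *\<^sub>R g j y) y = (\<Sum>j\<in>J. c j *\<^sub>R dir_deriv u (g j) y)"
      by (simp add: dir_deriv_sum dir_deriv_scaleR)
  qed
  moreover have "C_class (length us) (dir_deriv u (g j))" if "j \<in> J" for j
    using Cons.prems[OF that] by (rule C_class_dir_deriv) simp
  ultimately show ?case by (simp add: Cons.IH)
qed simp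

text \<open>Linearity in the first slot; symmetry of the derivatives extends it to every
  slot.\<close>

lemma nabla_sum_head:
  assumes "C_class (Suc (length us)) g"
  shows "nabla ((\<Sum>j\<in>J. c j *\<^sub>R u j) # us) g y = (\<Sum>j\<in>J. c j *\<^sub>R nabla (u j # us) g y)"
proof -
  have "dir_deriv (\<Sum>j\<in>J. c j *\<^sub>R u j) g = (\<lambda>y. \<Sum>j\<in>J. c j *\<^sub>R dir_deriv (u j) g y)"
  proof
    fix y
    have "g differentiable at y" using assms by (rule C_class_differentiable) simp
    then show "dir_deriv (\<Sum>j\<in>J. c j *\<^sub>R u j) g y = (\<Sum>j\<in>J. c j *\<^sub>R dir_deriv (u j) g y)"
      by (simp add: dir_deriv_sum_left dir_deriv_scaleR_left)
  qed
  then show ?thesis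
    using assms by (simp add: nabla_sum C_class_dir_deriv[OF assms])
qed

lemma nabla_expand:
  assumes "C_class (Suc (length us)) g"
  shows "nabla (v # us) g y = (\<Sum>b\<in>Basis. (v \<bullet> b) *\<^sub>R nabla us (dir_deriv b g) y)"
  using nabla_sum_head[OF assms, where J = Basis and c = "\<lambda>b. v \<bullet> b" and u = "\<lambda>b. b" and y = y]
  by (simp only: euclidean_representation nabla.simps)

lemma nabla_swap:
  assumes "C_class (Suc (Suc (length us))) g"
  shows "nabla (u # v # us) g = nabla (v # u # us) g"
proof -
  have "C_class 2 g" using assms by (rule C_class_mono) simp
  then show ?thesis using dir_deriv_commute[of g u v] by simp
qed

text \<open>Symmetry in two directions suffices: if the heads \<open>u\<close> and \<open>v\<close>
  differ, both lists are rearrangements of \<open>u\<close>, \<open>v\<close> and a common rest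
  \<open>R\<close>, and the heads are exchanged in front of it.\<close>

lemma nabla_perm:
  assumes "mset us = mset vs" "C_class (length us) g"
  shows "nabla us g = nabla vs g"
  using assms
proof (induction "length us" arbitrary: us vs g rule: less_induct)
  case less
  show ?case
  proof (cases us)
    case Nil
    then show ?thesis using less.prems by simp
  next
    case (Cons u us')
    then obtain v vs' where vs: "vs = v # vs'" using less.prems by (cases vs) auto
    have g': "C_class (length us') (dir_deriv w g)" for w
      using less.prems(2) Cons by (auto intro: C_class_dir_deriv)
    have len: "length vs' = length us'"
      using less.prems(1) Cons vs by (metis length_Cons nat.inject size_mset)
    show ?thesis
    proof (cases "u = v")
      case True
      then show ?thesis using less.hyps[of us' vs' "dir_deriv u g"] less.prems Cons vs g' by simp
    next
      case False
      have eq: "add_mset u (mset us') = add_mset v (mset vs')"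
        using less.prems(1) Cons vs by simp
      then have v: "v \<in># mset us'" using False by (metis insert_noteq_member)
      obtain R where R: "mset R = mset us' - {#v#}" using ex_mset by blast
      have us': "mset us' = mset (v # R)" using v R by simp
      then have lenR: "length us' = Suc (length R)" by (metis length_Cons size_mset)
      have vs': "mset (u # R) = mset vs'" using eq us' by (simp add: add_mset_commute)
      have "nabla us g = nabla us' (dir_deriv u g)" by (simp add: Cons)
      also have "\<dots> = nabla (v # R) (dir_deriv u g)"
        by (rule less.hyps) (use Cons us' g' in auto)
      also have "\<dots> = nabla (u # v # R) g" by simp
      also have "\<dots> = nabla (v # u # R) g"
        by (rule nabla_swap) (use less.prems(2) Cons lenR in simp)
      also have "\<dots> = nabla (u # R) (dir_deriv v g)" by simp
      also have "\<dots> = nabla vs' (dir_deriv v g)"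
        by (rule less.hyps) (use Cons vs' lenR g' in auto)
      finally show ?thesis by (simp add: vs)
    qed
  qed
qed

text \<open>The branches of a tree form a multiset, so an order is chosen arbitrarily; for a
  function with enough derivatives the choice does not matter.\<close>

definition nabla_mset :: "'e multiset \<Rightarrow> ('e \<Rightarrow> 'e) \<Rightarrow> 'e \<Rightarrow> 'e::euclidean_space" where
  "nabla_mset U g = nabla (SOME us. mset us = U) g"

lemma nabla_mset_eq: "C_class (length us) g \<Longrightarrow> nabla_mset (mset us) g = nabla us g"
  unfolding nabla_mset_def
  by (rule someI2[of "\<lambda>vs. mset vs = mset us" us]) (auto intro!: nabla_perm dest: mset_eq_length)

lemma C_class_nabla_fields:
  assumes "\<And>u. u \<in> set us \<Longrightarrow> C_class k u" "C_class (k + length us) g"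
  shows "C_class k (\<lambda>y. nabla (map (\<lambda>u. u y) us) g y)"
  using assms
proof (induction us arbitrary: g)
  case (Cons u us)
  have "C_class (Suc (length us)) g" using Cons.prems(2) by (rule C_class_mono) simp
  then have "nabla (map (\<lambda>u. u y) (u # us)) g y =
      (\<Sum>b\<in>Basis. (u y \<bullet> b) *\<^sub>R nabla (map (\<lambda>u. u y) us) (dir_deriv b g) y)" for y
    using nabla_expand[of "map (\<lambda>u. u y) us" g "u y" y] by simp
  moreover have "C_class k (\<lambda>y. nabla (map (\<lambda>u. u y) us) (dir_deriv b g) y)" for b
    by (rule Cons.IH) (use Cons.prems in \<open>auto intro: C_class_dir_deriv\<close>)
  ultimately show ?case
    using Cons.prems by (auto intro!: C_class_sum C_class_inner_scaleR)
qed simp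

text \<open>Product rule for a multilinear expression: \<open>h\<close> differentiates either
  \<open>g\<close>, as one more direction, or one of the fields in the slots. Expanding the first
  slot in \<open>Basis\<close> leaves the induction hypothesis for the derivatives of
  \<open>g\<close>.\<close>

lemma nabla_fields_has_derivative:
  assumes "\<And>u. u \<in> set us \<Longrightarrow> u differentiable at y" "C_class (Suc (length us)) g"
  shows "((\<lambda>y. nabla (map (\<lambda>u. u y) us) g y) has_derivative
    (\<lambda>h. nabla (h # map (\<lambda>u. u y) us) g y +
      (\<Sum>j<length us. nabla ((map (\<lambda>u. u y) us)[j := dir_deriv h (us ! j) y]) g y))) (at y)"
  using assms
proof (induction us arbitrary: g)
  case Nil
  then show ?case using C_class_has_derivative[of 1 g y] by simp
next
  case (Cons u us)
  let ?us = "\<lambda>y. map (\<lambda>u. u y) us"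
  have g: "C_class (Suc (length us)) g" "C_class (Suc (Suc (length us))) g"
    using Cons.prems(2) by (auto intro: C_class_mono)
  have gb: "C_class (Suc (length us)) (dir_deriv b g)" for b
    using Cons.prems(2) by (rule C_class_dir_deriv) simp
  have exp: "nabla (v # vs) g z = (\<Sum>b\<in>Basis. (v \<bullet> b) *\<^sub>R nabla vs (dir_deriv b g) z)"
    if "length vs = length us" for v vs z
    by (rule nabla_expand) (use that g in simp)
  have IH: "((\<lambda>y. nabla (?us y) (dir_deriv b g) y) has_derivative
    (\<lambda>h. nabla (h # ?us y) (dir_deriv b g) y +
      (\<Sum>j<length us. nabla ((?us y)[j := dir_deriv h (us ! j) y]) (dir_deriv b g) y))) (at y)" for b
    by (rule Cons.IH) (use Cons.prems gb in auto)
  have du: "(u has_derivative (\<lambda>h. dir_deriv h u y)) (at y)"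
    by (rule dir_deriv_works) (use Cons.prems in auto)
  have "((\<lambda>y. \<Sum>b\<in>Basis. (u y \<bullet> b) *\<^sub>R nabla (?us y) (dir_deriv b g) y) has_derivative
    (\<lambda>h. \<Sum>b\<in>Basis. (u y \<bullet> b) *\<^sub>R (nabla (h # ?us y) (dir_deriv b g) y +
      (\<Sum>j<length us. nabla ((?us y)[j := dir_deriv h (us ! j) y]) (dir_deriv b g) y)) +
      (dir_deriv h u y \<bullet> b) *\<^sub>R nabla (?us y) (dir_deriv b g) y)) (at y)"
    by (intro has_derivative_sum has_derivative_scaleR has_derivative_inner_left du IH)
  moreover have "(\<Sum>b\<in>Basis. (u y \<bullet> b) *\<^sub>R (nabla (h # ?us y) (dir_deriv b g) y +
      (\<Sum>j<length us. nabla ((?us y)[j := dir_deriv h (us ! j) y]) (dir_deriv b g) y)) +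
      (dir_deriv h u y \<bullet> b) *\<^sub>R nabla (?us y) (dir_deriv b g) y) =
     nabla (h # map (\<lambda>u. u y) (u # us)) g y + (\<Sum>j<length (u # us).
       nabla ((map (\<lambda>u. u y) (u # us))[j := dir_deriv h ((u # us) ! j) y]) g y)" for h
  proof -
    have "(\<Sum>b\<in>Basis. (u y \<bullet> b) *\<^sub>R nabla (h # ?us y) (dir_deriv b g) y) = nabla (u y # h # ?us y) g y"
      using nabla_expand[of "h # ?us y" g "u y" y] g by simp
    \<comment> \<open>The induction leaves \<open>h\<close> behind \<open>u y\<close>; symmetry of
      the derivatives brings it to the front.\<close>
    also have "\<dots> = nabla (h # map (\<lambda>u. u y) (u # us)) g y"
      by (subst nabla_swap) (use g in auto)
    finally have 1: "(\<Sum>b\<in>Basis. (u y \<bullet> b) *\<^sub>R nabla (h # ?us y) (dir_deriv b g) y) =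
      nabla (h # map (\<lambda>u. u y) (u # us)) g y" .
    have 2: "(\<Sum>b\<in>Basis. (u y \<bullet> b) *\<^sub>R
         (\<Sum>j<length us. nabla ((?us y)[j := dir_deriv h (us ! j) y]) (dir_deriv b g) y)) =
       (\<Sum>j<length us. nabla (u y # (?us y)[j := dir_deriv h (us ! j) y]) g y)"
      by (subst exp) (auto simp: scaleR_sum_right intro: sum.swap)
    have 3: "(\<Sum>b\<in>Basis. (dir_deriv h u y \<bullet> b) *\<^sub>R nabla (?us y) (dir_deriv b g) y) =
       nabla (dir_deriv h u y # ?us y) g y"
      by (subst exp) auto
    show ?thesis
      unfolding scaleR_add_right sum.distrib 1 2 3
      by (simp add: sum.lessThan_Suc_shift del: nabla.simps sum.lessThan_Suc)
  qed
  moreover have "nabla (map (\<lambda>u. u y) (u # us)) g y =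
      (\<Sum>b\<in>Basis. (u y \<bullet> b) *\<^sub>R nabla (?us y) (dir_deriv b g) y)" for y
    using exp[of "?us y" "u y" y] by (simp del: nabla.simps)
  ultimately show ?case by (simp del: nabla.simps)
qed

section \<open>Symmetry factors and the pre-Lie morphism from trees to vector fields\<close>

text \<open>Only permutations of equal branches at one root are counted. Through the recursion of
  \<open>elem_field\<close> these factors multiply to the order of the automorphism group of the
  tree.\<close>

definition symmetry_factor :: "'a multiset \<Rightarrow> real" where
  "symmetry_factor F = (\<Prod>t\<in>set_mset F. fact (count F t))"

lemma symmetry_factor_pos: "symmetry_factor F > 0"
  by (simp add: symmetry_factor_def prod_pos)

lemma symmetry_factor_add:
  "symmetry_factor (add_mset t F) = symmetry_factor F * real (Suc (count F t))"
proof -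
  have ext: "symmetry_factor G = (\<Prod>x\<in>insert t (set_mset F). fact (count G x))"
    if "set_mset G \<subseteq> insert t (set_mset F)" for G
    unfolding symmetry_factor_def
    by (rule prod.mono_neutral_left) (use that in \<open>auto simp: not_in_iff\<close>)
  have "symmetry_factor (add_mset t F) =
      fact (count (add_mset t F) t) * (\<Prod>x\<in>set_mset F - {t}. fact (count (add_mset t F) x))"
    unfolding ext[of "add_mset t F", simplified] by (simp add: prod.insert_remove)
  also have "(\<Prod>x\<in>set_mset F - {t}. fact (count (add_mset t F) x)) =
      (\<Prod>x\<in>set_mset F - {t}. fact (count F x) :: real)"
    by (rule prod.cong) auto
  also have "fact (count (add_mset t F) t) * \<dots> = real (Suc (count F t)) *
      (fact (count F t) * (\<Prod>x\<in>set_mset F - {t}. fact (count F x)))"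
    by simp
  also have "fact (count F t) * (\<Prod>x\<in>set_mset F - {t}. fact (count F x)) = symmetry_factor F"
    unfolding ext[of F, OF subset_insertI] by (simp add: prod.insert_remove)
  finally show ?thesis by simp
qed

primrec elem_field :: "('l \<Rightarrow> 'e \<Rightarrow> 'e) \<Rightarrow> 'l rtree \<Rightarrow> 'e \<Rightarrow> 'e::euclidean_space" where
  "elem_field f (Node i F) = (\<lambda>y. (1 / symmetry_factor F) *\<^sub>R
     nabla_mset (image_mset (\<lambda>h. h y) (image_mset (elem_field f) F)) (f i) y)"

lemma nabla_mset_trees:
  assumes "C_class r g" "forest_nodes F \<le> r" "mset ts = F"
  shows "nabla_mset (image_mset (\<lambda>h. h y) (image_mset (elem_field f) F)) g =
    nabla (map (\<lambda>t. elem_field f t y) ts) g"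
proof -
  have "C_class (length ts) g"
    using assms(1) by (rule C_class_mono) (use assms(2,3) size_le_forest_nodes[of F] in auto)
  then show ?thesis
    using nabla_mset_eq[of "map (\<lambda>t. elem_field f t y) ts" g]
    by (simp add: assms(3)[symmetric] image_mset.compositionality comp_def)
qed

lemma elem_field_Node:
  assumes "C_class r (f i)" "forest_nodes F \<le> r" "mset ts = F"
  shows "elem_field f (Node i F) y =
    (1 / symmetry_factor F) *\<^sub>R nabla (map (\<lambda>t. elem_field f t y) ts) (f i) y"
  by (simp add: nabla_mset_trees[OF assms])

declare elem_field.simps [simp del]

lemma C_class_elem_field:
  assumes "\<And>i. C_class r (f i)" "k + tree_nodes t \<le> Suc r"
  shows "C_class k (elem_field f t)"
  using assms(2)
proof (induction t)
  case (Node i F)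
  obtain ts where ts: "mset ts = F" using ex_mset by blast
  have "elem_field f (Node i F) =
      (\<lambda>y. (1 / symmetry_factor F) *\<^sub>R nabla (map (\<lambda>u. u y) (map (elem_field f) ts)) (f i) y)"
    using elem_field_Node[of r f i F ts, OF assms(1) _ ts] Node.prems by (auto simp: comp_def)
  moreover have "C_class k (\<lambda>y. nabla (map (\<lambda>u. u y) (map (elem_field f) ts)) (f i) y)"
  proof (rule C_class_nabla_fields)
    show "C_class k u" if "u \<in> set (map (elem_field f) ts)" for u
    proof -
      from that obtain t where t: "t \<in># F" "u = elem_field f t" using ts by auto
      then show ?thesis using Node.IH[OF t(1)] Node.prems tree_nodes_le_forest[OF t(1)] by simp
    qed
    have "length ts \<le> forest_nodes F" using size_le_forest_nodes[of F] ts by auto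
    then show "C_class (k + length (map (elem_field f) ts)) (f i)"
      using C_class_mono[OF assms(1)] Node.prems by simp
  qed
  ultimately show ?case using C_class_scaleR by simp
qed

definition tree_series_field ::
  "('l::finite \<Rightarrow> 'e \<Rightarrow> 'e::euclidean_space) \<Rightarrow> nat \<Rightarrow> 'l tree_series \<Rightarrow> 'e \<Rightarrow> 'e" where
  "tree_series_field f n u = (\<lambda>y. \<Sum>t\<in>trees_upto n. u t *\<^sub>R elem_field f t y)"

lemma tree_series_field_add:
  "tree_series_field f n (u + w) y = tree_series_field f n u y + tree_series_field f n w y"
  by (simp add: tree_series_field_def scaleR_add_left sum.distrib)

lemma tree_series_field_scale:
  "tree_series_field f n (scale_series c u) y = c *\<^sub>R tree_series_field f n u y"
  by (simp add: tree_series_field_def scaleR_sum_right)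

lemma tree_series_field_sum:
  "tree_series_field f n (\<Sum>i\<in>I. u i) y = (\<Sum>i\<in>I. tree_series_field f n (u i) y)"
  by (simp add: tree_series_field_def sum_fun_apply scaleR_sum_left sum.swap[of _ I])

lemma tree_series_field_unit:
  assumes "tree_nodes t \<le> n"
  shows "tree_series_field f n (unit_series t) y = elem_field f t y"
proof -
  have "tree_series_field f n (unit_series t) y =
      (\<Sum>s\<in>trees_upto n. if s = t then elem_field f t y else 0)"
    unfolding tree_series_field_def by (rule sum.cong) (auto simp: unit_series_apply)
  then show ?thesis using assms by (simp add: finite_trees_upto)
qed

lemma tree_series_field_extend:
  assumes "\<And>t. tree_nodes t > m \<Longrightarrow> u t = 0" "m \<le> n"
  shows "tree_series_field f m u = tree_series_field f n u"
  unfolding tree_series_field_def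
  by (rule ext, rule sum.mono_neutral_left) (use assms in \<open>auto simp: finite_trees_upto not_le\<close>)

lemma C_class_tree_series_field:
  assumes "\<And>i. C_class r (f i)" "k + n \<le> Suc r"
  shows "C_class k (tree_series_field f n u)"
  unfolding tree_series_field_def
  by (intro C_class_sum C_class_scaleR C_class_elem_field[OF assms(1)]) (use assms(2) in auto)

lemma sum_nth_eq_sum_mset:
  fixes \<phi> :: "'a \<Rightarrow> 'b::comm_monoid_add"
  shows "(\<Sum>j<length ts. \<phi> (ts ! j)) = (\<Sum>t\<in>#mset ts. \<phi> t)"
  by (simp add: sum_mset_sum_list sum_list_sum_nth atLeast0LessThan flip: mset_map)

text \<open>The product rule has the shape of \<open>tree_prelie_unit_Node\<close>: differentiating
  the field at the root adds the branch \<open>a\<close>, differentiating a branch grafts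
  \<open>a\<close> into it by induction. It remains to match multiplicities with symmetry
  factors.\<close>

lemma vf_prelie_elem_field:
  fixes f :: "'l::finite \<Rightarrow> 'e \<Rightarrow> 'e::euclidean_space"
  assumes f: "\<And>i. C_class r (f i)" and "tree_nodes a + tree_nodes b \<le> Suc r" "tree_nodes a + tree_nodes b \<le> n"
  shows "vf_prelie (elem_field f a) (elem_field f b) y =
    tree_series_field f n (tree_prelie (unit_series a) (unit_series b)) y"
  using assms(2,3)
proof (induction b)
  case (Node i F)
  let ?G = "\<lambda>t r. add_mset r (F - {#t#})"
  let ?k = "\<lambda>t r. real (cut_number a t r * count (?G t r) r)"
  let ?e = "\<lambda>t r. elem_field f (Node i (?G t r)) y"
  let ?s = "symmetry_factor F" and ?a = "elem_field f a y"
  let ?E = "\<lambda>G. nabla_mset (image_mset (\<lambda>t. elem_field f t y) G) (f i) y"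
  obtain ts where ts: "mset ts = F" using ex_mset by blast
  have a: "0 < tree_nodes a" by (rule tree_nodes_pos)
  have le: "tree_nodes a + forest_nodes F \<le> r" "tree_nodes a + forest_nodes F < n" using Node.prems by auto
  have len: "length ts \<le> forest_nodes F" using size_le_forest_nodes[of F] ts by auto
  have fi: "C_class (Suc (length ts)) (f i)" using f by (rule C_class_mono) (use le a len in simp)
  have E: "?E G = symmetry_factor G *\<^sub>R elem_field f (Node i G) y" for G
    using symmetry_factor_pos[of G]
    by (simp add: elem_field.simps image_mset.compositionality comp_def)
  have E_list: "?E (mset us) = nabla (map (\<lambda>t. elem_field f t y) us) (f i) y" if "length us \<le> Suc (length ts)" for us
    using nabla_mset_eq[of "map (\<lambda>t. elem_field f t y) us" "f i"] C_class_mono[OF fi that] by simp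
  have diff: "elem_field f t differentiable at y" if "t \<in># F" for t
    by (rule C_class_differentiable[of 1], rule C_class_elem_field[OF f])
      (use tree_nodes_le_forest[OF that] le a in auto)
  have "elem_field f (Node i F) =
      (\<lambda>y. (1 / ?s) *\<^sub>R nabla (map (\<lambda>u. u y) (map (elem_field f) ts)) (f i) y)"
    using elem_field_Node[of r f i F ts, OF f _ ts] le by (auto simp: comp_def)
  moreover have "((\<lambda>y. nabla (map (\<lambda>u. u y) (map (elem_field f) ts)) (f i) y) has_derivative
    (\<lambda>h. nabla (h # map (\<lambda>u. u y) (map (elem_field f) ts)) (f i) y +
      (\<Sum>j<length (map (elem_field f) ts). nabla ((map (\<lambda>u. u y) (map (elem_field f) ts))
        [j := dir_deriv h (map (elem_field f) ts ! j) y]) (f i) y))) (at y)"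
    by (rule nabla_fields_has_derivative) (use diff ts fi in auto)
  ultimately have "(elem_field f (Node i F) has_derivative
    (\<lambda>h. (1 / ?s) *\<^sub>R (nabla (h # map (\<lambda>u. u y) (map (elem_field f) ts)) (f i) y +
      (\<Sum>j<length (map (elem_field f) ts). nabla ((map (\<lambda>u. u y) (map (elem_field f) ts))
        [j := dir_deriv h (map (elem_field f) ts ! j) y]) (f i) y)))) (at y)"
    using has_derivative_scaleR_right by fastforce
  from dir_derivI[OF this, of ?a]
  have "vf_prelie (elem_field f a) (elem_field f (Node i F)) y =
    (1 / ?s) *\<^sub>R (nabla (?a # map (\<lambda>t. elem_field f t y) ts) (f i) y +
      (\<Sum>j<length ts. nabla ((map (\<lambda>t. elem_field f t y) ts)
        [j := vf_prelie (elem_field f a) (elem_field f (ts ! j)) y]) (f i) y))"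
    by (simp add: vf_prelie_eq comp_def del: nabla.simps)
  also have "nabla (?a # map (\<lambda>t. elem_field f t y) ts) (f i) y = ?E (add_mset a F)"
    using E_list[of "a # ts"] ts by simp
  also have "(\<Sum>j<length ts. nabla ((map (\<lambda>t. elem_field f t y) ts)
        [j := vf_prelie (elem_field f a) (elem_field f (ts ! j)) y]) (f i) y) =
      (\<Sum>j<length ts. \<Sum>r\<in>trees_upto (n - 1). real (cut_number a (ts ! j) r) *\<^sub>R ?E (add_mset r (F - {#ts ! j#})))"
  proof (rule sum.cong[OF refl])
    fix j assume j: "j \<in> {..<length ts}"
    let ?t = "ts ! j"
    have t: "?t \<in># F" using j ts by auto
    have le_t: "tree_nodes a + tree_nodes ?t \<le> n - 1" "tree_nodes a + tree_nodes ?t \<le> Suc r"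
      using tree_nodes_le_forest[OF t] le by auto
    let ?v = "vf_prelie (elem_field f a) (elem_field f ?t) y"
    let ?es = "map (\<lambda>t. elem_field f t y) ts"
    let ?R = "take j ts @ drop (Suc j) ts"
    have "?v = tree_series_field f n (tree_prelie (unit_series a) (unit_series ?t)) y"
      by (rule Node.IH[OF t]) (use le_t in auto)
    also have "\<dots> = (\<Sum>r\<in>trees_upto n. real (cut_number a ?t r) *\<^sub>R elem_field f r y)"
    proof -
      have "tree_prelie (unit_series a) (unit_series ?t) r = real (cut_number a ?t r)" for r
      proof -
        have "tree_prelie (unit_series a) (unit_series ?t) r =
            (\<Sum>c\<in>#edge_cuts r. if fst c = a \<and> snd c = ?t then 1 else 0)"
          unfolding tree_prelie_eq
          by (intro arg_cong[where f = sum_mset] image_mset_cong) (simp add: unit_series_apply)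
        also have "\<dots> = (\<Sum>t\<in>{t. t = ?t \<and> (a, t) \<in># edge_cuts r}. real (cut_number a t r))"
          by (rule edge_cuts_sum_indicator)
        also have "\<dots> = real (cut_number a ?t r)"
          by (cases "(a, ?t) \<in># edge_cuts r")
            (auto simp: cut_number_def count_eq_zero_iff Collect_conv_if conj_commute cong: conj_cong)
        finally show ?thesis .
      qed
      then show ?thesis by (simp add: tree_series_field_def)
    qed
    \<comment> \<open>Grafting \<open>a\<close> into a branch leaves out the root, so at most
      \<open>n - 1\<close> nodes occur and the whole tree stays within \<open>n\<close>.\<close>
    also have "\<dots> = (\<Sum>r\<in>trees_upto (n - 1). real (cut_number a ?t r) *\<^sub>R elem_field f r y)"
    proof (rule sum.mono_neutral_right[OF finite_trees_upto])
      show "\<forall>r\<in>trees_upto n - trees_upto (n - 1). real (cut_number a ?t r) *\<^sub>R elem_field f r y = 0"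
        using cut_number_nodes[of a ?t] le_t by fastforce
    qed auto
    finally have v: "?v = (\<Sum>r\<in>trees_upto (n - 1). real (cut_number a ?t r) *\<^sub>R elem_field f r y)" .
    \<comment> \<open>By symmetry the altered slot moves to the front, where
      \<open>nabla_sum_head\<close> gives linearity.\<close>
    have perm: "nabla (?es[j := x]) (f i) y = nabla (x # map (\<lambda>t. elem_field f t y) ?R) (f i) y" for x
    proof -
      have "mset (?es[j := x]) = mset (x # map (\<lambda>t. elem_field f t y) ?R)"
        using j by (simp add: upd_conv_take_nth_drop take_map drop_map)
      moreover have "C_class (length (?es[j := x])) (f i)" using fi by (auto intro: C_class_mono)
      ultimately show ?thesis using nabla_perm by metis
    qed
    have R: "mset ?R = F - {#?t#}" "Suc (length ?R) = length ts"
    proof -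
      have "mset ts = add_mset ?t (mset ?R)"
        using j id_take_nth_drop[of j ts] by (metis lessThan_iff mset.simps(2) mset_append union_mset_add_mset_right)
      then show "mset ?R = F - {#?t#}" using ts by simp
      show "Suc (length ?R) = length ts" using j by simp
    qed
    have "nabla (?es[j := ?v]) (f i) y =
      (\<Sum>r\<in>trees_upto (n - 1). real (cut_number a ?t r) *\<^sub>R
        nabla (elem_field f r y # map (\<lambda>t. elem_field f t y) ?R) (f i) y)"
      unfolding perm v
      by (rule nabla_sum_head) (use fi R(2) in \<open>auto intro: C_class_mono\<close>)
    also have "\<dots> = (\<Sum>r\<in>trees_upto (n - 1). real (cut_number a ?t r) *\<^sub>R ?E (add_mset r (F - {#?t#})))"
    proof (intro sum.cong refl arg_cong2[where f = scaleR])
      fix r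
      have "add_mset r (F - {#?t#}) = mset (r # ?R)" using R(1) by (simp only: mset.simps)
      moreover have "length (r # ?R) \<le> Suc (length ts)" using R(2) by simp
      ultimately show "nabla (elem_field f r y # map (\<lambda>t. elem_field f t y) ?R) (f i) y =
          ?E (add_mset r (F - {#?t#}))"
        using E_list[of "r # ?R"] by (simp only: list.map)
    qed
    finally show "nabla (?es[j := ?v]) (f i) y = \<dots>" .
  qed
  also have "\<dots> = (\<Sum>t\<in>#F. \<Sum>r\<in>trees_upto (n - 1). real (cut_number a t r) *\<^sub>R ?E (?G t r))"
    unfolding ts[symmetric] by (rule sum_nth_eq_sum_mset)
  also have "\<dots> = (\<Sum>t\<in>set_mset F. \<Sum>r\<in>trees_upto (n - 1).
      (?s * ?k t r) *\<^sub>R ?e t r)"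
    unfolding sum_mset_count
  proof (rule sum.cong[OF refl])
    fix t assume "t \<in> set_mset F"
    then obtain H where H: "F = add_mset t H" by (metis insert_DiffM)
    have G: "F - {#t#} = H" by (simp add: H)
    have "real (count F t) *\<^sub>R real (cut_number a t r) *\<^sub>R ?E (?G t r) =
      (?s * ?k t r) *\<^sub>R ?e t r" for r
    proof -
      \<comment> \<open>Both sides are \<open>symmetry_factor H\<close> times the multiplicities of
        \<open>t\<close> in \<open>F\<close> and of \<open>r\<close> in
        \<open>add_mset r H\<close>.\<close>
      have sym: "real (count F t) * symmetry_factor (add_mset r H) = ?s * real (count (add_mset r H) r)"
        unfolding H symmetry_factor_add by simp
      have "real (count F t) *\<^sub>R real (cut_number a t r) *\<^sub>R ?E (add_mset r H) =
          (real (cut_number a t r) * (real (count F t) * symmetry_factor (add_mset r H))) *\<^sub>R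
            elem_field f (Node i (add_mset r H)) y"
        unfolding E by (simp only: scaleR_scaleR mult_ac)
      also have "\<dots> = (?s * real (cut_number a t r * count (add_mset r H) r)) *\<^sub>R
            elem_field f (Node i (add_mset r H)) y"
        unfolding sym of_nat_mult by (simp only: mult_ac)
      finally show ?thesis unfolding G .
    qed
    then show "real (count F t) *\<^sub>R (\<Sum>r\<in>trees_upto (n - 1). real (cut_number a t r) *\<^sub>R ?E (?G t r)) =
      (\<Sum>r\<in>trees_upto (n - 1). (?s * ?k t r) *\<^sub>R ?e t r)"
      by (simp add: scaleR_sum_right)
  qed
  also have "?E (add_mset a F) = (?s * real (Suc (count F a))) *\<^sub>R elem_field f (Node i (add_mset a F)) y"
    unfolding E symmetry_factor_add ..
  finally have "vf_prelie (elem_field f a) (elem_field f (Node i F)) y =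
      real (Suc (count F a)) *\<^sub>R elem_field f (Node i (add_mset a F)) y +
      (\<Sum>t\<in>set_mset F. \<Sum>r\<in>trees_upto (n - 1).
        ?k t r *\<^sub>R ?e t r)"
    using symmetry_factor_pos[of F]
    by (simp add: scaleR_add_right scaleR_sum_right del: of_nat_Suc of_nat_mult)
  also have "\<dots> = tree_series_field f n (tree_prelie (unit_series a) (unit_series (Node i F))) y"
  proof -
    have unit: "?k t r *\<^sub>R ?e t r =
      ?k t r *\<^sub>R
        tree_series_field f n (unit_series (Node i (?G t r))) y" if "t \<in># F" for t r
    proof (cases "cut_number a t r = 0")
      case False
      obtain H where H: "F = add_mset t H" using \<open>t \<in># F\<close> by (metis insert_DiffM)
      have "tree_nodes (Node i (?G t r)) \<le> n"
      proof -
        have "forest_nodes F = tree_nodes t + forest_nodes H" "F - {#t#} = H" by (simp_all add: H)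
        then show ?thesis using cut_number_nodes[OF False] le(2) by simp
      qed
      then show ?thesis by (simp only: tree_series_field_unit)
    qed simp
    have "tree_nodes (Node i (add_mset a F)) \<le> n" using le by simp
    note root = tree_series_field_unit[OF this]
    have le': "tree_nodes a + forest_nodes F \<le> n - 1" using le by linarith
    show ?thesis
      unfolding tree_prelie_unit_Node[OF le'] tree_series_field_add tree_series_field_sum
        tree_series_field_scale root
      by (intro arg_cong2[where f = "(+)"] sum.cong refl unit)
  qed
  finally show ?case .
qed

section \<open>Vector fields induced by tree series\<close>

lemma tree_prelie_add_left: "tree_prelie (u + u') w = tree_prelie u w + tree_prelie u' w"
  and tree_prelie_add_right: "tree_prelie u (w + w') = tree_prelie u w + tree_prelie u w'"
  by (auto simp: fun_eq_iff tree_prelie_eq distrib_left distrib_right sum_mset.distrib)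

lemma tree_prelie_scale_left: "tree_prelie (scale_series c u) w = scale_series c (tree_prelie u w)"
  and tree_prelie_scale_right: "tree_prelie u (scale_series c w) = scale_series c (tree_prelie u w)"
  by (auto simp: fun_eq_iff tree_prelie_eq sum_mset_distrib_left mult_ac)

lemma tree_prelie_zero: "tree_prelie 0 w = 0" "tree_prelie u 0 = 0"
  by (auto simp: fun_eq_iff tree_prelie_eq)

lemma tree_prelie_sum_left: "tree_prelie (\<Sum>i\<in>I. u i) w = (\<Sum>i\<in>I. tree_prelie (u i) w)"
  by (induction I rule: infinite_finite_induct)
    (simp_all add: tree_prelie_zero tree_prelie_add_left del: zero_fun_apply plus_fun_apply)

lemma tree_prelie_sum_right: "tree_prelie w (\<Sum>i\<in>I. u i) = (\<Sum>i\<in>I. tree_prelie w (u i))"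
  by (induction I rule: infinite_finite_induct)
    (simp_all add: tree_prelie_zero tree_prelie_add_right del: zero_fun_apply plus_fun_apply)

lemma tree_prelie_expand:
  fixes u w :: "'l::finite tree_series"
  assumes u: "\<And>t. tree_nodes t > m \<Longrightarrow> u t = 0" and w: "\<And>t. tree_nodes t > n \<Longrightarrow> w t = 0"
  shows "tree_prelie u w = (\<Sum>b\<in>trees_upto n. scale_series (w b)
    (\<Sum>a\<in>trees_upto m. scale_series (u a) (tree_prelie (unit_series a) (unit_series b))))"
proof -
  have "u = (\<Sum>a\<in>trees_upto m. scale_series (u a) (unit_series a))"
    by (rule series_eq_sum) (use u in \<open>auto simp: finite_trees_upto\<close>)
  moreover have "w = (\<Sum>b\<in>trees_upto n. scale_series (w b) (unit_series b))"
    by (rule series_eq_sum) (use w in \<open>auto simp: finite_trees_upto\<close>)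
  ultimately have "tree_prelie u w = tree_prelie (\<Sum>a\<in>trees_upto m. scale_series (u a) (unit_series a))
      (\<Sum>b\<in>trees_upto n. scale_series (w b) (unit_series b))" by metis
  then show ?thesis
    unfolding tree_prelie_sum_left tree_prelie_sum_right tree_prelie_scale_left tree_prelie_scale_right .
qed

lemma tree_prelie_high:
  assumes "\<And>t. tree_nodes t > m \<Longrightarrow> u t = 0" "\<And>t. tree_nodes t > n \<Longrightarrow> w t = 0" "tree_nodes t > m + n"
  shows "tree_prelie u w t = 0"
proof -
  have "u (fst c) * w (snd c) = 0" if "c \<in># edge_cuts t" for c
    using edge_cuts_nodes[OF that] assms(3) assms(1)[of "fst c"] assms(2)[of "snd c"]
    by (cases "tree_nodes (fst c) > m") auto
  then show ?thesis by (auto simp: tree_prelie_eq intro!: sum_mset.neutral)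
qed

lemma tree_prelie_low:
  assumes "\<And>t. tree_nodes t < m \<Longrightarrow> u t = 0" "\<And>t. tree_nodes t < n \<Longrightarrow> w t = 0" "tree_nodes t < m + n"
  shows "tree_prelie u w t = 0"
proof -
  have "u (fst c) * w (snd c) = 0" if "c \<in># edge_cuts t" for c
    using edge_cuts_nodes[OF that] assms(3) assms(1)[of "fst c"] assms(2)[of "snd c"]
    by (cases "tree_nodes (fst c) < m") auto
  then show ?thesis by (auto simp: tree_prelie_eq intro!: sum_mset.neutral)
qed

lemma vf_prelie_tree_series_field:
  fixes f :: "'l::finite \<Rightarrow> 'e \<Rightarrow> 'e::euclidean_space"
  assumes f: "\<And>i. C_class r (f i)" and u: "\<And>t. tree_nodes t > m \<Longrightarrow> u t = 0"
    and w: "\<And>t. tree_nodes t > n \<Longrightarrow> w t = 0" and "1 \<le> m" "m + n \<le> N" "N \<le> Suc r"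
  shows "vf_prelie (tree_series_field f m u) (tree_series_field f n w) =
    tree_series_field f N (tree_prelie u w)"
proof
  fix y
  have diff: "elem_field f b differentiable at y" if "b \<in> trees_upto n" for b
    by (rule C_class_differentiable[of 1], rule C_class_elem_field[OF f]) (use assms(4-6) that in auto)
  have "vf_prelie (tree_series_field f m u) (tree_series_field f n w) y =
    (\<Sum>b\<in>trees_upto n. w b *\<^sub>R dir_deriv (tree_series_field f m u y) (elem_field f b) y)"
    unfolding vf_prelie_eq tree_series_field_def[of f n w]
    by (subst dir_deriv_sum) (use diff in \<open>auto simp: dir_deriv_scaleR\<close>)
  also have "\<dots> = (\<Sum>b\<in>trees_upto n. w b *\<^sub>R (\<Sum>a\<in>trees_upto m.
      u a *\<^sub>R tree_series_field f N (tree_prelie (unit_series a) (unit_series b)) y))"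
  proof (intro sum.cong refl arg_cong2[where f = scaleR])
    fix b :: "'l rtree" assume b: "b \<in> trees_upto n"
    have "dir_deriv (tree_series_field f m u y) (elem_field f b) y =
        (\<Sum>a\<in>trees_upto m. u a *\<^sub>R vf_prelie (elem_field f a) (elem_field f b) y)"
      unfolding vf_prelie_eq tree_series_field_def using diff[OF b]
      by (simp add: dir_deriv_sum_left dir_deriv_scaleR_left)
    also have "\<dots> = (\<Sum>a\<in>trees_upto m. u a *\<^sub>R
        tree_series_field f N (tree_prelie (unit_series a) (unit_series b)) y)"
      by (intro sum.cong refl arg_cong2[where f = scaleR] vf_prelie_elem_field[OF f])
        (use assms(5,6) b in auto)
    finally show "dir_deriv (tree_series_field f m u y) (elem_field f b) y =
      (\<Sum>a\<in>trees_upto m. u a *\<^sub>R tree_series_field f N (tree_prelie (unit_series a) (unit_series b)) y)" .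
  qed
  also have "\<dots> = tree_series_field f N (\<Sum>b\<in>trees_upto n. scale_series (w b)
      (\<Sum>a\<in>trees_upto m. scale_series (u a) (tree_prelie (unit_series a) (unit_series b)))) y"
    by (simp only: tree_series_field_sum tree_series_field_scale)
  also have "(\<Sum>b\<in>trees_upto n. scale_series (w b)
      (\<Sum>a\<in>trees_upto m. scale_series (u a) (tree_prelie (unit_series a) (unit_series b)))) = tree_prelie u w"
    by (rule tree_prelie_expand[symmetric]) (use u w in auto)
  finally show "vf_prelie (tree_series_field f m u) (tree_series_field f n w) y =
    tree_series_field f N (tree_prelie u w) y" .
qed

text \<open>Every rule of the graph respects the explicit formula, the graft rule by the pre-Lie
  morphism property; hence the graph is single-valued.\<close>

lemma branched_field_graph_eq:
  fixes f :: "'l::finite \<Rightarrow> 'e \<Rightarrow> 'e::euclidean_space"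
  assumes "branched_field_graph f n u U" "\<And>i. C_class r (f i)" "n \<le> Suc r"
  shows "1 \<le> n \<and> (\<forall>t. tree_nodes t > n \<longrightarrow> u t = 0) \<and> U = tree_series_field f n u"
  using assms(1,3)
proof (induction rule: branched_field_graph.induct)
  case (1 N i)
  have "elem_field f (bullet i) y = f i y" for y
    using elem_field_Node[of r f i "{#}" "[]" y] assms(2) by (simp add: symmetry_factor_def)
  moreover have "unit_series (bullet i) t = 0" if "tree_nodes t > N" for t
    using that 1 by (auto simp: unit_series_apply)
  ultimately show ?case using 1 by (auto simp: fun_eq_iff tree_series_field_unit)
next
  case (2 N u U w W)
  then show ?case by (simp add: fun_eq_iff tree_series_field_add del: plus_fun_apply) simp
next
  case (3 N u U c)
  then have "(\<lambda>y. c *\<^sub>R U y) = tree_series_field f N (scale_series c u)"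
    by (simp only: tree_series_field_scale[abs_def])
  moreover have "\<forall>t. tree_nodes t > N \<longrightarrow> scale_series c u t = 0" using 3 by simp
  ultimately show ?case using 3 by blast
next
  case (4 m u U n w W N)
  then have m: "1 \<le> m" "\<And>t. tree_nodes t > m \<Longrightarrow> u t = 0" "U = tree_series_field f m u"
    and n: "1 \<le> n" "\<And>t. tree_nodes t > n \<Longrightarrow> w t = 0" "W = tree_series_field f n w"
    by auto
  have "tree_prelie u w t = 0" if "tree_nodes t > N" for t
    by (rule tree_prelie_high[OF m(2) n(2)]) (use that 4 in auto)
  moreover have "vf_prelie U W = tree_series_field f N (tree_prelie u w)"
    unfolding m(3) n(3) by (rule vf_prelie_tree_series_field[OF assms(2) m(2) n(2) m(1)]) (use 4 in auto)
  ultimately show ?case using m(1) 4 by auto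
qed

lemma branched_field_graph_zero:
  assumes "1 \<le> n"
  shows "branched_field_graph f n 0 (\<lambda>y. 0 *\<^sub>R f undefined y)"
proof -
  have "branched_field_graph f n (scale_series 0 (unit_series (bullet undefined))) (\<lambda>y. 0 *\<^sub>R f undefined y)"
    by (rule branched_field_graph.intros(3)[OF branched_field_graph.intros(1)[OF assms]])
  then show ?thesis by (simp add: scale_series_def zero_fun_def)
qed

lemma branched_field_graph_mono:
  "branched_field_graph f m u U \<Longrightarrow> m \<le> n \<Longrightarrow> branched_field_graph f n u U"
proof (induction arbitrary: n rule: branched_field_graph.induct)
  case (4 m u U k w W N)
  then show ?case by (intro branched_field_graph.intros(4)[of f m u U k w W]) auto
qed (auto intro: branched_field_graph.intros)

text \<open>The degree followed by \<open>tree_generation\<close> is the bound in the graph, so the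
  grafts that build a tree never exceed its number of nodes.\<close>

lemma branched_field_graph_unit:
  fixes t :: "'l::finite rtree"
  shows "\<exists>U. branched_field_graph f (tree_nodes t) (unit_series t) U"
proof (rule tree_generation[where P = "\<lambda>n u. \<exists>U. branched_field_graph f n u U" and S = UNIV])
  show "\<exists>U. branched_field_graph f n 0 U" if "1 \<le> n" for n
    using branched_field_graph_zero[OF that] by blast
qed (blast intro: branched_field_graph.intros order_refl)+

lemma branched_field_graph_exists:
  fixes u :: "'l::finite tree_series"
  assumes "u \<in> branched_step N" "1 \<le> N"
  shows "\<exists>U. branched_field_graph f N u U"
proof -
  have sum: "\<exists>U. branched_field_graph f N (\<Sum>t\<in>A. scale_series (u t) (unit_series t)) U"
    if "A \<subseteq> trees_upto N" for A
    using that
  proof (induction A rule: infinite_finite_induct)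
    case (insert t A)
    obtain U where U: "branched_field_graph f (tree_nodes t) (unit_series t) U"
      using branched_field_graph_unit by blast
    have "branched_field_graph f N (unit_series t) U"
      by (rule branched_field_graph_mono[OF U]) (use insert in auto)
    moreover obtain W where "branched_field_graph f N (\<Sum>t\<in>A. scale_series (u t) (unit_series t)) W"
      using insert by blast
    ultimately show ?case unfolding sum.insert[OF insert(1,2)]
      by (blast intro: branched_field_graph.intros(2,3))
  qed (use branched_field_graph_zero[OF assms(2)] in \<open>auto simp del: zero_fun_apply\<close>)
  have "u = (\<Sum>t\<in>trees_upto N. scale_series (u t) (unit_series t))"
    by (rule series_eq_sum) (use assms(1) in \<open>auto simp: finite_trees_upto branched_step_def\<close>)
  then show ?thesis using sum[OF order_refl] by metis
qed

lemma branched_field_graph_branched_field: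
  fixes f :: "'l::finite \<Rightarrow> 'e \<Rightarrow> 'e::euclidean_space"
  assumes "u \<in> branched_step N" "1 \<le> N" "\<And>i. C_class r (f i)" "N \<le> Suc r"
  shows "branched_field_graph f N u (branched_field f N u)"
proof -
  obtain U where U: "branched_field_graph f N u U" using branched_field_graph_exists assms by blast
  have "(THE U. branched_field_graph f N u U) = U"
  proof (rule the_equality[where P = "branched_field_graph f N u"])
    show "W = U" if "branched_field_graph f N u W" for W
      using branched_field_graph_eq[where f = f, OF that assms(3,4)]
        branched_field_graph_eq[where f = f, OF U assms(3,4)] by simp
  qed (rule U)
  with U show ?thesis by (simp add: branched_field_def)
qed

lemma branched_field_eq:
  fixes f :: "'l::finite \<Rightarrow> 'e \<Rightarrow> 'e::euclidean_space"
  assumes "u \<in> branched_step N" "1 \<le> N" "\<And>i. C_class r (f i)" "N \<le> Suc r"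
  shows "branched_field f N u = tree_series_field f N u"
  using branched_field_graph_eq[where f = f, OF branched_field_graph_branched_field[where f = f, OF assms] assms(3,4)]
  by blast

lemma unit_series_branched_step: "tree_nodes t \<le> N \<Longrightarrow> unit_series t \<in> branched_step N"
  by (auto simp: branched_step_def unit_series_apply)

lemma branched_step_add: "u \<in> branched_step N \<Longrightarrow> w \<in> branched_step N \<Longrightarrow> u + w \<in> branched_step N"
  by (auto simp: branched_step_def)

lemma branched_field_unit:
  fixes f :: "'l::finite \<Rightarrow> 'e \<Rightarrow> 'e::euclidean_space"
  assumes "tree_nodes t \<le> n" "\<And>i. C_class r (f i)" "n \<le> Suc r"
  shows "branched_field f n (unit_series t) = elem_field f t"
proof -
  have "1 \<le> n" using assms(1) tree_nodes_pos[of t] by linarith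
  from branched_field_eq[where f = f, OF unit_series_branched_step[OF assms(1)] this assms(2,3)]
  show ?thesis using tree_series_field_unit[OF assms(1), of f] by (metis ext)
qed

section \<open>Translation of forest series\<close>

lemma forest_of_tree_series_unit: "forest_of_tree_series (unit_series t) = unit_series {#t#}"
proof
  fix F :: "'a forest"
  show "forest_of_tree_series (unit_series t) F = unit_series {#t#} F"
  proof (cases "size F = 1")
    case True
    then obtain s where "F = {#s#}" using size_1_singleton_mset by blast
    then show ?thesis by (simp add: unit_series_apply)
  next
    case False
    then show ?thesis by (auto simp: unit_series_apply forest_of_tree_series_other)
  qed
qed

lemma forest_of_tree_series_linear:
  "forest_of_tree_series (x + y) = forest_of_tree_series x + forest_of_tree_series y"
  "forest_of_tree_series (scale_series c x) = scale_series c (forest_of_tree_series x)"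
  by (auto simp: fun_eq_iff forest_of_tree_series_def)

lemma forest_of_tree_series_inject: "forest_of_tree_series x = forest_of_tree_series y \<Longrightarrow> x = y"
  by (metis ext forest_of_tree_series_simps(2))

context
  fixes v :: "'l::{finite, zero} \<Rightarrow> 'l tree_series" and M m N
  assumes M: "continuous_on UNIV M" "linear_series M" "M (unit_series {#}) = unit_series {#}"
      "\<And>x y. M (star_prod x y) = star_prod (M x) (M y)"
    and m: "\<And>x. M (forest_of_tree_series x) = forest_of_tree_series (m x)"
      "\<And>x y. m (tree_prelie x y) = tree_prelie (m x) (m y)"
      "\<And>i. m (unit_series (bullet i)) = unit_series (bullet i) + v i"
    and v: "\<And>i. v i \<in> branched_step N" and N: "1 \<le> N"
begin

lemma tree_translation_linear: "linear_series m"
  unfolding linear_series_def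
proof (intro conjI allI)
  show "m (x + y) = m x + m y" for x y
    by (rule forest_of_tree_series_inject)
      (simp only: m(1)[symmetric] forest_of_tree_series_linear linear_series_add[OF M(2)])
  show "m (scale_series c x) = scale_series c (m x)" for c x
    by (rule forest_of_tree_series_inject)
      (simp only: m(1)[symmetric] forest_of_tree_series_linear linear_series_scale[OF M(2)])
qed

lemma translation_unit_singleton: "M (unit_series {#t#}) = forest_of_tree_series (m (unit_series t))"
  by (simp only: m(1)[symmetric] forest_of_tree_series_unit)

section \<open>Images of forests with several trees\<close>

text \<open>The part of the star product in which \<open>a\<close> is grafted onto a node of
  \<open>G\<close>; it keeps the number of trees.\<close>

definition graft_rest :: "'l rtree \<Rightarrow> 'l forest \<Rightarrow> 'l forest_series" where
  "graft_rest a G = (\<lambda>H. \<Sum>t\<in>#H. \<Sum>c\<in>#edge_cuts t.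
     if fst c = a \<and> add_mset (snd c) (H - {#t#}) = G then 1 else 0)"

lemma star_prod_units:
  "star_prod (unit_series {#a#}) (unit_series G) =
    scale_series (real (Suc (count G a))) (unit_series (add_mset a G)) + graft_rest a G"
proof
  fix H
  have "star_prod (unit_series {#a#}) (unit_series G) H =
      (\<Sum>t\<in>#H. (if t = a \<and> H - {#t#} = G then 1 else 0)) + graft_rest a G H"
    unfolding forest_of_tree_series_unit[symmetric] star_prod_tree_series sum_mset.distrib graft_rest_def
    by (intro arg_cong2[where f = "(+)"] arg_cong[where f = sum_mset] image_mset_cong)
      (auto simp: unit_series_apply)
  also have "(\<Sum>t\<in>#H. (if t = a \<and> H - {#t#} = G then 1 else 0)) =
      real (Suc (count G a)) * unit_series (add_mset a G) H"
  proof (cases "H = add_mset a G")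
    case True
    have "(\<Sum>t\<in>#H. (if t = a \<and> H - {#t#} = G then 1 else 0 :: real)) =
        (\<Sum>t\<in>set_mset H. if t = a then real (count H a) else 0)"
      unfolding sum_mset_count by (rule sum.cong) (use True in auto)
    then show ?thesis using True by (simp add: unit_series_apply)
  next
    case False
    have "(\<Sum>t\<in>#H. (if t = a \<and> H - {#t#} = G then 1 else 0 :: real)) = (\<Sum>t\<in>#H. 0)"
      using False by (intro arg_cong[where f = sum_mset] image_mset_cong) (auto simp: insert_DiffM)
    then show ?thesis using False by (auto simp: unit_series_apply)
  qed
  finally show "star_prod (unit_series {#a#}) (unit_series G) H =
    (scale_series (real (Suc (count G a))) (unit_series (add_mset a G)) + graft_rest a G) H" by simp
qed

lemma graft_rest_nonzero:
  assumes "graft_rest a G H \<noteq> 0"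
  shows "size H = size G \<and> forest_nodes H = tree_nodes a + forest_nodes G"
proof -
  have "\<exists>t\<in>#H. \<exists>c\<in>#edge_cuts t. fst c = a \<and> add_mset (snd c) (H - {#t#}) = G"
  proof (rule ccontr)
    assume "\<not> ?thesis"
    then have "graft_rest a G H = (\<Sum>t\<in>#H. \<Sum>c\<in>#edge_cuts t. 0)"
      unfolding graft_rest_def
      by (intro arg_cong[where f = sum_mset] image_mset_cong) auto
    then show False using assms by simp
  qed
  then obtain t c where t: "t \<in># H" and c: "c \<in># edge_cuts t" "fst c = a" "add_mset (snd c) (H - {#t#}) = G"
    by blast
  obtain K where "H = add_mset t K" using t by (metis insert_DiffM)
  then show ?thesis using c edge_cuts_nodes[OF c(1)] by auto
qed

lemma graft_rest_singleton: "graft_rest a {#b#} = forest_of_tree_series (tree_prelie (unit_series a) (unit_series b))"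
proof
  fix H
  show "graft_rest a {#b#} H = forest_of_tree_series (tree_prelie (unit_series a) (unit_series b)) H"
  proof (cases "size H = 1")
    case True
    then obtain t where "H = {#t#}" using size_1_singleton_mset by blast
    then show ?thesis
      by (auto simp: graft_rest_def tree_prelie_eq unit_series_apply
          intro!: arg_cong[where f = sum_mset] image_mset_cong)
  next
    case False
    then show ?thesis using graft_rest_nonzero[of a "{#b#}" H] by (auto simp: forest_of_tree_series_other)
  qed
qed

text \<open>Applies \<open>M\<close> to \<open>star_prod_units\<close> and solves for the larger
  forest. The remainder has one tree fewer, which allows induction on the number of trees.\<close>

lemma translation_unit_add_mset:
  "scale_series (real (Suc (count G a))) (M (unit_series (add_mset a G))) =
    star_prod (forest_of_tree_series (m (unit_series a))) (M (unit_series G)) - M (graft_rest a G)"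
proof -
  have "M (star_prod (unit_series {#a#}) (unit_series G)) =
      scale_series (real (Suc (count G a))) (M (unit_series (add_mset a G))) + M (graft_rest a G)"
    unfolding star_prod_units by (simp only: linear_series_add[OF M(2)] linear_series_scale[OF M(2)])
  then show ?thesis unfolding M(4) translation_unit_singleton
    by (simp add: algebra_simps)
qed

lemma translation_graft_rest:
  assumes "\<And>H. size H = size G \<Longrightarrow> M (unit_series H) K = 0"
  shows "M (graft_rest a G) K = 0"
proof -
  have "M (graft_rest a G) K = (\<Sum>H\<in>{H. forest_nodes H \<le> tree_nodes a + forest_nodes G}.
      graft_rest a G H * M (unit_series H) K)"
    by (rule linear_series_finite[OF M(2) finite_forests_upto]) (use graft_rest_nonzero[of a G] in fastforce)
  also have "\<dots> = 0"
    by (rule sum.neutral) (use graft_rest_nonzero[of a G] assms in fastforce)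
  finally show ?thesis .
qed

text \<open>
  \<open>M\<close> is also multiplicative for the product of forests, so forests with at least two trees have no
  component along single trees.
\<close>

lemma translation_unit_forest:
  assumes "2 \<le> size F"
  shows "M (unit_series F) {#} = 0 \<and> (\<forall>t. M (unit_series F) {#t#} = 0)"
  using assms
proof (induction "size F" arbitrary: F rule: less_induct)
  case less
  then obtain a G where F: "F = add_mset a G" by (cases F) auto
  let ?c = "real (Suc (count G a))"
  have eq: "?c * M (unit_series F) K =
      star_prod (forest_of_tree_series (m (unit_series a))) (M (unit_series G)) K - M (graft_rest a G) K" for K
    using fun_cong[OF translation_unit_add_mset[of G a], of K] by (simp add: F)
  have "?c * M (unit_series F) {#} = 0 \<and> (\<forall>t. ?c * M (unit_series F) {#t#} = 0)"
  proof (cases "size G = 1")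
    case True
    then obtain b where G: "G = {#b#}" using size_1_singleton_mset by blast
    \<comment> \<open>With two trees the remainder is a pre-Lie product, which \<open>m\<close>
      preserves; its image cancels the single-tree part of the star product exactly.\<close>
    have "M (graft_rest a G) = forest_of_tree_series (tree_prelie (m (unit_series a)) (m (unit_series b)))"
      unfolding G graft_rest_singleton m ..
    then show ?thesis
      unfolding eq unfolding G translation_unit_singleton by (simp add: star_prod_empty star_prod_tree_series_singleton)
  next
    case False
    \<comment> \<open>The remainder consists of forests with as many trees as \<open>G\<close>, at
      least two, so the induction hypothesis covers it.\<close>
    then have IH: "M (unit_series H) {#} = 0 \<and> (\<forall>t. M (unit_series H) {#t#} = 0)" if "size H = size G" for H
      using less that by (auto simp: F)
    then have "M (graft_rest a G) {#} = 0" "M (graft_rest a G) {#t#} = 0" for t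
      by (auto intro!: translation_graft_rest)
    then show ?thesis
      unfolding eq using IH[of G] by (simp add: star_prod_empty star_prod_tree_series_singleton tree_prelie_eq)
  qed
  then show ?case by (simp del: of_nat_Suc)
qed

text \<open>Every tree has a node, so \<open>v i\<close> starts in degree one like the node it is
  added to, and pre-Lie products add degrees.\<close>

lemma tree_translation_low: "tree_nodes s < tree_nodes t \<Longrightarrow> m (unit_series t) s = 0"
proof -
  have "\<forall>s. tree_nodes s < tree_nodes t \<longrightarrow> m (unit_series t) s = 0"
  proof (rule tree_generation[where P = "\<lambda>n u. \<forall>s. tree_nodes s < n \<longrightarrow> m u s = 0" and S = UNIV])
    show "\<forall>s. tree_nodes s < k + n \<longrightarrow> m (tree_prelie u w) s = 0"
      if "\<forall>s. tree_nodes s < k \<longrightarrow> m u s = 0" "\<forall>s. tree_nodes s < n \<longrightarrow> m w s = 0" for k n u w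
      unfolding m(2) using that by (auto intro: tree_prelie_low)
    show "\<forall>s. tree_nodes s < 1 \<longrightarrow> m (unit_series (bullet i)) s = 0" for i
      using tree_nodes_pos by (metis less_one less_irrefl)
  qed (auto simp: linear_series_zero[OF tree_translation_linear] linear_series_add[OF tree_translation_linear]
      linear_series_scale[OF tree_translation_linear])
  then show "tree_nodes s < tree_nodes t \<Longrightarrow> m (unit_series t) s = 0" by blast
qed

text \<open>Forests with several trees have no single-tree component, and a tree only has components
  with at least as many nodes; by continuity a finite sum over trees remains.\<close>

lemma branched_translation_apply:
  assumes "tree_nodes s \<le> n"
  shows "M x {#s#} = (\<Sum>t\<in>trees_upto n. x {#t#} * m (unit_series t) s)"
proof -
  have single: "M (unit_series F) {#s#} = 0" if "size F \<noteq> 1" for F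
    using that translation_unit_forest[of F] M(3)
    by (cases "F = {#}") (auto simp: unit_series_apply numeral_2_eq_2 Suc_le_eq nonempty_has_size less_Suc_eq)
  have "M x {#s#} = (\<Sum>F | forest_nodes F \<le> n. x F * M (unit_series F) {#s#})"
  proof (rule continuous_linear_series_eq[OF M(1,2) finite_forests_upto])
    fix F :: "'l forest" assume F: "n < forest_nodes F"
    show "M (unit_series F) {#s#} = 0"
    proof (cases "size F = 1")
      case True
      then obtain t where "F = {#t#}" using size_1_singleton_mset by blast
      then show ?thesis
        using F assms tree_translation_low[of s t] by (simp add: translation_unit_singleton)
    qed (rule single)
  qed
  also have "\<dots> = (\<Sum>t\<in>trees_upto n. x {#t#} * M (unit_series {#t#}) {#s#})"
  proof -
    have "(\<Sum>F | forest_nodes F \<le> n. x F * M (unit_series F) {#s#}) =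
        (\<Sum>F\<in>(\<lambda>t. {#t#}) ` trees_upto n. x F * M (unit_series F) {#s#})"
    proof (rule sum.mono_neutral_right[OF finite_forests_upto])
      show "\<forall>F\<in>{F. forest_nodes F \<le> n} - (\<lambda>t. {#t#}) ` trees_upto n. x F * M (unit_series F) {#s#} = 0"
      proof
        fix F :: "'l forest" assume F: "F \<in> {F. forest_nodes F \<le> n} - (\<lambda>t. {#t#}) ` trees_upto n"
        have "size F \<noteq> 1"
        proof
          assume "size F = 1"
          then obtain t where "F = {#t#}" using size_1_singleton_mset by blast
          with F show False by auto
        qed
        then have "M (unit_series F) {#s#} = 0" by (rule single)
        then show "x F * M (unit_series F) {#s#} = 0" by simp
      qed
    qed auto
    then show ?thesis by (simp add: sum.reindex inj_on_def)
  qed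
  finally show ?thesis by (simp add: translation_unit_singleton)
qed

section \<open>Fields of translated trees\<close>

text \<open>A derivation over \<open>fv\<close> is replayed over \<open>f\<close>: nodes become
  their translations and grafts become grafts of images. The field \<open>U\<close> itself is
  unchanged, so no differential of \<open>fv\<close> has to be computed.\<close>

lemma branched_field_graph_translation:
  assumes "branched_field_graph fv n u U" "\<And>i. C_class r (f i)" "N \<le> Suc r"
    and fv: "\<And>i. fv i = branched_field f N (unit_series (bullet i) + v i)"
  shows "branched_field_graph f (N * n) (m u) U"
  using assms(1)
proof (induction rule: branched_field_graph.induct)
  case (1 n i)
  have "unit_series (bullet i) + v i \<in> branched_step N"
    using N by (intro branched_step_add unit_series_branched_step v) simp
  then have "branched_field_graph f N (unit_series (bullet i) + v i) (fv i)"
    unfolding fv by (rule branched_field_graph_branched_field[OF _ N assms(2,3)])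
  then show ?case unfolding m(3) by (rule branched_field_graph_mono) (use 1 in simp)
next
  case (2 n u U w W)
  then show ?case
    by (simp only: linear_series_add[OF tree_translation_linear]) (rule branched_field_graph.intros(2))
next
  case (3 n u U c)
  then show ?case
    by (simp only: linear_series_scale[OF tree_translation_linear]) (rule branched_field_graph.intros(3))
next
  case (4 k u U n w W l)
  have "N * k + N * n \<le> N * l" using mult_le_mono2[of "k + n" l N] 4 by (simp add: add_mult_distrib2)
  with 4 show ?case unfolding m(2) by (intro branched_field_graph.intros(4)[of f "N * k" "m u" U "N * n"])
qed

text \<open>One field \<open>U\<close> is a value of the graph of \<open>fv\<close> at
  \<open>t\<close> and of the graph of \<open>f\<close> at the translated tree; the explicit formula
  on each side gives the identity.\<close>

lemma elem_field_translation:
  assumes "\<And>i. C_class r (f i)" "N * tree_nodes t \<le> Suc r"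
    and fv: "\<And>i. fv i = branched_field f N (unit_series (bullet i) + v i)"
  shows "elem_field fv t = tree_series_field f (N * tree_nodes t) (m (unit_series t)) \<and>
    (\<forall>s. tree_nodes s > N * tree_nodes t \<longrightarrow> m (unit_series t) s = 0)"
proof -
  have t: "1 \<le> tree_nodes t" using tree_nodes_pos[of t] by simp
  then have "N * 1 \<le> N * tree_nodes t" by (rule mult_le_mono2)
  then have N': "N \<le> Suc r" using assms(2) by linarith
  have C_class_translated_field: "C_class (Suc r - N) (fv i)" for i
  proof -
    have "unit_series (bullet i) + v i \<in> branched_step N"
      using N by (intro branched_step_add unit_series_branched_step v) simp
    from branched_field_eq[where f = f, OF this N assms(1) N'] show ?thesis
      unfolding fv using C_class_tree_series_field[of r f "Suc r - N" N, OF assms(1)] N' by simp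
  qed
  \<comment> \<open>\<open>fv\<close> is of class \<open>Suc r - N\<close>; this suffices for a tree
    with \<open>k\<close> nodes because \<open>k - 1 \<le> N * (k - 1)\<close>.\<close>
  have "tree_nodes t \<le> Suc (Suc r - N)"
  proof -
    have "tree_nodes t - 1 \<le> N * (tree_nodes t - 1)" using N by simp
    also have "\<dots> = N * tree_nodes t - N" by (simp add: diff_mult_distrib2)
    also have "\<dots> \<le> Suc r - N" using assms(2) by simp
    finally show ?thesis by simp
  qed
  note unit = branched_field_graph_eq[where f = fv, OF _ C_class_translated_field this]
  obtain U where U: "branched_field_graph fv (tree_nodes t) (unit_series t) U"
    using branched_field_graph_unit by blast
  have "U = elem_field fv t"
    using unit[OF U] tree_series_field_unit[of t "tree_nodes t" fv] by (metis ext order_refl)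
  then show ?thesis
    using branched_field_graph_eq[where f = f, OF branched_field_graph_translation[OF U assms(1) N' fv] assms(1,2)]
    by simp
qed

text \<open>\<open>m\<close> is known only on nodes and products, so fixed points are obtained by
  generating trees from nodes with nonzero label.\<close>

lemma tree_translation_no_zero:
  assumes "\<And>i. i \<noteq> 0 \<Longrightarrow> v i = 0" "0 \<notin> set_rtree t"
  shows "m (unit_series t) = unit_series t"
proof (rule tree_generation[where P = "\<lambda>n u. m u = u" and S = "- {0}"])
  show "set_rtree t \<subseteq> - {0}" using assms(2) by auto
  show "m (unit_series (bullet i)) = unit_series (bullet i)" if "i \<in> - {0}" for i
    using assms(1)[of i] that m(3)[of i] by (simp only: add_0_right) auto
  show "m 0 = 0" by (rule linear_series_zero[OF tree_translation_linear])
  show "m (u + w) = u + w" if "m u = u" "m w = w" for u w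
    using that by (simp only: linear_series_add[OF tree_translation_linear])
  show "m (scale_series c u) = scale_series c u" if "m u = u" for c u
    using that by (simp only: linear_series_scale[OF tree_translation_linear])
  show "m (tree_prelie u w) = tree_prelie u w" if "m u = u" "m w = w" for u w
    using that by (simp only: m(2))
qed

lemma branched_expansion_translation:
  fixes f :: "'l \<Rightarrow> 'e \<Rightarrow> 'e::euclidean_space"
  assumes "\<And>i. C_class r (f i)" "level \<alpha> \<le> Suc r"
  shows "branched_expansion \<alpha> f (M x) y = y + (\<Sum>t\<in>trees_upto (level \<alpha>).
    x {#t#} *\<^sub>R tree_series_field f (level \<alpha>) (m (unit_series t)) y)"
proof -
  let ?W = "trees_upto (level \<alpha>) :: 'l rtree set"
  have "(\<Sum>t\<in>?W. M x {#t#} *\<^sub>R branched_field f (level \<alpha>) (unit_series t) y) =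
      (\<Sum>s\<in>?W. \<Sum>t\<in>?W. (x {#t#} * m (unit_series t) s) *\<^sub>R elem_field f s y)"
  proof (rule sum.cong[OF refl])
    fix s :: "'l rtree" assume "s \<in> ?W"
    then show "M x {#s#} *\<^sub>R branched_field f (level \<alpha>) (unit_series s) y =
        (\<Sum>t\<in>?W. (x {#t#} * m (unit_series t) s) *\<^sub>R elem_field f s y)"
      using branched_translation_apply[of s "level \<alpha>" x]
        branched_field_unit[of s "level \<alpha>" r f, OF _ assms]
      by (simp add: scaleR_sum_left)
  qed
  also have "\<dots> = (\<Sum>t\<in>?W. \<Sum>s\<in>?W. (x {#t#} * m (unit_series t) s) *\<^sub>R elem_field f s y)"
    by (rule sum.swap)
  finally show ?thesis
    by (simp add: branched_expansion_def tree_series_field_def scaleR_sum_right)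
qed

end

section \<open>Solution flows driven by translated branched rough paths\<close>

context
  fixes T \<alpha> :: real and X :: "real \<Rightarrow> real \<Rightarrow> 'l forest_series"
  assumes X: "branched_rough_path T \<alpha> X"
begin

lemma branched_mult:
  assumes "s \<in> {0..T}" "t \<in> {0..T}"
  shows "X s t (F + G) = X s t F * X s t G"
  using X assms unfolding branched_rough_path_def by blast

lemma branched_chen:
  assumes "s \<in> {0..T}" "u \<in> {0..T}" "t \<in> {0..T}"
  shows "X s t = star_prod (X s u) (X u t)"
  using X assms unfolding branched_rough_path_def by blast

text \<open>If the empty forest has value one, the series at equal times is a trivial character
  below the size of \<open>t\<close>, and \<open>star_prod_tree\<close> leaves
  \<open>x = x + x\<close> for the value \<open>x\<close> at \<open>t\<close>. Otherwise the empty
  forest has value 0, and multiplicativity makes \<open>x\<close> vanish.\<close>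

lemma branched_diagonal:
  assumes s: "s \<in> {0..T}"
  shows "X s s {#t#} = 0"
proof (cases "X s s {#} = 1")
  case True
  show ?thesis
  proof (induction "tree_nodes t" arbitrary: t rule: less_induct)
    case less
    obtain i F where t: "t = Node i F" by (cases t)
    have "star_prod (X s s) (\<lambda>G. X s s {#Node i G#}) F = X s s {#Node i F#}"
    proof (rule star_prod_character_trivial[where n = "forest_nodes F"])
      show "X s s {#u#} = 0" if "tree_nodes u \<le> forest_nodes F" for u
        by (rule less) (use that t in simp)
    qed (use True branched_mult[OF s s] in auto)
    moreover have "X s s {#t#} = star_prod (X s s) (X s s) {#t#}"
      using fun_cong[OF branched_chen[OF s s s]] .
    ultimately show ?case by (simp add: t star_prod_tree True)
  qed
next
  case False
  have "X s s {#} = X s s {#} * X s s {#}" using branched_mult[OF s s, of "{#}" "{#}"] by simp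
  with False have "X s s {#} = 0" by (metis mult_cancel_left1)
  then show ?thesis using branched_mult[OF s s, of "{#}" "{#t#}"] by simp
qed

lemma branched_increment:
  assumes "s \<in> {0..T}" "t \<in> {0..T}"
  shows "X 0 t {#bullet i#} - X 0 s {#bullet i#} = X s t {#bullet i#}"
proof -
  have 0: "0 \<in> {0..T}" using assms by auto
  note chen = fun_cong[OF branched_chen]
  show ?thesis
  proof (rule chen_increment[where S = "{0..T}" and n = "\<lambda>a b. X a b {#}", OF _ _ _ 0 assms])
    fix a b c assume S: "a \<in> {0..T}" "b \<in> {0..T}" "c \<in> {0..T}"
    show "X a b {#} = X a c {#} * X c b {#}"
      "X a b {#bullet i#} = X a c {#} * X c b {#bullet i#} + X a c {#bullet i#} * X c b {#}"
      using chen[OF S(1,3,2)] by (simp_all add: star_prod_tree star_prod_empty)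
  qed (metis add_0 branched_mult)
qed

lemma branched_large_trees:
  assumes "0 < \<alpha>" "level \<alpha> < tree_nodes t"
  shows "higher_order T (\<lambda>s u. X s u {#t#})"
proof (rule higher_order_long[OF assms])
  have "\<exists>C. \<forall>s\<in>{0..T}. \<forall>u\<in>{0..T}. s \<noteq> u \<longrightarrow>
      \<bar>X s u {#t#}\<bar> / \<bar>u - s\<bar> powr (\<alpha> * real (forest_nodes {#t#})) \<le> C"
    using X unfolding branched_rough_path_def by blast
  then show "\<exists>C. \<forall>s\<in>{0..T}. \<forall>u\<in>{0..T}. s \<noteq> u \<longrightarrow>
      \<bar>X s u {#t#}\<bar> / \<bar>u - s\<bar> powr (\<alpha> * real (tree_nodes t)) \<le> C" by simp
qed (use branched_diagonal in auto)

end

lemma tree_label_count_pos: "0 \<in> set_rtree t \<Longrightarrow> 0 < tree_label_count 0 t"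
proof (induction t)
  case (Node i F)
  show ?case
  proof (cases "i = 0")
    case False
    then obtain t where t: "t \<in># F" "0 \<in> set_rtree t" using Node.prems by auto
    obtain G where "F = add_mset t G" using t by (metis insert_DiffM)
    then show ?thesis using Node.IH[OF t] by simp
  qed simp
qed

context
  fixes T \<alpha> :: real and N and X :: "real \<Rightarrow> real \<Rightarrow> 'l::{finite, zero} forest_series"
    and v :: "'l \<Rightarrow> 'l tree_series" and M m and f fv :: "'l \<Rightarrow> 'e \<Rightarrow> 'e::euclidean_space"
    and Y :: "real \<Rightarrow> real \<Rightarrow> 'e \<Rightarrow> 'e"
  assumes \<alpha>: "0 < \<alpha>" "\<alpha> \<le> 1" and N: "1 \<le> N"
    and X: "branched_rough_path T \<alpha> X"
    and v: "\<And>i. v i \<in> branched_step N"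
    and M: "continuous_on UNIV M" "linear_series M" "M (unit_series {#}) = unit_series {#}"
      "\<And>x y. M (star_prod x y) = star_prod (M x) (M y)"
    and m: "\<And>x. M (forest_of_tree_series x) = forest_of_tree_series (m x)"
      "\<And>x y. m (tree_prelie x y) = tree_prelie (m x) (m y)"
      "\<And>i. m (unit_series (bullet i)) = unit_series (bullet i) + v i"
    and fv: "\<And>i. fv i = branched_field f N (unit_series (bullet i) + v i)"
begin

lemmas translation = M m v N

lemma unit_bullet_step: "unit_series (bullet i) + v i \<in> branched_step N"
  using N by (intro branched_step_add unit_series_branched_step v) simp

lemma C_class_translated_field:
  assumes "\<And>i. C_class r (f i)" "N \<le> Suc r"
  shows "C_class (Suc r - N) (fv i)"
  unfolding fv branched_field_eq[where f = f, OF unit_bullet_step N assms]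
  by (rule C_class_tree_series_field[where f = f, OF assms(1)]) (use assms(2) in simp)

text \<open>The counterpart of \<open>geometric_translation_expansion\<close>. Coefficients of
  forests with several trees do not enter, and the initial value is carried along unchanged.\<close>

lemma branched_expansion_agree:
  assumes f: "\<And>i. C_class r (f i)" "level \<beta> \<le> Suc r"
    and "level \<alpha> \<le> level \<beta>"
    and "\<And>t. tree_nodes t \<le> level \<beta> \<Longrightarrow>
      tree_nodes t \<le> level \<alpha> \<and> tree_series_field f (level \<beta>) (m (unit_series t)) = h t \<or>
      higher_order T (\<lambda>s u. X s u {#t#}) \<and> (tree_nodes t \<le> level \<alpha> \<longrightarrow> continuous_on UNIV (h t))"
  shows "has_local_expansion T (\<lambda>s u. branched_expansion \<beta> f (M (X s u)))
    (\<lambda>s u y. y + (\<Sum>t\<in>trees_upto (level \<alpha>). X s u {#t#} *\<^sub>R h t y))"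
proof -
  let ?M = "level \<beta>" and ?L = "level \<alpha>"
  have cont: "continuous_on UNIV (tree_series_field f ?M u)" for u
    by (rule C_class_continuous[where n = 0], rule C_class_tree_series_field[where f = f, OF f(1)]) (use f(2) in simp)
  have "(\<Sum>t\<in>trees_upto ?L. X s u {#t#} *\<^sub>R h t y) =
      (\<Sum>t\<in>trees_upto ?M. X s u {#t#} *\<^sub>R (if tree_nodes t \<le> ?L then h t y else 0))" for s u y
    by (rule sum.mono_neutral_cong_left) (use assms(3) in \<open>auto simp: finite_trees_upto\<close>)
  moreover have "has_local_expansion T
      (\<lambda>s u y. \<Sum>t\<in>trees_upto ?M. X s u {#t#} *\<^sub>R tree_series_field f ?M (m (unit_series t)) y)
      (\<lambda>s u y. \<Sum>t\<in>trees_upto ?M. X s u {#t#} *\<^sub>R (if tree_nodes t \<le> ?L then h t y else 0))"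
  proof (rule has_local_expansion_sum_agree[where X = "\<lambda>s u t. X s u {#t#}"])
    fix t :: "'l rtree" assume "t \<in> trees_upto ?M"
    then show "(\<forall>y. tree_series_field f ?M (m (unit_series t)) y = (if tree_nodes t \<le> ?L then h t y else 0)) \<or>
      higher_order T (\<lambda>s u. X s u {#t#}) \<and> continuous_on UNIV (tree_series_field f ?M (m (unit_series t))) \<and>
      continuous_on UNIV (\<lambda>y. if tree_nodes t \<le> ?L then h t y else 0)"
      using assms(4)[of t] cont by force
  qed
  moreover have "(\<lambda>s u. branched_expansion \<beta> f (M (X s u))) = (\<lambda>s u y. y +
      (\<Sum>t\<in>trees_upto ?M. X s u {#t#} *\<^sub>R tree_series_field f ?M (m (unit_series t)) y))"
    by (rule ext)+ (rule branched_expansion_translation[OF translation f])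
  ultimately show ?thesis using has_local_expansion_add[OF has_local_expansion_zero[where A = "\<lambda>s u y. y"]] by simp
qed

lemma branched_expansion_elem_field:
  fixes g :: "'l \<Rightarrow> 'e \<Rightarrow> 'e"
  assumes "\<And>i. C_class r (g i)" "level \<alpha> \<le> Suc r"
  shows "branched_expansion \<alpha> g x =
    (\<lambda>y. y + (\<Sum>t\<in>trees_upto (level \<alpha>). x {#t#} *\<^sub>R elem_field g t y))"
  unfolding branched_expansion_def
  using branched_field_unit[where f = g, OF _ assms] by (auto intro!: sum.cong ext)

lemma branched_translation_i:
  assumes f: "\<And>i. C_class (nat \<lfloor>real N / \<alpha>\<rfloor> - 1) (f i)"
  shows "branched_solution_flow T (\<alpha> / real N) f (\<lambda>s t. M (X s t)) Y \<longleftrightarrow>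
    branched_solution_flow T \<alpha> fv X Y"
proof -
  let ?M = "nat \<lfloor>real N / \<alpha>\<rfloor>" and ?L = "level \<alpha>"
  have M: "nat \<lfloor>1 / (\<alpha> / real N)\<rfloor> = ?M" using N by simp
  have NL: "N * ?L \<le> ?M" using mult_nat_floor_le \<alpha> by blast
  have "N * 1 \<le> N * ?L" using nat_floor_inverse_pos[OF \<alpha>] by (rule mult_le_mono2)
  moreover have "1 * ?L \<le> N * ?L" using N by (rule mult_le_mono1)
  ultimately have L: "1 \<le> ?L" "?L \<le> N * ?L" "N \<le> ?M" "N \<le> Suc (?M - 1)" using nat_floor_inverse_pos[OF \<alpha>] NL by (simp_all only: mult_1 mult_1_right)
  \<comment> \<open>Of the derivatives of \<open>f\<close>, \<open>N - 1\<close> are spent on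
    \<open>fv\<close>; the rest suffices for trees with \<open>?L\<close> nodes because
    \<open>N * ?L \<le> ?M\<close>.\<close>
  have "?L \<le> Suc (Suc (?M - 1) - N)"
  proof -
    have "?L - 1 \<le> N * (?L - 1)" using N by simp
    also have "\<dots> = N * ?L - N" by (simp add: diff_mult_distrib2)
    also have "\<dots> \<le> Suc (?M - 1) - N" using NL by simp
    finally show ?thesis by simp
  qed
  note exp = branched_expansion_elem_field[where g = fv, OF C_class_translated_field[OF f L(4)] this]
  have "has_local_expansion T (\<lambda>s t. branched_expansion (\<alpha> / real N) f (M (X s t)))
    (\<lambda>s u y. y + (\<Sum>t\<in>trees_upto ?L. X s u {#t#} *\<^sub>R elem_field fv t y))"
  proof (rule branched_expansion_agree[OF f], unfold M)
    show "?L \<le> ?M" "?M \<le> Suc (?M - 1)" using NL L by linarith+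
    fix t :: "'l rtree"
    show "tree_nodes t \<le> ?L \<and> tree_series_field f ?M (m (unit_series t)) = elem_field fv t \<or>
      higher_order T (\<lambda>s u. X s u {#t#}) \<and> (tree_nodes t \<le> ?L \<longrightarrow> continuous_on UNIV (elem_field fv t))"
    proof (cases "tree_nodes t \<le> ?L")
      case True
      then have "N * tree_nodes t \<le> N * ?L" by (rule mult_le_mono2)
      then have le: "N * tree_nodes t \<le> ?M" "N * tree_nodes t \<le> Suc (?M - 1)" using NL by linarith+
      note * = elem_field_translation[OF translation f le(2) fv]
      have "tree_series_field f (N * tree_nodes t) (m (unit_series t)) =
          tree_series_field f ?M (m (unit_series t))"
        by (rule tree_series_field_extend) (use * le(1) in auto)
      then show ?thesis using * True by simp
    next
      case False
      then show ?thesis using branched_large_trees[OF X \<alpha>(1), of t] by auto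
    qed
  qed
  then have "has_local_expansion T (\<lambda>s t. branched_expansion (\<alpha> / real N) f (M (X s t)))
    (\<lambda>s t. branched_expansion \<alpha> fv (X s t))"
    unfolding exp .
  then show ?thesis
    by (simp add: branched_solution_flow_def has_local_expansion_cong_right)
qed

section \<open>Translation of the zeroth label only, branched case\<close>

context
  assumes f: "\<And>i. C_class (level \<alpha> + N - 2) (f i)"
    and v0: "\<And>i. i \<noteq> 0 \<Longrightarrow> v i = 0"
    and reg: "zeroth_regular forest_nodes (forest_label_count 0) T \<alpha> X"
begin

lemma step_le: "N \<le> Suc (level \<alpha> + N - 2)"
  and level_le: "level \<alpha> \<le> Suc (level \<alpha> + N - 2)"
  and level_le_diff: "level \<alpha> \<le> Suc (Suc (level \<alpha> + N - 2) - N)"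
  using nat_floor_inverse_pos[OF \<alpha>] N by auto

lemma branched_field_eq':
  assumes "u \<in> branched_step N"
  shows "branched_field f N u = tree_series_field f N u"
  by (rule branched_field_eq[OF assms N f step_le])

lemma elem_field_bullet: "elem_field g (bullet i) y = g i y"
  by (simp add: elem_field.simps symmetry_factor_def nabla_mset_def)

lemma translated_field_nonzero:
  assumes "i \<noteq> 0"
  shows "fv i = f i"
proof
  fix y
  have "fv i y = tree_series_field f N (unit_series (bullet i)) y"
    using branched_field_eq'[OF unit_bullet_step[of i]] v0[OF assms] by (simp only: fv add_0_right)
  also have "\<dots> = elem_field f (bullet i) y"
    using N by (intro tree_series_field_unit) simp
  finally show "fv i y = f i y" by (simp only: elem_field_bullet)
qed

lemma elem_field_no_zero: "0 \<notin> set_rtree t \<Longrightarrow> elem_field fv t = elem_field f t"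
proof (induction t)
  case (Node i F)
  then have "image_mset (elem_field fv) F = image_mset (elem_field f) F"
    by (intro image_mset_cong) auto
  moreover have "fv i = f i" using Node.prems by (intro translated_field_nonzero) auto
  ultimately show ?case by (simp only: elem_field.simps)
qed

lemma singular_trees:
  assumes "tree_nodes t \<le> level \<alpha>" "0 \<in> set_rtree t" "t \<noteq> bullet 0"
  shows "higher_order T (\<lambda>s u. X s u {#t#})"
proof (rule higher_order_zeroth[OF \<alpha> reg])
  obtain i F where t: "t = Node i F" by (cases t)
  have "F \<noteq> {#}" using assms(2,3) t by auto
  then have "1 \<le> size F" by (simp add: Suc_le_eq nonempty_has_size)
  then show "2 \<le> forest_nodes {#t#}" using size_le_forest_nodes[of F] by (simp add: t)
  show "1 \<le> forest_label_count 0 {#t#}"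
    using tree_label_count_pos[OF assms(2)] by (simp add: forest_label_count_def)
qed (use assms branched_diagonal[OF X] in auto)

lemma elem_field_translated_bullet: "elem_field fv (bullet 0) = tree_series_field f N (unit_series (bullet 0) + v 0)"
  using branched_field_eq'[OF unit_bullet_step[of 0]] by (simp add: fun_eq_iff elem_field_bullet fv)

lemma continuous_elem_field_fv:
  assumes "tree_nodes t \<le> level \<alpha>"
  shows "continuous_on UNIV (elem_field fv t)"
  by (rule C_class_continuous[where n = 0], rule C_class_elem_field[where f = fv, OF C_class_translated_field[OF f step_le]])
    (use assms level_le_diff in simp)

lemma branched_translation_ii:
  "branched_solution_flow T (min \<alpha> (1 / real N)) f (\<lambda>s t. M (X s t)) Y \<longleftrightarrow>
    branched_solution_flow T \<alpha> fv X Y"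
proof -
  let ?L = "level \<alpha>"
  define K where "K = max ?L N"
  have K: "nat \<lfloor>1 / min \<alpha> (1 / real N)\<rfloor> = K" unfolding K_def by (rule nat_floor_inverse_min[OF \<alpha>(1) N])
  have K': "?L \<le> K" "N \<le> K" "K \<le> Suc (?L + N - 2)" using nat_floor_inverse_pos[OF \<alpha>] N by (auto simp: K_def)
  have "has_local_expansion T (\<lambda>s t. branched_expansion (min \<alpha> (1 / real N)) f (M (X s t)))
    (\<lambda>s u y. y + (\<Sum>t\<in>trees_upto ?L. X s u {#t#} *\<^sub>R elem_field fv t y))"
  proof (rule branched_expansion_agree[OF f], unfold K)
    show "?L \<le> K" "K \<le> Suc (?L + N - 2)" by fact+
    fix t :: "'l rtree"
    \<comment> \<open>In the last case truncation at \<open>K\<close> may cut the translated tree,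
      and the smallness of the coefficient makes up for it.\<close>
    consider "tree_nodes t > ?L" | "tree_nodes t \<le> ?L" "0 \<notin> set_rtree t" | "t = bullet 0" |
      "tree_nodes t \<le> ?L" "0 \<in> set_rtree t" "t \<noteq> bullet 0" by linarith
    then show "tree_nodes t \<le> ?L \<and> tree_series_field f K (m (unit_series t)) = elem_field fv t \<or>
      higher_order T (\<lambda>s u. X s u {#t#}) \<and> (tree_nodes t \<le> ?L \<longrightarrow> continuous_on UNIV (elem_field fv t))"
    proof cases
      case 1
      then show ?thesis using branched_large_trees[OF X \<alpha>(1)] by auto
    next
      case 2
      have "tree_series_field f K (unit_series t) = elem_field f t"
        using 2 K' by (intro ext tree_series_field_unit) simp
      then show ?thesis
        using 2 tree_translation_no_zero[OF translation v0 2(2)] elem_field_no_zero[OF 2(2)] by metis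
    next
      case 3
      have "elem_field fv t = tree_series_field f K (unit_series (bullet 0) + v 0)"
        unfolding 3 elem_field_translated_bullet
        by (rule tree_series_field_extend) (use unit_bullet_step[of 0] K' in \<open>auto simp: branched_step_def\<close>)
      moreover have "tree_nodes t \<le> ?L" using 3 nat_floor_inverse_pos[OF \<alpha>] by simp
      ultimately show ?thesis using m(3)[of 0] 3 by metis
    next
      case 4
      then show ?thesis using singular_trees[OF 4] continuous_elem_field_fv by auto
    qed
  qed
  then have "has_local_expansion T (\<lambda>s t. branched_expansion (min \<alpha> (1 / real N)) f (M (X s t)))
    (\<lambda>s t. branched_expansion \<alpha> fv (X s t))"
    unfolding branched_expansion_elem_field[where g = fv, OF C_class_translated_field[OF f step_le] level_le_diff] .
  then show ?thesis
    by (simp add: branched_solution_flow_def has_local_expansion_cong_right)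
qed

lemma branched_translation_drift:
  "branched_solution_flow T \<alpha> fv X Y \<longleftrightarrow>
    branched_drift_solution_flow T \<alpha> f X (branched_field f N (v 0)) (\<lambda>t. X 0 t {#bullet 0#}) Y"
proof -
  let ?L = "level \<alpha>"
  let ?g = "branched_field f N (v 0)"
  \<comment> \<open>As for words, the drift sits on the single node \<open>bullet 0\<close>
    alone.\<close>
  let ?h = "\<lambda>t y. elem_field f t y + (if t = bullet 0 then ?g y else 0)"
  have g: "?g = tree_series_field f N (v 0)" by (rule branched_field_eq'[OF v])
  have "has_local_expansion T (\<lambda>s u y. \<Sum>t\<in>trees_upto ?L. X s u {#t#} *\<^sub>R elem_field fv t y)
    (\<lambda>s u y. \<Sum>t\<in>trees_upto ?L. X s u {#t#} *\<^sub>R ?h t y)"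
  proof (rule has_local_expansion_sum_agree[where X = "\<lambda>s u t. X s u {#t#}"])
    fix t :: "'l rtree" assume t: "t \<in> trees_upto ?L"
    consider "0 \<notin> set_rtree t" | "t = bullet 0" | "0 \<in> set_rtree t" "t \<noteq> bullet 0" by linarith
    then show "(\<forall>y. elem_field fv t y = ?h t y) \<or>
      higher_order T (\<lambda>s u. X s u {#t#}) \<and> continuous_on UNIV (elem_field fv t) \<and> continuous_on UNIV (?h t)"
    proof cases
      case 1
      then show ?thesis using elem_field_no_zero[OF 1] by auto
    next
      case 2
      have "elem_field fv t y = ?h t y" for y
      proof -
        have "tree_nodes (bullet (0 :: 'l)) \<le> N" using N by simp
        from tree_series_field_unit[OF this, of f y] show ?thesis
          unfolding 2 elem_field_translated_bullet tree_series_field_add g by simp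
      qed
      then show ?thesis by blast
    next
      case 3
      have "continuous_on UNIV (elem_field f t)"
        by (rule C_class_continuous[where n = 0], rule C_class_elem_field[where f = f, OF f])
          (use t level_le in simp)
      then have "continuous_on UNIV (?h t)" using 3 by simp
      then show ?thesis
        using singular_trees[of t] continuous_elem_field_fv[of t] t 3 by auto
    qed
  qed
  from has_local_expansion_add[OF has_local_expansion_zero[where A = "\<lambda>s u y. y"] this]
  have "has_local_expansion T (\<lambda>s t. branched_expansion \<alpha> fv (X s t))
    (\<lambda>s u y. y + (\<Sum>t\<in>trees_upto ?L. X s u {#t#} *\<^sub>R ?h t y))"
    unfolding branched_expansion_elem_field[where g = fv, OF C_class_translated_field[OF f step_le] level_le_diff] .
  moreover have "y + (\<Sum>t\<in>trees_upto ?L. X s u {#t#} *\<^sub>R ?h t y) =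
      branched_expansion \<alpha> f (X s u) y + (X 0 u {#bullet 0#} - X 0 s {#bullet 0#}) *\<^sub>R ?g y"
    if "0 \<le> s" "s \<le> u" "u \<le> T" for s u y
  proof -
    have "(\<Sum>t\<in>trees_upto ?L. X s u {#t#} *\<^sub>R ?h t y) =
        (\<Sum>t\<in>trees_upto ?L. X s u {#t#} *\<^sub>R elem_field f t y) +
        (\<Sum>t\<in>trees_upto ?L. if t = bullet (0 :: 'l) then X s u {#bullet 0#} *\<^sub>R ?g y else 0)"
      unfolding sum.distrib[symmetric]
      by (intro sum.cong refl) (auto simp: scaleR_add_right)
    then show ?thesis
      using nat_floor_inverse_pos[OF \<alpha>] branched_increment[OF X, of s u 0] that
      by (simp add: finite_trees_upto branched_expansion_elem_field[where g = f, OF f level_le])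
  qed
  ultimately have "has_local_expansion T (\<lambda>s t. branched_expansion \<alpha> fv (X s t))
    (\<lambda>s u y. branched_expansion \<alpha> f (X s u) y + (X 0 u {#bullet 0#} - X 0 s {#bullet 0#}) *\<^sub>R ?g y)"
    by (subst (asm) has_local_expansion_cong)
  then show ?thesis
    unfolding branched_solution_flow_def branched_drift_solution_flow_def
    by (simp add: has_local_expansion_cong_right)
qed

end

end

section \<open>Translations and rough differential equations\<close>

theorem theorem38:
  fixes \<alpha> T :: real and N :: nat
    and f :: "'l::{finite, zero} \<Rightarrow> real ^ 'e \<Rightarrow> real ^ 'e"
    and Y :: "real \<Rightarrow> real \<Rightarrow> real ^ 'e \<Rightarrow> real ^ 'e"
  assumes "0 < \<alpha>" "\<alpha> \<le> 1" "1 \<le> N"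
  shows
    "(\<forall>(X :: real \<Rightarrow> real \<Rightarrow> 'l tensor_series) v \<T>.
        weakly_geometric_rough_path T \<alpha> X \<longrightarrow>
        (\<forall>i. v i \<in> lie_step N) \<longrightarrow>
        is_geometric_translation v \<T> \<longrightarrow>
        (let fv = (\<lambda>i. lie_field f N (unit_series [i] + v i)) in
          ((\<forall>i. C_class (nat \<lfloor>real N / \<alpha>\<rfloor> - 1) (f i)) \<longrightarrow>
             (geometric_solution_flow T (\<alpha> / real N) f (\<lambda>s t. \<T> (X s t)) Y \<longleftrightarrow>
              geometric_solution_flow T \<alpha> fv X Y)) \<and>
          ((\<forall>i. C_class (nat \<lfloor>1 / \<alpha>\<rfloor> + N - 2) (f i)) \<longrightarrow>
           (\<forall>i. i \<noteq> 0 \<longrightarrow> v i = 0) \<longrightarrow>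
           zeroth_regular length (\<lambda>w. count_list w 0) T \<alpha> X \<longrightarrow>
             (geometric_solution_flow T (min \<alpha> (1 / real N)) f (\<lambda>s t. \<T> (X s t)) Y \<longleftrightarrow>
              geometric_solution_flow T \<alpha> fv X Y) \<and>
             (geometric_solution_flow T \<alpha> fv X Y \<longleftrightarrow>
              geometric_drift_solution_flow T \<alpha> f X
                (lie_field f N (v 0)) (\<lambda>t. X 0 t [0]) Y)))) \<and>
     (\<forall>(X :: real \<Rightarrow> real \<Rightarrow> 'l forest_series) v M.
        branched_rough_path T \<alpha> X \<longrightarrow>
        (\<forall>i. v i \<in> branched_step N) \<longrightarrow>
        is_branched_translation v M \<longrightarrow>
        (let fv = (\<lambda>i. branched_field f N (unit_series (bullet i) + v i)) in
          ((\<forall>i. C_class (nat \<lfloor>real N / \<alpha>\<rfloor> - 1) (f i)) \<longrightarrow>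
             (branched_solution_flow T (\<alpha> / real N) f (\<lambda>s t. M (X s t)) Y \<longleftrightarrow>
              branched_solution_flow T \<alpha> fv X Y)) \<and>
          ((\<forall>i. C_class (nat \<lfloor>1 / \<alpha>\<rfloor> + N - 2) (f i)) \<longrightarrow>
           (\<forall>i. i \<noteq> 0 \<longrightarrow> v i = 0) \<longrightarrow>
           zeroth_regular forest_nodes (forest_label_count 0) T \<alpha> X \<longrightarrow>
             (branched_solution_flow T (min \<alpha> (1 / real N)) f (\<lambda>s t. M (X s t)) Y \<longleftrightarrow>
              branched_solution_flow T \<alpha> fv X Y) \<and>
             (branched_solution_flow T \<alpha> fv X Y \<longleftrightarrow>
              branched_drift_solution_flow T \<alpha> f X
                (branched_field f N (v 0)) (\<lambda>t. X 0 t {#bullet 0#}) Y))))"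
proof (intro conjI allI impI, goal_cases)
  case (1 X v \<T>)
  define fv where "fv i = lie_field f N (unit_series [i] + v i)" for i
  note rules = assms 1(1) 1(2)[rule_format] 1(3) fv_def
  show ?case
    unfolding Let_def fv_def[abs_def, symmetric]
    by (intro conjI impI; rule geometric_translation_i[OF rules] geometric_translation_ii[OF rules]
        geometric_translation_drift[OF rules]; blast)
next
  case (2 X v M)
  define fv where "fv i = branched_field f N (unit_series (bullet i) + v i)" for i
  from 2(3) have M: "continuous_on UNIV M" "linear_series M" "M (unit_series {#}) = unit_series {#}"
      "\<And>x y. M (star_prod x y) = star_prod (M x) (M y)"
    unfolding is_branched_translation_def by blast+
  \<comment> \<open>The restriction of \<open>M\<close> to tree series is fixed as \<open>m\<close>,
    on which all results about branched translations are based.\<close>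
  from 2(3) obtain m where m: "\<And>x. M (forest_of_tree_series x) = forest_of_tree_series (m x)"
      "\<And>x y. m (tree_prelie x y) = tree_prelie (m x) (m y)"
      "\<And>i. m (unit_series (bullet i)) = unit_series (bullet i) + v i"
    unfolding is_branched_translation_def by blast
  note rules = assms 2(1) 2(2)[rule_format] M m fv_def
  show ?case
    unfolding Let_def fv_def[abs_def, symmetric]
    by (intro conjI impI; rule branched_translation_i[OF rules] branched_translation_ii[OF rules]
        branched_translation_drift[OF rules]; blast)
qed

end
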